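(* Suppose Assumptions 1, 2 and 3 hold and $\delta_{2r}=c_0/\sqrt r$ for a sufficiently small constant $c_0$. Let $U^{(\lambda)}$ satisfy the first- and second-order necessary conditions for a local minimum of $f^{(\lambda)}$ and let $Z^{(\lambda)}$ be a minimizer of $g^{(\lambda)}$. On the event $\mathcal{E}_{\mathsf{Good}}$, writing the singular value decomposition $U^{(\lambda)}=V_U\Sigma^{1/2}W_U^\top$ ($V_U\in\mathbb{R}^{d\times r}$ orthonormal columns, $\Sigma$ positive diagonal, $W_U$ orthogonal), one has \[ Z^{(\lambda)}_{\mathsf{deb}}=V_U(\Sigma+\lambda I)V_U^\top\qquad\text{and}\qquad U^{(\lambda)}_{\mathsf{deb}}U^{(\lambda)\top}_{\mathsf{deb}}=Z^{(\lambda)}_{\mathsf{deb}}. \]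
   Context: Setting. Let $d,n,r$ be positive integers and $\sigma>0$. $\mathsf{GOE}(d)$ denotes the law of a symmetric $d\times d$ matrix whose diagonal entries are i.i.d. $N(0,1)$ and whose entries above the diagonal are i.i.d. $N(0,1/2)$, independent of the diagonal. One observes $(y_i,X_i)$, $i=1,\dots,n$, with $y_i=n^{-1/2}\langle X_i,M\rangle+\varepsilon_i$, where $\langle\cdot,\cdot\rangle$ is the Frobenius inner product, $X_i\sim\mathsf{GOE}(d)$, $\varepsilon_i\sim N(0,\sigma^2)$, all mutually independent, and $M$ is a symmetric positive semidefinite matrix of rank $r$. Define $\mathcal{X}(A)_i=n^{-1/2}\langle X_i,A\rangle$. $g^{(\lambda)}(Z)=\frac12\sum_{i=1}^n(y_i-n^{-1/2}\langle X_i,Z\rangle)^2+\lambda\|Z\|_*$ (minimized over positive semidefinite $Z$) and, for $U\in\mathbb{R}^{d\times r}$, $f^{(\lambda)}(U)=\frac14\sum_{i=1}^n(y_i-n^{-1/2}\langle X_i,UU^\top\rangle)^2+\frac{\lambda}{2}\|U\|_F^2$. Debiased estimators: $Z^{(\lambda)}_{\mathsf{deb}}=\mathcal{P}_{\mathrm{rank}-r}\big(Z^{(\lambda)}+\frac{1}{\sqrt n}\sum_{i=1}^n(y_i-n^{-1/2}\langle X_i,Z^{(\lambda)}\rangle)X_i\big)$, where $\mathcal{P}_{\mathrm{rank}-r}$ is the best rank-$r$ approximation; $U^{(\lambda)}_{\mathsf{deb}}=U^{(\lambda)}\big(I+\lambda(U^{(\lambda)\top}U^{(\lambda)})^{-1}\big)^{1/2}$.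 Assumption 1: $M=\sqrt d\,V\Lambda V^\top$ with $V\in\mathbb{R}^{d\times r}$ having orthonormal columns and $\Lambda$ an $r\times r$ positive diagonal matrix whose smallest entry $\lambda_r$ satisfies $C_1\sqrt r<\lambda_r/\sigma<C_2\sqrt r$ for sufficiently large constants $C_1,C_2$; moreover $\|M\|/(\lambda_r\sqrt d)\le\kappa$ with $\kappa=O(1)$, and $\sigma\ge\sigma_{\min}>c>0$. Assumption 2: $\gamma_n:=n/(dr)$ satisfies $\gamma_n\ge C_3 r$ for a sufficiently large constant $C_3$. Assumption 3: $C_4\sqrt d\le\lambda/\sigma\le C_5\sqrt d$ for constants $C_4,C_5$. For a fixed constant $\delta_{2r}>0$, $\mathcal{E}_{\mathsf{Good}}$ is the intersection of the events: (i) $\|\frac1n\sum_i\varepsilon_iX_i\|\le 8\sigma\sqrt{d/n}$ (spectral norm); (ii) $(1-\delta_{2r})\|A\|_F^2\le\|\mathcal{X}(A)\|^2\le(1+\delta_{2r})\|A\|_F^2$ for all symmetric $A$ of rank at most $2r$; (iii) $|\frac1n\sum_i\varepsilon_i\langle X_i,A\rangle|\le C\sigma\sqrt{dr/n}\,\|A\|_F$ for all symmetric $A$ of rank at most $2r$.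
   Formalization: Assumption 3 is read with C_4 sufficiently large (so that λ dominates the noise level 8σ√d); for small C_4 the claim fails. C_1 may depend on C_5, and c_0 on the other constants. *)

theory Defs
  imports "HOL-Analysis.Analysis" "Jordan_Normal_Form.Jordan_Normal_Form" "Jordan_Normal_Form.DL_Rank"
begin

definition frob_inner :: "real mat \<Rightarrow> real mat \<Rightarrow> real" where
  "frob_inner A B = (\<Sum>i<dim_row A. \<Sum>j<dim_col A. A $$ (i,j) * B $$ (i,j))"

definition frob_norm :: "real mat \<Rightarrow> real" where
  "frob_norm A = sqrt (frob_inner A A)"

definition vnorm :: "real vec \<Rightarrow> real" where
  "vnorm x = sqrt (x \<bullet> x)"

definition spec_norm :: "real mat \<Rightarrow> real" where
  "spec_norm A = Sup {vnorm (A *\<^sub>v x) | x. x \<in> carrier_vec (dim_col A) \<and> vnorm x = 1}"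

text \<open>Nuclear norm: sum of the singular values, i.e. of the square roots of the
  eigenvalues of A^T A counted with algebraic multiplicity.\<close>
definition nuc_norm :: "real mat \<Rightarrow> real" where
  "nuc_norm A = (\<Sum>\<mu>\<in>{\<mu>. eigenvalue (A\<^sup>T * A) \<mu>}.
      real (Polynomial.order \<mu> (char_poly (A\<^sup>T * A))) * sqrt \<mu>)"

definition mrank :: "real mat \<Rightarrow> nat" where
  "mrank A = vec_space.rank (dim_row A) A"

definition sym_mat :: "nat \<Rightarrow> real mat \<Rightarrow> bool" where
  "sym_mat d A \<longleftrightarrow> A \<in> carrier_mat d d \<and> A\<^sup>T = A"

definition psd_mat :: "nat \<Rightarrow> real mat \<Rightarrow> bool" where
  "psd_mat d A \<longleftrightarrow> sym_mat d A \<and> (\<forall>x\<in>carrier_vec d. x \<bullet> (A *\<^sub>v x) \<ge> 0)"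

definition mat_inv :: "nat \<Rightarrow> real mat \<Rightarrow> real mat" where
  "mat_inv k A = (THE B. B \<in> carrier_mat k k \<and> A * B = 1\<^sub>m k \<and> B * A = 1\<^sub>m k)"

definition psd_sqrt :: "nat \<Rightarrow> real mat \<Rightarrow> real mat" where
  "psd_sqrt k A = (THE B. psd_mat k B \<and> B * B = A)"

definition best_rank_approx :: "nat \<Rightarrow> real mat \<Rightarrow> real mat \<Rightarrow> bool" where
  "best_rank_approx r A Y \<longleftrightarrow>
     Y \<in> carrier_mat (dim_row A) (dim_col A) \<and> mrank Y \<le> r \<and>
     (\<forall>Y'\<in>carrier_mat (dim_row A) (dim_col A). mrank Y' \<le> r \<longrightarrow>
        frob_norm (A - Y) \<le> frob_norm (A - Y'))"

definition obs :: "nat \<Rightarrow> (nat \<Rightarrow> real mat) \<Rightarrow> real mat \<Rightarrow> (nat \<Rightarrow> real) \<Rightarrow> nat \<Rightarrow> real" where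
  "obs n X M eps i = frob_inner (X i) M / sqrt (real n) + eps i"

definition g_obj :: "nat \<Rightarrow> (nat \<Rightarrow> real mat) \<Rightarrow> (nat \<Rightarrow> real) \<Rightarrow> real \<Rightarrow> real mat \<Rightarrow> real" where
  "g_obj n X y lam Z = (1/2) * (\<Sum>i<n. (y i - frob_inner (X i) Z / sqrt (real n))\<^sup>2) + lam * nuc_norm Z"

definition f_obj :: "nat \<Rightarrow> (nat \<Rightarrow> real mat) \<Rightarrow> (nat \<Rightarrow> real) \<Rightarrow> real \<Rightarrow> real mat \<Rightarrow> real" where
  "f_obj n X y lam U = (1/4) * (\<Sum>i<n. (y i - frob_inner (X i) (U * U\<^sup>T) / sqrt (real n))\<^sup>2)
                       + (lam/2) * (frob_norm U)\<^sup>2"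

definition g_minimizer :: "nat \<Rightarrow> nat \<Rightarrow> (nat \<Rightarrow> real mat) \<Rightarrow> (nat \<Rightarrow> real) \<Rightarrow> real \<Rightarrow> real mat \<Rightarrow> bool" where
  "g_minimizer d n X y lam Z \<longleftrightarrow> psd_mat d Z \<and>
     (\<forall>Z'. psd_mat d Z' \<longrightarrow> g_obj n X y lam Z \<le> g_obj n X y lam Z')"

text \<open>First- and second-order necessary conditions for a local minimum of f at U
  (zero gradient, positive semidefinite Hessian), expressed along every direction D.\<close>
definition f_stationary_2nd :: "nat \<Rightarrow> nat \<Rightarrow> nat \<Rightarrow> (nat \<Rightarrow> real mat) \<Rightarrow> (nat \<Rightarrow> real) \<Rightarrow> real \<Rightarrow> real mat \<Rightarrow> bool" where
  "f_stationary_2nd d r n X y lam U \<longleftrightarrow> U \<in> carrier_mat d r \<and>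
     (\<forall>D\<in>carrier_mat d r.
        ((\<lambda>t. f_obj n X y lam (U + t \<cdot>\<^sub>m D)) has_real_derivative 0) (at 0) \<and>
        deriv (deriv (\<lambda>t. f_obj n X y lam (U + t \<cdot>\<^sub>m D))) 0 \<ge> 0)"

definition deb_input :: "nat \<Rightarrow> nat \<Rightarrow> (nat \<Rightarrow> real mat) \<Rightarrow> (nat \<Rightarrow> real) \<Rightarrow> real mat \<Rightarrow> real mat" where
  "deb_input d n X y Z = Z + Matrix.mat d d (\<lambda>(a,b).
      (\<Sum>i<n. (y i - frob_inner (X i) Z / sqrt (real n)) * (X i) $$ (a,b)) / sqrt (real n))"

definition U_deb :: "nat \<Rightarrow> real \<Rightarrow> real mat \<Rightarrow> real mat" where
  "U_deb r lam U = U * psd_sqrt r (1\<^sub>m r + lam \<cdot>\<^sub>m mat_inv r (U\<^sup>T * U))"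

definition good_event :: "nat \<Rightarrow> nat \<Rightarrow> nat \<Rightarrow> real \<Rightarrow> real \<Rightarrow> real \<Rightarrow> (nat \<Rightarrow> real mat) \<Rightarrow> (nat \<Rightarrow> real) \<Rightarrow> bool" where
  "good_event d n r \<sigma> \<delta> C X eps \<longleftrightarrow>
     spec_norm (Matrix.mat d d (\<lambda>(a,b). (\<Sum>i<n. eps i * (X i) $$ (a,b)) / real n)) \<le> 8 * \<sigma> * sqrt (real d / real n) \<and>
     (\<forall>A. sym_mat d A \<and> mrank A \<le> 2*r \<longrightarrow>
        (1 - \<delta>) * (frob_norm A)\<^sup>2 \<le> (\<Sum>i<n. (frob_inner (X i) A / sqrt (real n))\<^sup>2) \<and>
        (\<Sum>i<n. (frob_inner (X i) A / sqrt (real n))\<^sup>2) \<le> (1 + \<delta>) * (frob_norm A)\<^sup>2) \<and>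
     (\<forall>A. sym_mat d A \<and> mrank A \<le> 2*r \<longrightarrow>
        \<bar>(\<Sum>i<n. eps i * frob_inner (X i) A) / real n\<bar> \<le> C * \<sigma> * sqrt (real d * real r / real n) * frob_norm A)"

definition svd_form :: "nat \<Rightarrow> nat \<Rightarrow> real mat \<Rightarrow> real mat \<Rightarrow> (nat \<Rightarrow> real) \<Rightarrow> real mat \<Rightarrow> bool" where
  "svd_form d r U VU s W \<longleftrightarrow>
     VU \<in> carrier_mat d r \<and> VU\<^sup>T * VU = 1\<^sub>m r \<and> (\<forall>i<r. s i > 0) \<and>
     W \<in> carrier_mat r r \<and> W\<^sup>T * W = 1\<^sub>m r \<and>
     U = VU * mat_diag r (\<lambda>i. sqrt (s i)) * W\<^sup>T"

end

theory Submission
  imports Defs "Jordan_Normal_Form.Spectral_Radius"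
begin

text \<open>Write \<open>\<Delta> = U U\<^sup>T - M\<close> and let \<open>G\<close> be the back-projection of the residuals of \<open>U\<close>, so that stationarity
  reads \<open>G U = \<lambda> U\<close>. The second-order condition in the direction \<open>U - L\<close>, where \<open>M = L L\<^sup>T\<close> and \<open>L\<close> is
  rotated so that \<open>U\<^sup>T L\<close> is positive semidefinite, together with the restricted isometry property yields
  \<open>\<parallel>\<Delta>\<parallel>\<^sub>F = O(\<sigma> \<surd>(d r))\<close>; hence \<open>U\<close> has full rank. As \<open>\<delta> = c\<^sub>0 / \<surd>r\<close>, it follows that \<open>G = H - \<Delta>\<close> with an
  operator norm \<open>\<parallel>H\<parallel> \<le> 9 \<sigma> \<surd>d\<close>, and a Schur complement argument bounds \<open>G\<close> on the orthogonal complement of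
  the columns of \<open>U\<close> by \<open>10 \<sigma> \<surd>d < \<lambda>\<close>. So \<open>\<lambda> I - G\<close> is a strict dual certificate: \<open>U U\<^sup>T\<close> is the only
  minimizer of the convex problem, the argument of the rank-\<open>r\<close> projection is
  \<open>V\<^sub>U (\<Sigma> + \<lambda> I) V\<^sub>U\<^sup>T\<close> plus an orthogonal part of norm less than \<open>\<lambda>\<close>, and the projection removes the latter.\<close>

text \<open>The obstacle is a factor \<open>sqrt r\<close> between norms. The Frobenius bound on
  \<Delta> is \<open>K * \<sigma> * sqrt (d * r)\<close> with K at least 12 * C5, hence at least 12
  \<lambda>. For x orthogonal to the columns of U, bounding x^T M x = - x^T \<Delta> x by it proves
  nothing. The Schur complement uses G U = \<lambda> U exactly and replaces this bound by h^2 / (m -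
  e), where h bounds the form of H, m is the smallest eigenvalue of M on its range and e is the
  Frobenius bound. In H the isometry defect costs only \<delta> times e, and the scaling of \<delta>
  cancels the \<open>sqrt r\<close>.

  In units of b = \<sigma> \<open>sqrt d\<close>: the noise contributes 8 b and the defect at most
  b, so h = 9 b. Asking for m - e > 81 b makes h^2 / (m - e) at most b, which gives 10 b on the
  complement; \<lambda> at least 11 b leaves room for strictness. The constant K = 14 C + 12 C5 of
  the Frobenius error then dictates C1 >= K + 81 and 2 c0 K <= 1.\<close>

notation frob_inner (infixl "\<bullet>\<^sub>F" 66)

section \<open>The Frobenius inner product\<close>

lemma mat_mult_assoc:
  "dim_col A = dim_row B \<Longrightarrow> dim_col B = dim_row C \<Longrightarrow> A * B * C = A * (B * (C :: real mat))"
  by (rule assoc_mult_mat[of _ "dim_row A" "dim_col A" _ "dim_col B" _ "dim_col C"]) auto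

lemma mat_transpose_mult:
  "dim_col A = dim_row B \<Longrightarrow> (A * B)\<^sup>T = B\<^sup>T * (A :: real mat)\<^sup>T"
  by (rule transpose_mult[of _ "dim_row A" "dim_col A" _ "dim_col B"]) auto

lemma mat_transpose_add:
  "dim_row A = dim_row B \<Longrightarrow> dim_col A = dim_col B \<Longrightarrow> (A + B)\<^sup>T = A\<^sup>T + (B :: real mat)\<^sup>T"
  by (rule eq_matI) auto

lemma mat_transpose_minus:
  "dim_row A = dim_row B \<Longrightarrow> dim_col A = dim_col B \<Longrightarrow> (A - B)\<^sup>T = A\<^sup>T - (B :: real mat)\<^sup>T"
  by (rule eq_matI) auto

lemma mat_transpose_smult: "(c \<cdot>\<^sub>m A)\<^sup>T = c \<cdot>\<^sub>m (A :: real mat)\<^sup>T"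
  by (rule eq_matI) auto

lemma mat_add_mult:
  "dim_row A = dim_row B \<Longrightarrow> dim_col A = dim_col B \<Longrightarrow> dim_col B = dim_row C \<Longrightarrow>
    (A + B) * C = A * C + B * (C :: real mat)"
  by (rule add_mult_distrib_mat[of _ "dim_row A" "dim_col A" _ _ "dim_col C"]) auto

lemma mat_mult_add:
  "dim_row B = dim_row C \<Longrightarrow> dim_col B = dim_col C \<Longrightarrow> dim_col A = dim_row C \<Longrightarrow>
    A * (B + C) = A * B + A * (C :: real mat)"
  by (rule mult_add_distrib_mat[of _ "dim_row A" "dim_col A" _ "dim_col C"]) auto

lemma mat_minus_mult:
  "dim_row A = dim_row B \<Longrightarrow> dim_col A = dim_col B \<Longrightarrow> dim_col B = dim_row C \<Longrightarrow>
    (A - B) * C = A * C - B * (C :: real mat)"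
  by (rule minus_mult_distrib_mat[of _ "dim_row A" "dim_col A" _ _ "dim_col C"]) auto

lemma mat_mult_minus:
  "dim_row B = dim_row C \<Longrightarrow> dim_col B = dim_col C \<Longrightarrow> dim_col A = dim_row C \<Longrightarrow>
    A * (B - C) = A * B - A * (C :: real mat)"
  by (rule mult_minus_distrib_mat[of _ "dim_row A" "dim_col A" _ "dim_col C"]) auto

lemma mat_smult_mult: "dim_col A = dim_row B \<Longrightarrow> (c \<cdot>\<^sub>m A) * B = c \<cdot>\<^sub>m (A * (B :: real mat))"
  by (rule mult_smult_assoc_mat[of _ "dim_row A" "dim_col A" _ "dim_col B"]) auto

lemma mat_mult_smult: "dim_col A = dim_row B \<Longrightarrow> A * (c \<cdot>\<^sub>m B) = c \<cdot>\<^sub>m (A * (B :: real mat))"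
  by (rule mult_smult_distrib[of _ "dim_row A" "dim_col A" _ "dim_col B"]) auto

lemma mat_one_mult: "dim_row A = n \<Longrightarrow> 1\<^sub>m n * A = (A :: real mat)"
  by (rule left_mult_one_mat') auto

lemma mat_mult_one: "dim_col A = n \<Longrightarrow> A * 1\<^sub>m n = (A :: real mat)"
  by (rule right_mult_one_mat') auto

lemma mat_zero_mult: "dim_row A = n \<Longrightarrow> 0\<^sub>m m n * A = 0\<^sub>m m (dim_col (A :: real mat))"
  by (rule left_mult_zero_mat[of _ n "dim_col A"]) auto

lemma mat_mult_zero: "dim_col A = n \<Longrightarrow> A * 0\<^sub>m n m = 0\<^sub>m (dim_row (A :: real mat)) m"
  by (rule right_mult_zero_mat[of _ "dim_row A" n]) auto

lemma mat_diag_transpose [simp]: "(mat_diag n f)\<^sup>T = mat_diag n f"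
  unfolding mat_diag_def by (rule eq_matI) auto

lemma dim_mat_diag [simp]: "dim_row (mat_diag n f) = n" "dim_col (mat_diag n f) = n"
  unfolding mat_diag_def by auto

text \<open>Normal form: products nested to the right, transposes pushed inward, sums expanded,
  scalars in front. The side conditions are equations between dimensions, which conditional
  rewriting can discharge; carrier premises would leave dimension variables uninstantiated.\<close>

lemmas mat_normalize = mat_mult_assoc mat_transpose_mult mat_transpose_add mat_transpose_minus
  mat_transpose_smult mat_add_mult mat_mult_add mat_minus_mult mat_mult_minus mat_smult_mult
  mat_mult_smult mat_one_mult mat_mult_one mat_zero_mult mat_mult_zero

lemma mat_eq_iff_minus_zero:
  fixes A B :: "real mat"
  assumes "A \<in> carrier_mat m n" "B \<in> carrier_mat m n"
  shows "A = B \<longleftrightarrow> A - B = 0\<^sub>m m n"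
proof
  assume *: "A - B = 0\<^sub>m m n"
  have "A $$ (i,j) = B $$ (i,j)" if "i < m" "j < n" for i j
  proof -
    have "(A - B) $$ (i,j) = 0" using * that by simp
    then show ?thesis using assms that by simp
  qed
  then show "A = B" using assms by (intro eq_matI) auto
qed (use assms in auto)

lemma mult_mat_entry:
  "i < dim_row A \<Longrightarrow> j < dim_col B \<Longrightarrow> dim_col A = dim_row B \<Longrightarrow>
    (A * B) $$ (i,j) = (\<Sum>k<dim_row B. A $$ (i,k) * (B :: real mat) $$ (k,j))"
  by (simp add: scalar_prod_def atLeast0LessThan)

lemma frob_inner_commute:
  "dim_row A = dim_row B \<Longrightarrow> dim_col A = dim_col B \<Longrightarrow> A \<bullet>\<^sub>F B = B \<bullet>\<^sub>F A"
  by (simp add: frob_inner_def mult.commute)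

lemma frob_inner_add_left:
  "dim_row A = dim_row B \<Longrightarrow> dim_col A = dim_col B \<Longrightarrow> (A + B) \<bullet>\<^sub>F C = A \<bullet>\<^sub>F C + B \<bullet>\<^sub>F C"
  by (simp add: frob_inner_def sum.distrib algebra_simps)

lemma frob_inner_minus_left:
  "dim_row A = dim_row B \<Longrightarrow> dim_col A = dim_col B \<Longrightarrow> (A - B) \<bullet>\<^sub>F C = A \<bullet>\<^sub>F C - B \<bullet>\<^sub>F C"
  by (simp add: frob_inner_def sum_subtractf algebra_simps)

lemma frob_inner_smult_left: "(c \<cdot>\<^sub>m A) \<bullet>\<^sub>F B = c * (A \<bullet>\<^sub>F B)"
  by (simp add: frob_inner_def sum_distrib_left algebra_simps)

lemma frob_inner_add_right:
  "dim_row A = dim_row B \<Longrightarrow> dim_col A = dim_col B \<Longrightarrow> dim_row B = dim_row C \<Longrightarrow> dim_col B = dim_col C \<Longrightarrow>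
    A \<bullet>\<^sub>F (B + C) = A \<bullet>\<^sub>F B + A \<bullet>\<^sub>F C"
  by (simp add: frob_inner_def sum.distrib algebra_simps)

lemma frob_inner_minus_right:
  "dim_row A = dim_row B \<Longrightarrow> dim_col A = dim_col B \<Longrightarrow> dim_row B = dim_row C \<Longrightarrow> dim_col B = dim_col C \<Longrightarrow>
    A \<bullet>\<^sub>F (B - C) = A \<bullet>\<^sub>F B - A \<bullet>\<^sub>F C"
  by (simp add: frob_inner_def sum_subtractf algebra_simps)

lemma frob_inner_smult_right:
  "dim_row A = dim_row B \<Longrightarrow> dim_col A = dim_col B \<Longrightarrow> A \<bullet>\<^sub>F (c \<cdot>\<^sub>m B) = c * (A \<bullet>\<^sub>F B)"
  by (simp add: frob_inner_def sum_distrib_left algebra_simps)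

lemma frob_inner_zero [simp]: "0\<^sub>m m n \<bullet>\<^sub>F A = 0" "dim_row A = m \<Longrightarrow> dim_col A = n \<Longrightarrow> A \<bullet>\<^sub>F 0\<^sub>m m n = 0"
  by (auto simp: frob_inner_def)

lemmas frob_inner_linear = frob_inner_add_left frob_inner_minus_left frob_inner_smult_left
  frob_inner_add_right frob_inner_minus_right frob_inner_smult_right

lemma frob_inner_transpose:
  assumes "dim_row A = dim_row B" "dim_col A = dim_col B"
  shows "A\<^sup>T \<bullet>\<^sub>F B\<^sup>T = A \<bullet>\<^sub>F B"
  unfolding frob_inner_def using assms by simp (rule sum.swap)

text \<open>Adjointness of left multiplication. Together with the right-hand version it takes the
  place of the cyclicity of the trace.\<close>

lemma frob_inner_mult_left:
  assumes "dim_row A = dim_row C" "dim_col A = dim_row B" "dim_col B = dim_col C"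
  shows "(A * B) \<bullet>\<^sub>F C = B \<bullet>\<^sub>F (A\<^sup>T * C)"
proof -
  have "(A * B) \<bullet>\<^sub>F C = (\<Sum>i<dim_row A. \<Sum>j<dim_col B. \<Sum>k<dim_row B. A $$ (i,k) * B $$ (k,j) * C $$ (i,j))"
    unfolding frob_inner_def using assms by (simp add: mult_mat_entry sum_distrib_right del: index_mult_mat(1))
  also have "\<dots> = (\<Sum>j<dim_col B. \<Sum>i<dim_row A. \<Sum>k<dim_row B. A $$ (i,k) * B $$ (k,j) * C $$ (i,j))"
    by (rule sum.swap)
  also have "\<dots> = (\<Sum>j<dim_col B. \<Sum>k<dim_row B. \<Sum>i<dim_row A. A $$ (i,k) * B $$ (k,j) * C $$ (i,j))"
    by (intro sum.cong refl sum.swap)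
  also have "\<dots> = (\<Sum>k<dim_row B. \<Sum>j<dim_col B. \<Sum>i<dim_row A. A $$ (i,k) * B $$ (k,j) * C $$ (i,j))"
    by (rule sum.swap)
  also have "\<dots> = B \<bullet>\<^sub>F (A\<^sup>T * C)"
    unfolding frob_inner_def using assms
    by (simp add: mult_mat_entry sum_distrib_left algebra_simps del: index_mult_mat(1))
  finally show ?thesis .
qed

lemma frob_inner_mult_right:
  assumes "dim_row A = dim_row C" "dim_col A = dim_row B" "dim_col B = dim_col C"
  shows "(A * B) \<bullet>\<^sub>F C = A \<bullet>\<^sub>F (C * B\<^sup>T)"
proof -
  have "(A * B) \<bullet>\<^sub>F C = (B\<^sup>T * A\<^sup>T) \<bullet>\<^sub>F C\<^sup>T"
    using assms by (simp add: mat_transpose_mult[symmetric] frob_inner_transpose)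
  also have "\<dots> = A\<^sup>T \<bullet>\<^sub>F (C * B\<^sup>T)\<^sup>T"
    using assms by (subst frob_inner_mult_left) (auto simp: mat_transpose_mult)
  also have "\<dots> = A \<bullet>\<^sub>F (C * B\<^sup>T)" using assms by (simp add: frob_inner_transpose)
  finally show ?thesis .
qed

lemma frob_inner_nonneg [simp]: "0 \<le> A \<bullet>\<^sub>F A"
  unfolding frob_inner_def by (intro sum_nonneg) simp

lemma frob_inner_eq_0_iff: "A \<bullet>\<^sub>F A = 0 \<longleftrightarrow> A = 0\<^sub>m (dim_row A) (dim_col A)"
proof
  assume *: "A \<bullet>\<^sub>F A = 0"
  have "A $$ (i,j) = 0" if "i < dim_row A" "j < dim_col A" for i j
  proof -
    have "(\<Sum>j<dim_col A. A $$ (i,j) * A $$ (i,j)) = 0"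
      using * that unfolding frob_inner_def
      by (subst (asm) sum_nonneg_eq_0_iff) (auto intro!: sum_nonneg)
    then show ?thesis using that by (subst (asm) sum_nonneg_eq_0_iff) auto
  qed
  then show "A = 0\<^sub>m (dim_row A) (dim_col A)" by (intro eq_matI) auto
next
  assume *: "A = 0\<^sub>m (dim_row A) (dim_col A)"
  show "A \<bullet>\<^sub>F A = 0" by (subst *) simp
qed

lemma frob_norm_nonneg [simp]: "0 \<le> frob_norm A" by (simp add: frob_norm_def)

lemma frob_norm_sq: "(frob_norm A)\<^sup>2 = A \<bullet>\<^sub>F A" by (simp add: frob_norm_def)

text \<open>The common engine of Cauchy-Schwarz, of the polarized form bound and of the polarized
  isometry property. No sign of \<open>a\<close> is assumed, so negative and vanishing leading
  coefficients have to be excluded or treated inside.\<close>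

lemma nonneg_quadratic_discriminant:
  fixes a b c :: real
  assumes "\<And>t. 0 \<le> a * t\<^sup>2 + 2 * b * t + c"
  shows "b\<^sup>2 \<le> a * c"
proof (cases "a = 0")
  case True
  have "b = 0"
  proof (rule ccontr)
    assume "b \<noteq> 0"
    then show False using assms[of "- (c + 1) / (2 * b)"] True by (simp add: field_simps)
  qed
  then show ?thesis using True by simp
next
  case False
  have "0 \<le> a"
  proof (rule ccontr)
    assume "\<not> 0 \<le> a"
    \<comment> \<open>With this t the term a * t^2 outweighs the linear and constant terms, and the
      quadratic drops to at most - t.\<close>
    define t where "t = max 1 ((\<bar>c\<bar> + 2 * \<bar>b\<bar> + 1) / (- a))"
    have t: "1 \<le> t" "\<bar>c\<bar> + 2 * \<bar>b\<bar> + 1 \<le> - a * t"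
      using \<open>\<not> 0 \<le> a\<close> unfolding t_def by (auto simp: field_simps max_def)
    have "a * t\<^sup>2 = - ((- a * t) * t)" by (simp add: power2_eq_square)
    also have "\<dots> \<le> - ((\<bar>c\<bar> + 2 * \<bar>b\<bar> + 1) * t)"
      using t by (intro le_imp_neg_le mult_right_mono) auto
    finally have "a * t\<^sup>2 + 2 * b * t + c \<le> - ((\<bar>c\<bar> + 2 * \<bar>b\<bar> + 1) * t) + 2 * \<bar>b\<bar> * t + \<bar>c\<bar> * t"
      using t(1) mult_right_mono[of "2 * b" "2 * \<bar>b\<bar>" t] mult_left_mono[of 1 t "\<bar>c\<bar>"] by linarith
    also have "\<dots> = - t" by (simp add: algebra_simps)
    finally show False using assms[of t] t(1) by linarith
  qed
  then have "0 < a" using False by simp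
  have "0 \<le> a * (a * (- b / a)\<^sup>2 + 2 * b * (- b / a) + c)"
    using assms[of "- b / a"] \<open>0 \<le> a\<close> by (rule mult_nonneg_nonneg[rotated])
  also have "\<dots> = a * c - b\<^sup>2" using \<open>0 < a\<close> by (simp add: field_simps power2_eq_square)
  finally show ?thesis by simp
qed

lemma frob_Cauchy_Schwarz:
  assumes "dim_row A = dim_row B" "dim_col A = dim_col B"
  shows "\<bar>A \<bullet>\<^sub>F B\<bar> \<le> frob_norm A * frob_norm B"
proof -
  have "(A \<bullet>\<^sub>F B)\<^sup>2 \<le> (B \<bullet>\<^sub>F B) * (A \<bullet>\<^sub>F A)"
  proof (rule nonneg_quadratic_discriminant)
    fix t
    have "0 \<le> (A + t \<cdot>\<^sub>m B) \<bullet>\<^sub>F (A + t \<cdot>\<^sub>m B)" by simp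
    then show "0 \<le> (B \<bullet>\<^sub>F B) * t\<^sup>2 + 2 * (A \<bullet>\<^sub>F B) * t + A \<bullet>\<^sub>F A"
      using assms by (simp add: frob_inner_linear frob_inner_commute[of B A] algebra_simps power2_eq_square)
  qed
  also have "\<dots> = (frob_norm A * frob_norm B)\<^sup>2"
    by (simp add: power_mult_distrib frob_norm_sq)
  finally show ?thesis by (simp add: power2_le_iff_abs_le)
qed

section \<open>Quadratic forms\<close>

text \<open>Vectors are handled as matrices with one column, so that one inner product serves
  vectors and matrices. This is the bridge to \<open>psd_mat\<close>, which is stated with genuine
  vectors.\<close>

lemma vec_quadratic_form:
  assumes "A \<in> carrier_mat d d" "x \<in> carrier_vec d"
  shows "mat_of_cols d [x] \<bullet>\<^sub>F (A * mat_of_cols d [x]) = x \<bullet> (A *\<^sub>v x)"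
  using assms unfolding frob_inner_def
  by (simp add: scalar_prod_def mat_of_cols_def atLeast0LessThan)

lemma quadratic_form_cols:
  assumes "A \<in> carrier_mat d d" "Y \<in> carrier_mat d k"
  shows "Y \<bullet>\<^sub>F (A * Y) = (\<Sum>j<k. col Y j \<bullet> (A *\<^sub>v col Y j))"
proof -
  have "Y \<bullet>\<^sub>F (A * Y) = (\<Sum>i<d. \<Sum>j<k. Y $$ (i,j) * (\<Sum>l<d. A $$ (i,l) * Y $$ (l,j)))"
    unfolding frob_inner_def using assms by (simp add: mult_mat_entry del: index_mult_mat(1))
  also have "\<dots> = (\<Sum>j<k. \<Sum>i<d. Y $$ (i,j) * (\<Sum>l<d. A $$ (i,l) * Y $$ (l,j)))" by (rule sum.swap)
  also have "\<dots> = (\<Sum>j<k. col Y j \<bullet> (A *\<^sub>v col Y j))"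
    using assms by (simp add: scalar_prod_def atLeast0LessThan)
  finally show ?thesis .
qed

lemma frob_inner_cols:
  assumes "Y \<in> carrier_mat d k"
  shows "Y \<bullet>\<^sub>F Y = (\<Sum>j<k. col Y j \<bullet> col Y j)"
  using quadratic_form_cols[of "1\<^sub>m d" d Y k] assms by simp

lemma psd_mat_quadratic_form:
  "psd_mat d A \<Longrightarrow> Y \<in> carrier_mat d k \<Longrightarrow> 0 \<le> Y \<bullet>\<^sub>F (A * Y)"
  by (subst quadratic_form_cols[of A d Y k]) (auto simp: psd_mat_def sym_mat_def intro!: sum_nonneg)

lemma psd_matI:
  assumes "A \<in> carrier_mat d d" "A\<^sup>T = A" "\<And>Y. Y \<in> carrier_mat d 1 \<Longrightarrow> 0 \<le> Y \<bullet>\<^sub>F (A * Y)"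
  shows "psd_mat d A"
proof -
  have "0 \<le> x \<bullet> (A *\<^sub>v x)" if "x \<in> carrier_vec d" for x
    using assms(3)[of "mat_of_cols d [x]"] vec_quadratic_form[OF assms(1) that]
      mat_of_cols_carrier(1)[of d "[x]"] by simp
  then show ?thesis using assms by (simp add: psd_mat_def sym_mat_def)
qed

section \<open>Spectral and singular value decompositions\<close>

definition orth_mat :: "nat \<Rightarrow> real mat \<Rightarrow> bool" where
  "orth_mat n Q \<longleftrightarrow> Q \<in> carrier_mat n n \<and> Q\<^sup>T * Q = 1\<^sub>m n"

lemma orth_matD:
  assumes "orth_mat n Q"
  shows "dim_row Q = n" "dim_col Q = n" "Q\<^sup>T * Q = 1\<^sub>m n" "Q * Q\<^sup>T = 1\<^sub>m n"
  using assms mat_mult_left_right_inverse[of "Q\<^sup>T" n Q] unfolding orth_mat_def by auto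

text \<open>In right-nested normal form A * B is not a subterm of A * (B * Y), so an identity for A
  * B must be extended by a tail Y before it can rewrite.\<close>

lemma mat_mult_cancel_left:
  "A * B = C \<Longrightarrow> dim_col A = dim_row B \<Longrightarrow> dim_col B = dim_row Y \<Longrightarrow> A * (B * Y) = C * (Y :: real mat)"
  by (simp add: mat_mult_assoc[symmetric])

lemma orth_mat_cancel:
  assumes "orth_mat n Q" "dim_row Y = n"
  shows "Q\<^sup>T * (Q * Y) = Y" "Q * (Q\<^sup>T * Y) = Y"
  using assms mat_mult_cancel_left[OF orth_matD(3)[OF assms(1)]] mat_mult_cancel_left[OF orth_matD(4)[OF assms(1)]]
  by (simp_all add: orth_matD(1,2) mat_one_mult)

lemma orth_mat_mult:
  assumes P: "orth_mat n P" and Q: "orth_mat n Q"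
  shows "orth_mat n (P * Q)"
proof -
  note [simp] = orth_matD(1,2)[OF P] orth_matD(1,2)[OF Q]
  have "(P * Q)\<^sup>T * (P * Q) = Q\<^sup>T * (P\<^sup>T * (P * Q))" by (simp add: mat_normalize)
  also have "\<dots> = 1\<^sub>m n" by (simp add: orth_mat_cancel[OF P] orth_matD[OF Q])
  finally show ?thesis by (simp add: orth_mat_def carrier_matI)
qed

lemma orth_mat_transpose: "orth_mat n Q \<Longrightarrow> orth_mat n Q\<^sup>T"
  using orth_matD[of n Q] by (simp add: orth_mat_def)

lemma col_mat_mult: 
  assumes "x \<in> carrier_mat n 1" "y \<in> carrier_mat n 1"
  shows "x\<^sup>T * y = (x \<bullet>\<^sub>F y) \<cdot>\<^sub>m 1\<^sub>m 1"
  using assms by (intro eq_matI) (auto simp: frob_inner_def scalar_prod_def atLeast0LessThan)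

definition unit_col :: "nat \<Rightarrow> real mat" where
  "unit_col n = mat n 1 (\<lambda>(i,j). if i = 0 then 1 else 0)"

lemma unit_col_dim [simp]: "dim_row (unit_col n) = n" "dim_col (unit_col n) = 1"
  by (auto simp: unit_col_def)

lemma frob_inner_unit_col: "0 < n \<Longrightarrow> unit_col n \<bullet>\<^sub>F unit_col n = 1"
  by (cases n) (simp_all add: frob_inner_def unit_col_def sum.lessThan_Suc_shift del: sum.lessThan_Suc)

text \<open>The reflection along w = v - e swaps the unit vectors e and v. It supplies an orthogonal
  matrix with prescribed first column, which is what the deflation steps below need.\<close>

lemma householder_exists:
  assumes v: "v \<in> carrier_mat n 1" "v \<bullet>\<^sub>F v = 1" and n: "0 < n"
  shows "\<exists>Q. orth_mat n Q \<and> Q * unit_col n = v"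
proof (cases "v = unit_col n")
  case True
  then show ?thesis by (intro exI[of _ "1\<^sub>m n"]) (auto simp: orth_mat_def mat_normalize)
next
  case False
  define e where "e = unit_col n"
  define w where "w = v - e"
  define c where "c = 2 / (w \<bullet>\<^sub>F w)"
  define Q where "Q = 1\<^sub>m n - c \<cdot>\<^sub>m (w * w\<^sup>T)"
  have dims [simp]: "dim_row v = n" "dim_col v = 1" "dim_row e = n" "dim_col e = 1"
    "dim_row w = n" "dim_col w = 1" "dim_row Q = n" "dim_col Q = n"
    using v by (auto simp: e_def w_def Q_def)
  have carr: "w \<in> carrier_mat n 1" "e \<in> carrier_mat n 1" by (auto intro: carrier_matI)
  have "w \<noteq> 0\<^sub>m n 1"
    using False mat_eq_iff_minus_zero[of v n 1 e] v carr unfolding w_def e_def by auto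
  then have w0: "w \<bullet>\<^sub>F w \<noteq> 0" using frob_inner_eq_0_iff[of w] by simp
  have ee: "e \<bullet>\<^sub>F e = 1" using n by (simp add: e_def frob_inner_unit_col)
  have "e \<bullet>\<^sub>F v = v \<bullet>\<^sub>F e" by (simp add: frob_inner_commute)
  then have ww: "w \<bullet>\<^sub>F w = 2 - 2 * (v \<bullet>\<^sub>F e)" and we: "w \<bullet>\<^sub>F e = v \<bullet>\<^sub>F e - 1"
    using v(2) ee by (simp_all add: w_def frob_inner_linear)
  have "w\<^sup>T * w = (w \<bullet>\<^sub>F w) \<cdot>\<^sub>m 1\<^sub>m 1" by (rule col_mat_mult[OF carr(1) carr(1)])
  then have www: "w * (w\<^sup>T * (w * w\<^sup>T)) = (w \<bullet>\<^sub>F w) \<cdot>\<^sub>m (w * w\<^sup>T)"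
    using mat_mult_cancel_left[of "w\<^sup>T" w _ "w\<^sup>T"] by (simp add: mat_normalize)
  have cw: "c * (w \<bullet>\<^sub>F w) = 2" using w0 by (simp add: c_def)
  have "Q\<^sup>T = Q" by (simp add: Q_def mat_normalize)
  have "Q\<^sup>T * Q = 1\<^sub>m n - c \<cdot>\<^sub>m (w * w\<^sup>T) - c \<cdot>\<^sub>m (w * w\<^sup>T - c \<cdot>\<^sub>m ((w \<bullet>\<^sub>F w) \<cdot>\<^sub>m (w * w\<^sup>T)))"
    by (simp add: Q_def mat_normalize www)
  also have "\<dots> = 1\<^sub>m n"
  proof -
    have "c * (z - c * ((w \<bullet>\<^sub>F w) * z)) = - c * z" for z
      using cw by (simp add: mult.assoc[symmetric])
    then show ?thesis by (intro eq_matI) auto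
  qed
  finally have "orth_mat n Q" by (auto simp: orth_mat_def intro: carrier_matI)
  moreover have "Q * e = e - c \<cdot>\<^sub>m (w * (w\<^sup>T * e))"
    by (simp add: Q_def mat_normalize)
  moreover have "\<dots> = e - (c * (w \<bullet>\<^sub>F e)) \<cdot>\<^sub>m w"
    by (simp add: col_mat_mult[OF carr] mat_normalize) (rule eq_matI, auto)
  \<comment> \<open>For unit vectors v and e, <w, e> is minus half of |w|^2, so the reflection sends
    e to e + w = v.\<close>
  moreover have "c * (w \<bullet>\<^sub>F e) = -1"
  proof -
    have "w \<bullet>\<^sub>F e = - (w \<bullet>\<^sub>F w) / 2" using ww we by simp
    then show ?thesis using cw by simp
  qed
  moreover have "e - (-1) \<cdot>\<^sub>m w = v" by (rule eq_matI) (auto simp: w_def)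
  ultimately show ?thesis unfolding e_def by auto
qed

lemma mult_mat_of_col:
  "A \<in> carrier_mat m n \<Longrightarrow> x \<in> carrier_vec n \<Longrightarrow> A * mat_of_cols n [x] = mat_of_cols m [A *\<^sub>v x]"
  for A :: "real mat"
  by (intro eq_matI) (auto simp: mat_of_cols_def scalar_prod_def)

lemma normalize_col:
  assumes "x \<in> carrier_mat n 1" "x \<noteq> 0\<^sub>m n 1"
  shows "(1 / frob_norm x) \<cdot>\<^sub>m x \<bullet>\<^sub>F ((1 / frob_norm x) \<cdot>\<^sub>m x) = 1" "frob_norm x \<noteq> 0"
proof -
  have nz: "x \<bullet>\<^sub>F x \<noteq> 0" using assms frob_inner_eq_0_iff[of x] by auto
  then show "frob_norm x \<noteq> 0" unfolding frob_norm_def by simp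
  then show "(1 / frob_norm x) \<cdot>\<^sub>m x \<bullet>\<^sub>F ((1 / frob_norm x) \<cdot>\<^sub>m x) = 1"
    using frob_norm_sq[of x] nz by (simp add: frob_inner_linear field_simps power2_eq_square)
qed

text \<open>Existence comes from the complex spectrum. Comparing <y, A x> with <A y, x> for the real
  part x and imaginary part y of a complex eigenvector gives Im k * (|x|^2 + |y|^2) = 0; so k is
  real, and whichever of x, y is nonzero is a real eigenvector.\<close>

lemma sym_mat_unit_eigenvector:
  assumes A: "sym_mat n A" and n: "0 < n"
  shows "\<exists>v \<mu>. v \<in> carrier_mat n 1 \<and> v \<bullet>\<^sub>F v = 1 \<and> A * v = \<mu> \<cdot>\<^sub>m v"
proof -
  have Ac: "A \<in> carrier_mat n n" "A\<^sup>T = A" using A by (auto simp: sym_mat_def)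
  then have [simp]: "dim_row A = n" "dim_col A = n" by auto
  define B where "B = map_mat complex_of_real A"
  have B: "B \<in> carrier_mat n n" using Ac by (simp add: B_def)
  obtain k z where z: "z \<in> carrier_vec n" "z \<noteq> 0\<^sub>v n" "B *\<^sub>v z = k \<cdot>\<^sub>v z"
    using spectrum_non_empty[OF B n] B unfolding spectrum_def eigenvalue_def eigenvector_def by auto
  define x where "x = mat n 1 (\<lambda>(i,j). Re (z $ i))"
  define y where "y = mat n 1 (\<lambda>(i,j). Im (z $ i))"
  have dims [simp]: "dim_row x = n" "dim_col x = 1" "dim_row y = n" "dim_col y = 1"
    by (auto simp: x_def y_def)
  have eq: "(\<Sum>j<n. complex_of_real (A $$ (i,j)) * z $ j) = k * z $ i" if "i < n" for i
  proof -
    have "(B *\<^sub>v z) $ i = (k \<cdot>\<^sub>v z) $ i" using z by simp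
    then show ?thesis using that z(1) Ac
      by (simp add: B_def scalar_prod_def atLeast0LessThan)
  qed
  have Ax: "A * x = Re k \<cdot>\<^sub>m x - Im k \<cdot>\<^sub>m y"
  proof (rule eq_matI)
    fix i j assume "i < dim_row (Re k \<cdot>\<^sub>m x - Im k \<cdot>\<^sub>m y)" "j < dim_col (Re k \<cdot>\<^sub>m x - Im k \<cdot>\<^sub>m y)"
    then show "(A * x) $$ (i,j) = (Re k \<cdot>\<^sub>m x - Im k \<cdot>\<^sub>m y) $$ (i,j)"
      using arg_cong[OF eq[of i], of Re] by (simp add: scalar_prod_def x_def y_def atLeast0LessThan)
  qed simp_all
  have Ay: "A * y = Im k \<cdot>\<^sub>m x + Re k \<cdot>\<^sub>m y"
  proof (rule eq_matI)
    fix i j assume "i < dim_row (Im k \<cdot>\<^sub>m x + Re k \<cdot>\<^sub>m y)" "j < dim_col (Im k \<cdot>\<^sub>m x + Re k \<cdot>\<^sub>m y)"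
    then show "(A * y) $$ (i,j) = (Im k \<cdot>\<^sub>m x + Re k \<cdot>\<^sub>m y) $$ (i,j)"
      using arg_cong[OF eq[of i], of Im] by (simp add: scalar_prod_def x_def y_def atLeast0LessThan)
  qed simp_all
  have "y \<bullet>\<^sub>F (A * x) = (A * y) \<bullet>\<^sub>F x"
    using Ac by (subst frob_inner_mult_left) auto
  moreover have "x \<bullet>\<^sub>F y = y \<bullet>\<^sub>F x" by (simp add: frob_inner_commute)
  ultimately have *: "Im k * (x \<bullet>\<^sub>F x + y \<bullet>\<^sub>F y) = 0"
    unfolding Ax Ay by (simp add: frob_inner_linear algebra_simps)
  have xy: "x \<noteq> 0\<^sub>m n 1 \<or> y \<noteq> 0\<^sub>m n 1"
  proof (rule ccontr)
    assume "\<not> ?thesis"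
    then have "x $$ (i,0) = 0" "y $$ (i,0) = 0" if "i < n" for i using that by auto
    then have "z $ i = 0" if "i < n" for i using that by (auto simp: x_def y_def complex_eq_iff)
    then show False using z(1,2) by auto
  qed
  then have "x \<bullet>\<^sub>F x + y \<bullet>\<^sub>F y \<noteq> 0"
    using frob_inner_nonneg[of x] frob_inner_nonneg[of y] frob_inner_eq_0_iff[of x] frob_inner_eq_0_iff[of y]
    by (auto simp: add_nonneg_eq_0_iff)
  then have k: "Im k = 0" using * by simp
  obtain u where u: "u \<in> carrier_mat n 1" "u \<noteq> 0\<^sub>m n 1" "A * u = Re k \<cdot>\<^sub>m u"
  proof (cases "x = 0\<^sub>m n 1")
    case False
    moreover have "A * x = Re k \<cdot>\<^sub>m x" unfolding Ax k by (rule eq_matI) auto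
    moreover have "x \<in> carrier_mat n 1" by (rule carrier_matI) auto
    ultimately show ?thesis using that by blast
  next
    case True
    then have "y \<noteq> 0\<^sub>m n 1" using xy by simp
    moreover have "A * y = Re k \<cdot>\<^sub>m y" unfolding Ay k by (rule eq_matI) auto
    moreover have "y \<in> carrier_mat n 1" by (rule carrier_matI) auto
    ultimately show ?thesis using that by blast
  qed
  have "A * ((1 / frob_norm u) \<cdot>\<^sub>m u) = Re k \<cdot>\<^sub>m ((1 / frob_norm u) \<cdot>\<^sub>m u)"
    using u by (simp add: mat_normalize) (rule eq_matI, auto)
  then show ?thesis using u normalize_col[OF u(1,2)] by (intro exI[of _ "(1 / frob_norm u) \<cdot>\<^sub>m u"] exI) auto
qed

text \<open>The two conditions fix the first column and the first row. Keeping them separate lets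
  the lemma serve both symmetric matrices and singular pairs of a general square matrix.\<close>

lemma block_of_unit_eigencol:
  assumes B: "B \<in> carrier_mat (Suc n) (Suc n)"
    and e: "B * unit_col (Suc n) = s \<cdot>\<^sub>m unit_col (Suc n)" "B\<^sup>T * unit_col (Suc n) = s \<cdot>\<^sub>m unit_col (Suc n)"
  shows "B = four_block_mat (mat_diag 1 (\<lambda>_. s)) (0\<^sub>m 1 n) (0\<^sub>m n 1) (mat n n (\<lambda>(i,j). B $$ (Suc i, Suc j)))"
proof (rule eq_matI)
  have c0: "B $$ (i,0) = (if i = 0 then s else 0)" if "i < Suc n" for i
  proof -
    have "(B * unit_col (Suc n)) $$ (i,0) = (s \<cdot>\<^sub>m unit_col (Suc n)) $$ (i,0)" using e by simp
    then show ?thesis using that B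
      by (simp add: unit_col_def scalar_prod_def if_distrib[of "(*) _"] split: if_splits cong: if_cong)
  qed
  have r0: "B $$ (0,i) = (if i = 0 then s else 0)" if "i < Suc n" for i
  proof -
    have "(B\<^sup>T * unit_col (Suc n)) $$ (i,0) = (s \<cdot>\<^sub>m unit_col (Suc n)) $$ (i,0)" using e by simp
    then show ?thesis using that B
      by (simp add: unit_col_def scalar_prod_def if_distrib[of "(*) _"] split: if_splits cong: if_cong)
  qed
  fix i j assume "i < dim_row (four_block_mat (mat_diag 1 (\<lambda>_. s)) (0\<^sub>m 1 n) (0\<^sub>m n 1) (mat n n (\<lambda>(i,j). B $$ (Suc i, Suc j))))"
    "j < dim_col (four_block_mat (mat_diag 1 (\<lambda>_. s)) (0\<^sub>m 1 n) (0\<^sub>m n 1) (mat n n (\<lambda>(i,j). B $$ (Suc i, Suc j))))"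
  then show "B $$ (i,j) = four_block_mat (mat_diag 1 (\<lambda>_. s)) (0\<^sub>m 1 n) (0\<^sub>m n 1) (mat n n (\<lambda>(i,j). B $$ (Suc i, Suc j))) $$ (i,j)"
    using c0[of i] r0[of j] by (cases i; cases j) (auto simp: mat_diag_def)
qed (use B in auto)

definition bordered :: "nat \<Rightarrow> real mat \<Rightarrow> real mat" where
  "bordered n Q = four_block_mat (1\<^sub>m 1) (0\<^sub>m 1 n) (0\<^sub>m n 1) Q"

text \<open>\<open>case_nat s f\<close> prepends s to the diagonal f: a decomposition of the lower
  block lifts to one of the whole matrix, which is the inductive step of both decompositions
  below.\<close>

lemma bordered_diag_block:
  assumes P: "P \<in> carrier_mat n n" and Q: "Q \<in> carrier_mat n n"
  shows "four_block_mat (mat_diag 1 (\<lambda>_. s)) (0\<^sub>m 1 n) (0\<^sub>m n 1) (P * mat_diag n f * Q\<^sup>T)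
    = bordered n P * mat_diag (Suc n) (case_nat s f) * (bordered n Q)\<^sup>T"
proof -
  have D: "mat_diag (Suc n) (case_nat s f)
    = four_block_mat (mat_diag 1 (\<lambda>_. s)) (0\<^sub>m 1 n) (0\<^sub>m n 1) (mat_diag n f)"
    by (rule eq_matI) (auto simp: mat_diag_def split: nat.split)
  have c: "mat_diag 1 (\<lambda>_. s) \<in> carrier_mat 1 1" by simp
  have QT: "Q\<^sup>T \<in> carrier_mat n n" using Q by simp
  have PD: "P * mat_diag n f \<in> carrier_mat n n" using P by auto
  have 1: "bordered n P * mat_diag (Suc n) (case_nat s f)
      = four_block_mat (mat_diag 1 (\<lambda>_. s)) (0\<^sub>m 1 n) (0\<^sub>m n 1) (P * mat_diag n f)"
    unfolding bordered_def D
    by (subst mult_four_block_mat[of _ 1 1 _ n _ n _ _ 1 _ n]) (use P PD in auto)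
  have 2: "(bordered n Q)\<^sup>T = four_block_mat (1\<^sub>m 1) (0\<^sub>m 1 n) (0\<^sub>m n 1) (Q\<^sup>T)"
    unfolding bordered_def by (subst transpose_four_block_mat[of _ 1 1 _ n _ n]) (use Q in auto)
  show ?thesis unfolding 1 2
    by (subst mult_four_block_mat[of _ 1 1 _ n _ n _ _ 1 _ n]) (use P Q PD QT in auto)
qed

lemma orth_mat_bordered:
  assumes "orth_mat n Q" shows "orth_mat (Suc n) (bordered n Q)"
proof -
  have Q: "Q \<in> carrier_mat n n" "Q\<^sup>T * Q = 1\<^sub>m n" using assms by (auto simp: orth_mat_def)
  have 2: "(bordered n Q)\<^sup>T = four_block_mat (1\<^sub>m 1) (0\<^sub>m 1 n) (0\<^sub>m n 1) (Q\<^sup>T)"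
    unfolding bordered_def by (subst transpose_four_block_mat[of _ 1 1 _ n _ n]) (use Q in auto)
  have "(bordered n Q)\<^sup>T * bordered n Q = 1\<^sub>m (Suc n)"
    unfolding 2 unfolding bordered_def
    by (subst mult_four_block_mat[of _ 1 1 _ n _ n _ _ 1 _ n]) (use Q in auto)
  moreover have "bordered n Q \<in> carrier_mat (Suc n) (Suc n)"
    using Q by (auto simp: bordered_def intro!: carrier_matI)
  ultimately show ?thesis by (simp add: orth_mat_def)
qed

text \<open>Deflation: rotating a unit eigenvector to the first coordinate splits off a 1 x 1 block,
  because symmetry also clears the first row.\<close>

lemma sym_mat_spectral:
  assumes "sym_mat n A"
  shows "\<exists>Q f. orth_mat n Q \<and> A = Q * mat_diag n f * Q\<^sup>T"
  using assms
proof (induction n arbitrary: A)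
  case 0
  then show ?case
    by (intro exI[of _ "1\<^sub>m 0"] exI[of _ "\<lambda>_. 0"]) (auto simp: orth_mat_def sym_mat_def intro!: eq_matI)
next
  case (Suc n)
  have A: "dim_row A = Suc n" "dim_col A = Suc n" "A\<^sup>T = A" using Suc.prems by (auto simp: sym_mat_def)
  note [simp] = A(1,2)
  obtain v \<mu> where v: "v \<in> carrier_mat (Suc n) 1" "v \<bullet>\<^sub>F v = 1" "A * v = \<mu> \<cdot>\<^sub>m v"
    using sym_mat_unit_eigenvector[OF Suc.prems] by auto
  obtain P where P: "orth_mat (Suc n) P" "P * unit_col (Suc n) = v"
    using householder_exists[OF v(1,2)] by auto
  note [simp] = orth_matD(1,2)[OF P(1)]
  define B where "B = P\<^sup>T * A * P"
  have [simp]: "dim_row B = Suc n" "dim_col B = Suc n" by (auto simp: B_def)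
  have "B\<^sup>T = B" by (simp add: B_def mat_normalize A(3))
  have "P\<^sup>T * v = unit_col (Suc n)"
    unfolding P(2)[symmetric] by (simp add: orth_mat_cancel[OF P(1)])
  then have Be: "B * unit_col (Suc n) = \<mu> \<cdot>\<^sub>m unit_col (Suc n)"
    using v P(2) by (simp add: B_def mat_normalize)
  define B' where "B' = mat n n (\<lambda>(i,j). B $$ (Suc i, Suc j))"
  have B: "B = four_block_mat (mat_diag 1 (\<lambda>_. \<mu>)) (0\<^sub>m 1 n) (0\<^sub>m n 1) B'"
    unfolding B'_def by (rule block_of_unit_eigencol) (auto simp: Be \<open>B\<^sup>T = B\<close> intro: carrier_matI)
  have sym: "B $$ (i,j) = B $$ (j,i)" if "i < Suc n" "j < Suc n" for i j
    using arg_cong[OF \<open>B\<^sup>T = B\<close>, of "\<lambda>M. M $$ (i,j)"] that by simp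
  have "B'\<^sup>T = B'" unfolding B'_def by (rule eq_matI) (auto simp: sym)
  then have "sym_mat n B'" by (auto simp: sym_mat_def B'_def)
  then obtain Q f where Q: "orth_mat n Q" "B' = Q * mat_diag n f * Q\<^sup>T" using Suc.IH by blast
  let ?Q = "bordered n Q"
  have oQ: "orth_mat (Suc n) ?Q" using Q by (intro orth_mat_bordered)
  note [simp] = orth_matD(1,2)[OF oQ]
  have BQ: "B = ?Q * mat_diag (Suc n) (case_nat \<mu> f) * ?Q\<^sup>T"
    unfolding B Q(2) by (rule bordered_diag_block) (use Q(1) in \<open>auto simp: orth_mat_def\<close>)
  have "A = P * B * P\<^sup>T"
    by (simp add: B_def mat_mult_assoc orth_mat_cancel[OF P(1)] orth_matD(4)[OF P(1)] mat_mult_one)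
  also have "\<dots> = (P * ?Q) * mat_diag (Suc n) (case_nat \<mu> f) * (P * ?Q)\<^sup>T"
    unfolding BQ by (simp add: mat_normalize)
  finally show ?case using orth_mat_mult[OF P(1) oQ] by blast
qed

text \<open>Deflation with any singular pair T v = s u, T^T u = s v; the second equation clears the
  first row after rotation. The pair need not be extremal because no ordering of \<open>s\<close> is
  claimed.\<close>

lemma square_mat_svd:
  assumes "T \<in> carrier_mat n n"
  shows "\<exists>P Q s. orth_mat n P \<and> orth_mat n Q \<and> (\<forall>i<n. 0 \<le> s i) \<and> T = P * mat_diag n s * Q\<^sup>T"
  using assms
proof (induction n arbitrary: T)
  case 0
  then show ?case
    by (intro exI[of _ "1\<^sub>m 0"] exI[of _ "\<lambda>_. 0"]) (auto simp: orth_mat_def intro!: eq_matI)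
next
  case (Suc n)
  let ?n = "Suc n"
  have [simp]: "dim_row T = ?n" "dim_col T = ?n" using Suc.prems by auto
  have "sym_mat ?n (T\<^sup>T * T)" by (auto simp: sym_mat_def mat_normalize intro: carrier_matI)
  then obtain v \<mu> where v: "v \<in> carrier_mat ?n 1" "v \<bullet>\<^sub>F v = 1" "T\<^sup>T * T * v = \<mu> \<cdot>\<^sub>m v"
    using sym_mat_unit_eigenvector by blast
  have [simp]: "dim_row v = ?n" "dim_col v = 1" using v by auto
  have Tv: "T\<^sup>T * (T * v) = \<mu> \<cdot>\<^sub>m v" using v(3) by (simp add: mat_normalize)
  have TvTv: "(T * v) \<bullet>\<^sub>F (T * v) = \<mu>"
    using v(2) by (subst frob_inner_mult_left) (simp_all add: Tv frob_inner_linear)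
  then have mu: "0 \<le> \<mu>" using frob_inner_nonneg[of "T * v"] by simp
  define s where "s = sqrt \<mu>"
  have "\<exists>u. u \<in> carrier_mat ?n 1 \<and> u \<bullet>\<^sub>F u = 1 \<and> T * v = s \<cdot>\<^sub>m u \<and> T\<^sup>T * u = s \<cdot>\<^sub>m v"
  proof (cases "\<mu> = 0")
    case False
    then have s: "s > 0" "s * s = \<mu>" using mu by (auto simp: s_def)
    have 1: "T * v = s \<cdot>\<^sub>m ((1/s) \<cdot>\<^sub>m (T * v))" using s by (intro eq_matI) auto
    have 2: "T\<^sup>T * ((1/s) \<cdot>\<^sub>m (T * v)) = s \<cdot>\<^sub>m v"
      using s by (simp add: mat_normalize Tv) (rule eq_matI, auto simp: field_simps simp flip: s(2))
    have 3: "(1/s) \<cdot>\<^sub>m (T * v) \<bullet>\<^sub>F ((1/s) \<cdot>\<^sub>m (T * v)) = 1"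
      using s False by (simp add: frob_inner_linear TvTv field_simps)
    show ?thesis using 1 2 3 by (intro exI[of _ "(1/s) \<cdot>\<^sub>m (T * v)"]) (auto intro: carrier_matI)
  next
    \<comment> \<open>Here T v = 0 yields no u by normalization. But T is singular, hence so is its
      transpose, and a unit vector in the kernel of T^T serves as u.\<close>
    case True
    then have Tv0: "T * v = 0\<^sub>m ?n 1" using TvTv frob_inner_eq_0_iff[of "T * v"] by simp
    have "col v 0 \<noteq> 0\<^sub>v ?n"
    proof
      assume *: "col v 0 = 0\<^sub>v ?n"
      have "v $$ (i,j) = 0" if "i < ?n" "j < 1" for i j
        using arg_cong[OF *, of "\<lambda>x. x $ i"] that by simp
      then have "v = 0\<^sub>m ?n 1" by (intro eq_matI) auto
      then show False using v(2) by simp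
    qed
    moreover have "T *\<^sub>v col v 0 = col (T * v) 0" by (rule eq_vecI) auto
    then have "T *\<^sub>v col v 0 = 0\<^sub>v ?n" unfolding Tv0 by simp
    moreover have "col v 0 \<in> carrier_vec ?n" by (intro carrier_vecI) simp
    ultimately have "det T = 0" using det_0_iff_vec_prod_zero_field[OF Suc.prems] by blast
    then have "det T\<^sup>T = 0" using det_transpose[OF Suc.prems] by simp
    then obtain x where x: "x \<in> carrier_vec ?n" "x \<noteq> 0\<^sub>v ?n" "T\<^sup>T *\<^sub>v x = 0\<^sub>v ?n"
      using det_0_iff_vec_prod_zero_field[of "T\<^sup>T" ?n] Suc.prems by auto
    define u where "u = mat_of_cols ?n [x]"
    have u: "u \<in> carrier_mat ?n 1" using mat_of_cols_carrier(1)[of ?n "[x]"] by (simp add: u_def)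
    have "T\<^sup>T * u = mat_of_cols ?n [0\<^sub>v ?n]"
      unfolding u_def using x Suc.prems by (subst mult_mat_of_col[of _ ?n]) auto
    also have "\<dots> = 0\<^sub>m ?n 1" by (rule eq_matI) (auto simp: mat_of_cols_def)
    finally have Tu: "T\<^sup>T * u = 0\<^sub>m ?n 1" .
    have u0: "u \<noteq> 0\<^sub>m ?n 1"
    proof
      assume *: "u = 0\<^sub>m ?n 1"
      have "x $ i = 0" if "i < ?n" for i
        using arg_cong[OF *, of "\<lambda>M. M $$ (i,0)"] that by (simp add: u_def mat_of_cols_def)
      then show False using x by auto
    qed
    have "s = 0" using True by (simp add: s_def)
    have "T * v = s \<cdot>\<^sub>m ((1 / frob_norm u) \<cdot>\<^sub>m u)" "T\<^sup>T * ((1 / frob_norm u) \<cdot>\<^sub>m u) = s \<cdot>\<^sub>m v"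
      using u by (auto simp: Tv0 \<open>s = 0\<close> mat_normalize Tu)
    then show ?thesis using normalize_col[OF u u0] u
      by (intro exI[of _ "(1 / frob_norm u) \<cdot>\<^sub>m u"]) auto
  qed
  then obtain u where u: "u \<in> carrier_mat ?n 1" "u \<bullet>\<^sub>F u = 1" "T * v = s \<cdot>\<^sub>m u" "T\<^sup>T * u = s \<cdot>\<^sub>m v" by blast
  obtain P where P: "orth_mat ?n P" "P * unit_col ?n = u" using householder_exists[OF u(1,2)] by auto
  obtain Q where Q: "orth_mat ?n Q" "Q * unit_col ?n = v" using householder_exists[OF v(1,2)] by auto
  note [simp] = orth_matD(1,2)[OF P(1)] orth_matD(1,2)[OF Q(1)]
  have Pu: "P\<^sup>T * u = unit_col ?n" "Q\<^sup>T * v = unit_col ?n"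
    unfolding P(2)[symmetric] Q(2)[symmetric]
    by (simp_all add: orth_mat_cancel[OF P(1)] orth_mat_cancel[OF Q(1)])
  define B where "B = P\<^sup>T * T * Q"
  have [simp]: "dim_row B = ?n" "dim_col B = ?n" by (auto simp: B_def)
  have [simp]: "dim_row u = ?n" "dim_col u = 1" using u by auto
  have Be: "B * unit_col ?n = s \<cdot>\<^sub>m unit_col ?n" "B\<^sup>T * unit_col ?n = s \<cdot>\<^sub>m unit_col ?n"
    using u P(2) Q(2) by (simp_all add: B_def mat_normalize Pu)
  define B' where "B' = mat n n (\<lambda>(i,j). B $$ (Suc i, Suc j))"
  have B: "B = four_block_mat (mat_diag 1 (\<lambda>_. s)) (0\<^sub>m 1 n) (0\<^sub>m n 1) B'"
    unfolding B'_def by (rule block_of_unit_eigencol) (auto simp: Be intro: carrier_matI)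
  have "B' \<in> carrier_mat n n" by (auto simp: B'_def)
  then obtain P' Q' f where f: "orth_mat n P'" "orth_mat n Q'" "\<forall>i<n. 0 \<le> f i" "B' = P' * mat_diag n f * Q'\<^sup>T"
    using Suc.IH by blast
  let ?P = "bordered n P'" and ?Q = "bordered n Q'"
  have oP: "orth_mat ?n ?P" and oQ: "orth_mat ?n ?Q" using f by (auto intro: orth_mat_bordered)
  note [simp] = orth_matD(1,2)[OF oQ] orth_matD(1,2)[OF oP]
  have BQ: "B = ?P * mat_diag ?n (case_nat s f) * ?Q\<^sup>T"
    unfolding B f(4) by (rule bordered_diag_block) (use f in \<open>auto simp: orth_mat_def\<close>)
  have "T = P * B * Q\<^sup>T"
    by (simp add: B_def mat_mult_assoc orth_mat_cancel[OF P(1)] orth_matD(4)[OF Q(1)] mat_mult_one)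
  also have "\<dots> = (P * ?P) * mat_diag ?n (case_nat s f) * (Q * ?Q)\<^sup>T"
    unfolding BQ by (simp add: mat_normalize)
  finally have "T = (P * ?P) * mat_diag ?n (case_nat s f) * (Q * ?Q)\<^sup>T" .
  moreover have "\<forall>i<?n. 0 \<le> (case_nat s f) i" using f(3) mu by (auto simp: s_def split: nat.split)
  ultimately show ?case using orth_mat_mult[OF P(1) oP] orth_mat_mult[OF Q(1) oQ] by blast
qed

lemma mat_diag_cong: "(\<And>i. i < n \<Longrightarrow> f i = g i) \<Longrightarrow> mat_diag n f = mat_diag n g"
  by (rule eq_matI) (auto simp: mat_diag_def)

lemma mat_diag_mult_cancel:
  "dim_row Y = n \<Longrightarrow> mat_diag n f * (mat_diag n g * Y) = mat_diag n (\<lambda>i. f i * g i) * Y" for Y :: "real mat"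
  by (simp add: mat_mult_assoc[symmetric])

lemma frob_inner_mat_diag: "mat_diag n f \<bullet>\<^sub>F mat_diag n g = (\<Sum>i<n. f i * g i)"
  by (auto simp: frob_inner_def mat_diag_def if_distrib[of "\<lambda>x. x * _"] if_distrib[of "(*) _"]
      cong: if_cong intro!: sum.cong)

lemma frob_inner_diag_mult:
  assumes "Y \<in> carrier_mat k m"
  shows "Y \<bullet>\<^sub>F (mat_diag k c * Y) = (\<Sum>i<k. c i * (\<Sum>j<m. (Y $$ (i,j))\<^sup>2))"
  using assms unfolding frob_inner_def
  by (simp add: mat_diag_mult_left[OF assms] power2_eq_square sum_distrib_left algebra_simps)

lemma diag_form_lower:
  assumes "Y \<in> carrier_mat k m" "\<And>i. i < k \<Longrightarrow> b \<le> c i"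
  shows "b * (Y \<bullet>\<^sub>F Y) \<le> Y \<bullet>\<^sub>F (mat_diag k c * Y)"
proof -
  have "Y \<bullet>\<^sub>F Y = (\<Sum>i<k. \<Sum>j<m. (Y $$ (i,j))\<^sup>2)"
    using assms(1) by (simp add: frob_inner_def power2_eq_square)
  then have "b * (Y \<bullet>\<^sub>F Y) = (\<Sum>i<k. b * (\<Sum>j<m. (Y $$ (i,j))\<^sup>2))" by (simp add: sum_distrib_left)
  also have "\<dots> \<le> (\<Sum>i<k. c i * (\<Sum>j<m. (Y $$ (i,j))\<^sup>2))"
    by (intro sum_mono mult_right_mono sum_nonneg) (auto simp: assms(2))
  finally show ?thesis unfolding frob_inner_diag_mult[OF assms(1)] .
qed

section \<open>Rank\<close>

lemma mrank_sum_outer_le: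
  assumes "finite S"
  shows "mrank (mat d m (\<lambda>(i,j). \<Sum>l\<in>S. f l i * g l j)) \<le> card S"
  using assms
proof induction
  case empty
  have eq: "mat d m (\<lambda>(i,j). \<Sum>l\<in>{}. f l i * g l j) = 0\<^sub>m d m" by (rule eq_matI) auto
  show ?case unfolding eq using vec_space.rank_0I[of d m, where ?'a = real] by (simp add: mrank_def)
next
  case (insert a S)
  let ?A = "mat d m (\<lambda>(i,j). \<Sum>l\<in>S. f l i * g l j)" and ?B = "mat d m (\<lambda>(i,j). f a i * g a j)"
  have eq: "mat d m (\<lambda>(i,j). \<Sum>l\<in>insert a S. f l i * g l j) = ?A + ?B"
    using insert by (intro eq_matI) auto
  have "vec_space.rank d (?A + ?B) \<le> vec_space.rank d ?A + vec_space.rank d ?B"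
    by (rule vec_space.rank_subadditive) auto
  moreover have "vec_space.rank d ?B \<le> 1"
    by (rule vec_space.rank_le_1_product_entries[of _ _ m "f a" "g a"]) auto
  ultimately show ?case unfolding eq using insert by (simp add: mrank_def)
qed

lemma mrank_mult_le:
  assumes "dim_col P = dim_row Q"
  shows "mrank (P * Q) \<le> dim_row Q"
proof -
  have "P * Q = mat (dim_row P) (dim_col Q) (\<lambda>(i,j). \<Sum>l\<in>{..<dim_row Q}. (\<lambda>l i. P $$ (i,l)) l i * (\<lambda>l j. Q $$ (l,j)) l j)"
    using assms by (intro eq_matI) (auto simp: mult_mat_entry simp del: index_mult_mat(1))
  then show ?thesis
    using mrank_sum_outer_le[of "{..<dim_row Q}" "dim_row P" "dim_col Q" "\<lambda>l i. P $$ (i,l)" "\<lambda>l j. Q $$ (l,j)"] by simp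
qed

lemma mrank_diag_le:
  assumes P: "P \<in> carrier_mat d k" and S: "S \<subseteq> {..<k}" and f: "\<And>i. i < k \<Longrightarrow> i \<notin> S \<Longrightarrow> f i = 0"
  shows "mrank (P * mat_diag k f * P\<^sup>T) \<le> card S"
proof -
  have "P * mat_diag k f * P\<^sup>T = mat d d (\<lambda>(i,j). \<Sum>l\<in>S. (\<lambda>l i. P $$ (i,l) * f l) l i * (\<lambda>l j. P $$ (j,l)) l j)"
  proof (rule eq_matI)
    fix i j assume "i < dim_row (mat d d (\<lambda>(i,j). \<Sum>l\<in>S. (\<lambda>l i. P $$ (i,l) * f l) l i * (\<lambda>l j. P $$ (j,l)) l j))"
      "j < dim_col (mat d d (\<lambda>(i,j). \<Sum>l\<in>S. (\<lambda>l i. P $$ (i,l) * f l) l i * (\<lambda>l j. P $$ (j,l)) l j))"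
    then have ij: "i < d" "j < d" by auto
    have "(P * mat_diag k f * P\<^sup>T) $$ (i,j) = (\<Sum>l<k. P $$ (i,l) * f l * P $$ (j,l))"
      using P ij by (simp add: mult_mat_entry mat_diag_mult_right[OF P] del: index_mult_mat(1))
    also have "\<dots> = (\<Sum>l\<in>S. P $$ (i,l) * f l * P $$ (j,l))"
      using S f by (intro sum.mono_neutral_right) auto
    finally show "(P * mat_diag k f * P\<^sup>T) $$ (i,j)
      = mat d d (\<lambda>(i,j). \<Sum>l\<in>S. (\<lambda>l i. P $$ (i,l) * f l) l i * (\<lambda>l j. P $$ (j,l)) l j) $$ (i,j)" using ij by simp
  qed (use P in auto)
  moreover have "finite S" using S finite_subset by blast
  ultimately show ?thesis
    using mrank_sum_outer_le[of S d d "\<lambda>l i. P $$ (i,l) * f l" "\<lambda>l j. P $$ (j,l)"] by simp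
qed

lemma mrank_add_le:
  assumes "A \<in> carrier_mat d m" "B \<in> carrier_mat d m"
  shows "mrank (A + B) \<le> mrank A + mrank B"
  using vec_space.rank_subadditive[OF assms] assms by (simp add: mrank_def)

text \<open>Passage from the abstract rank to explicit factors: a maximal independent set of columns
  spans all columns, and the coefficients form the second factor.\<close>

lemma mrank_factorization:
  assumes Y: "Y \<in> carrier_mat d m" and r: "mrank Y \<le> k"
  shows "\<exists>P Q. P \<in> carrier_mat d k \<and> Q \<in> carrier_mat k m \<and> Y = P * Q"
proof -
  interpret vec_space "TYPE(real)" d .
  have sub: "set (cols Y) \<subseteq> carrier_vec d" using Y cols_dim by blast
  have "lin_indpt {}" by (rule finite_lin_indpt2) auto
  then obtain S where S: "maximal S (\<lambda>T. T \<subseteq> set (cols Y) \<and> lin_indpt T)" "finite S"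
    using maximal_exists_superset[of "set (cols Y)" "\<lambda>T. T \<subseteq> set (cols Y) \<and> lin_indpt T" "{}"] by auto
  have SY: "S \<subseteq> set (cols Y)" "lin_indpt S" using S(1) unfolding maximal_def by auto
  have Sd: "S \<subseteq> carrier_vec d" using SY sub by blast
  have card: "card S \<le> k" using rank_card_indpt[OF Y S(1)] r Y by (simp add: mrank_def)
  have span: "c \<in> span S" if "c \<in> set (cols Y)" for c
  proof (rule ccontr)
    assume n: "c \<notin> span S"
    then have cS: "c \<notin> S" using Sd in_own_span by blast
    have "c \<in> carrier_vec d" using that sub by blast
    then have "lin_indpt (S \<union> {c})" using lin_dep_iff_in_span[of S c] Sd SY(2) n cS by auto
    then have "S \<union> {c} = S" using S(1) SY that unfolding maximal_def by blast
    then show False using cS by blast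
  qed
  obtain xs where xs: "distinct xs" "set xs = S" using finite_distinct_list[OF S(2)] by blast
  have len: "length xs \<le> k" using xs card distinct_card by fastforce
  have "\<exists>a. c = lincomb a S" if "c \<in> set (cols Y)" for c
    using span[OF that] finite_span[OF S(2)] Sd by auto
  then obtain a where a: "\<And>c. c \<in> set (cols Y) \<Longrightarrow> c = lincomb (a c) S" by metis
  \<comment> \<open>Zero columns pad P to width k, since the rank may be smaller than k.\<close>
  define P where "P = mat d k (\<lambda>(i,j). if j < length xs then xs ! j $ i else 0)"
  define Q where "Q = mat k m (\<lambda>(j,l). if j < length xs then a (col Y l) (xs ! j) else 0)"
  have "Y = P * Q"
  proof (rule eq_matI)
    fix i l assume "i < dim_row (P * Q)" "l < dim_col (P * Q)"
    then have il: "i < d" "l < m" by (auto simp: P_def Q_def)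
    have "Y $$ (i,l) = col Y l $ i" using Y il by auto
    also have "col Y l = lincomb (a (col Y l)) S" using il Y by (intro a) (auto simp: cols_def)
    also have "\<dots> $ i = (\<Sum>x\<in>S. a (col Y l) x * x $ i)" by (rule lincomb_index[OF il(1) Sd])
    also have "\<dots> = (\<Sum>j<length xs. a (col Y l) (xs ! j) * xs ! j $ i)"
      using sum.reindex_bij_betw[OF bij_betw_nth[OF xs(1) refl], of S "\<lambda>x. a (col Y l) x * x $ i"] xs(2)
      by (simp add: atLeast0LessThan)
    also have "\<dots> = (\<Sum>j<k. P $$ (i,j) * Q $$ (j,l))"
      using il len by (intro sum.mono_neutral_cong_left) (auto simp: P_def Q_def)
    also have "\<dots> = (P * Q) $$ (i,l)"
      using il by (subst mult_mat_entry) (auto simp: P_def Q_def)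
    finally show "Y $$ (i,l) = (P * Q) $$ (i,l)" .
  qed (use Y in \<open>auto simp: P_def Q_def\<close>)
  then show ?thesis by (intro exI[of _ P] exI[of _ Q]) (auto simp: P_def Q_def)
qed

text \<open>The columns of \<open>Q\<close> are orthonormal or zero; allowing zero columns makes it unnecessary to
  select a basis, and \<open>Q * Q\<^sup>T\<close> is still the orthogonal projection onto the column space.\<close>
lemma orthonormalize:
  assumes B: "B \<in> carrier_mat d k"
  shows "\<exists>Q. Q \<in> carrier_mat d k \<and> Q * (Q\<^sup>T * Q) = Q \<and> Q \<bullet>\<^sub>F Q \<le> real k \<and> Q * (Q\<^sup>T * B) = B"
proof -
  have [simp]: "dim_row B = d" "dim_col B = k" using B by auto
  have "sym_mat k (B\<^sup>T * B)" by (auto simp: sym_mat_def mat_normalize intro: carrier_matI)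
  then obtain W s where W: "orth_mat k W" and BB: "B\<^sup>T * B = W * mat_diag k s * W\<^sup>T"
    using sym_mat_spectral by blast
  note [simp] = orth_matD(1,2)[OF W]
  note W_cancel = orth_mat_cancel[OF W] orth_matD(3,4)[OF W]
  define C where "C = B * W"
  have [simp]: "dim_row C = d" "dim_col C = k" by (auto simp: C_def)
  \<comment> \<open>Rotating B by the eigenvectors of its Gram matrix makes the columns orthogonal;
    only their lengths remain to be normalized.\<close>
  have "C\<^sup>T * C = W\<^sup>T * ((B\<^sup>T * B) * W)" by (simp add: C_def mat_normalize)
  also have "\<dots> = mat_diag k s" unfolding BB by (simp add: mat_normalize W_cancel)
  finally have CC: "C\<^sup>T * C = mat_diag k s" .
  have s0: "0 \<le> s i" if "i < k" for i
  proof -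
    have "s i = (C\<^sup>T * C) $$ (i,i)" unfolding CC using that by (simp add: mat_diag_def)
    also have "\<dots> = (\<Sum>l<d. (C $$ (l,i))\<^sup>2)"
      using that by (subst mult_mat_entry) (auto simp: power2_eq_square)
    finally show ?thesis by (simp add: sum_nonneg)
  qed
  define t where "t i = (if 0 < s i then 1 / sqrt (s i) else 0)" for i
  define e where "e i = (if 0 < s i then 1 else 0 :: real)" for i
  have ts: "t i * (s i * t i) = e i" "t i * e i = t i" for i
    by (auto simp: t_def e_def field_simps)
  define Q where "Q = C * mat_diag k t"
  have [simp]: "dim_row Q = d" "dim_col Q = k" by (auto simp: Q_def)
  have "Q\<^sup>T * Q = mat_diag k t * ((C\<^sup>T * C) * mat_diag k t)" by (simp add: Q_def mat_normalize)
  then have QQ: "Q\<^sup>T * Q = mat_diag k e" unfolding CC by (simp add: ts)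
  then have QQQ: "Q * (Q\<^sup>T * Q) = Q" by (simp add: Q_def mat_normalize ts)
  have "Q \<bullet>\<^sub>F Q = 1\<^sub>m k \<bullet>\<^sub>F (Q\<^sup>T * Q)"
    using frob_inner_mult_left[of Q Q "1\<^sub>m k"] by (simp add: mat_normalize)
  also have "\<dots> = (\<Sum>i<k. e i)" unfolding QQ mat_diag_one[symmetric] frob_inner_mat_diag by simp
  also have "\<dots> \<le> (\<Sum>i<k. 1)" by (intro sum_mono) (simp add: e_def)
  finally have Qk: "Q \<bullet>\<^sub>F Q \<le> real k" by simp
  define E where "E = mat_diag k e - 1\<^sub>m k"
  have Ed: "E = mat_diag k (\<lambda>i. e i - 1)" by (rule eq_matI) (auto simp: E_def mat_diag_def)
  \<comment> \<open>The factor e i - 1 is nonzero only where s i = 0, that is, at zero columns of C;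
    so this norm vanishes and C loses nothing under the 0-1 diagonal \<open>e\<close>.\<close>
  have "(C * E) \<bullet>\<^sub>F (C * E) = E \<bullet>\<^sub>F (C\<^sup>T * C * E)"
    by (subst frob_inner_mult_left) (auto simp: Ed mat_normalize)
  also have "\<dots> = (\<Sum>i<k. (e i - 1) * (s i * (e i - 1)))" unfolding CC Ed by (simp add: frob_inner_mat_diag)
  also have "\<dots> = 0" using s0 by (intro sum.neutral) (force simp: e_def)
  finally have "C * E = 0\<^sub>m d k" using frob_inner_eq_0_iff[of "C * E"] by (simp add: Ed)
  then have Ce: "C * mat_diag k e = C"
    using mat_eq_iff_minus_zero[of "C * mat_diag k e" d k C]
    by (simp add: E_def mat_normalize carrier_matI)
  have "Q * (Q\<^sup>T * C) = C * (mat_diag k t * (mat_diag k t * (C\<^sup>T * C)))" by (simp add: Q_def mat_normalize)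
  also have "\<dots> = C * mat_diag k e" unfolding CC using ts by (simp add: mult.commute mult.left_commute)
  finally have QC: "Q * (Q\<^sup>T * C) = C" by (simp add: Ce)
  have BC: "B = C * W\<^sup>T" by (simp add: C_def mat_normalize W_cancel)
  have "Q * (Q\<^sup>T * B) = Q * (Q\<^sup>T * C) * W\<^sup>T" by (simp add: BC mat_normalize)
  then have "Q * (Q\<^sup>T * B) = B" unfolding QC BC .
  then show ?thesis using QQQ Qk by (intro exI[of _ Q]) (auto intro: carrier_matI)
qed

lemma low_rank_projection:
  assumes Y: "Y \<in> carrier_mat d m" and r: "mrank Y \<le> k"
  shows "\<exists>Q. Q \<in> carrier_mat d k \<and> Q * (Q\<^sup>T * Q) = Q \<and> Q \<bullet>\<^sub>F Q \<le> real k \<and> Q * (Q\<^sup>T * Y) = Y"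
proof -
  obtain P R where P: "P \<in> carrier_mat d k" "R \<in> carrier_mat k m" "Y = P * R"
    using mrank_factorization[OF assms] by blast
  obtain Q where Q: "Q \<in> carrier_mat d k" "Q * (Q\<^sup>T * Q) = Q" "Q \<bullet>\<^sub>F Q \<le> real k" "Q * (Q\<^sup>T * P) = P"
    using orthonormalize[OF P(1)] by blast
  have "Q * (Q\<^sup>T * Y) = Q * (Q\<^sup>T * P) * R" using P Q(1) by (simp add: mat_normalize)
  then show ?thesis using Q P by auto
qed

text \<open>Q^T Q is idempotent, so Q^T Q Y and Q Y have equal norms, and |Q Y|^2 = <Y, Q^T Q Y> <=
  |Y| |Q Y|. The transposed bound follows in the same way from the first one.\<close>

lemma partial_isometry_contraction:
  assumes Q: "Q \<in> carrier_mat d k" "Q * (Q\<^sup>T * Q) = Q"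
  shows "Y \<in> carrier_mat k m \<Longrightarrow> frob_norm (Q * Y) \<le> frob_norm Y"
    and "Y' \<in> carrier_mat d m' \<Longrightarrow> frob_norm (Q\<^sup>T * Y') \<le> frob_norm Y'"
proof -
  have [simp]: "dim_row Q = d" "dim_col Q = k" using Q by auto
  have le: "a \<le> b" if "a * a \<le> a * b" "0 \<le> a" "0 \<le> b" for a b :: real
    using that by (cases "a = 0") auto
  have 1: "frob_norm (Q * Y) \<le> frob_norm Y" if "Y \<in> carrier_mat k m" for Y m
  proof -
    have [simp]: "dim_row Y = k" "dim_col Y = m" using that by auto
    have "Q\<^sup>T * Q * (Q\<^sup>T * Q) = Q\<^sup>T * Q" using Q(2) by (simp add: mat_normalize)
    then have c: "Q\<^sup>T * (Q * (Q\<^sup>T * (Q * Y))) = Q\<^sup>T * (Q * Y)"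
      using mat_mult_cancel_left[of "Q\<^sup>T * Q" "Q\<^sup>T * Q" _ Y] by (simp add: mat_normalize)
    have "(Q\<^sup>T * (Q * Y)) \<bullet>\<^sub>F (Q\<^sup>T * (Q * Y)) = (Q * Y) \<bullet>\<^sub>F (Q * (Q\<^sup>T * (Q * Y)))"
      by (subst frob_inner_mult_left) auto
    also have "\<dots> = Y \<bullet>\<^sub>F (Q\<^sup>T * (Q * Y))" using c by (subst frob_inner_mult_left) auto
    also have "\<dots> = (Q * Y) \<bullet>\<^sub>F (Q * Y)" using frob_inner_mult_left[where A = Q and B = Y and C = "Q * Y"] by simp
    finally have e: "frob_norm (Q\<^sup>T * (Q * Y)) = frob_norm (Q * Y)" by (simp add: frob_norm_def)
    have "frob_norm (Q * Y) * frob_norm (Q * Y) = Y \<bullet>\<^sub>F (Q\<^sup>T * (Q * Y))"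
      unfolding power2_eq_square[symmetric] frob_norm_sq by (subst frob_inner_mult_left) auto
    also have "\<dots> \<le> frob_norm Y * frob_norm (Q\<^sup>T * (Q * Y))"
      using frob_Cauchy_Schwarz[of Y "Q\<^sup>T * (Q * Y)"] by simp
    finally have "frob_norm (Q * Y) * frob_norm (Q * Y) \<le> frob_norm (Q * Y) * frob_norm Y"
      unfolding e by (simp only: mult.commute)
    then show ?thesis by (rule le) simp_all
  qed
  then show "Y \<in> carrier_mat k m \<Longrightarrow> frob_norm (Q * Y) \<le> frob_norm Y" .
  assume "Y' \<in> carrier_mat d m'"
  then have [simp]: "dim_row Y' = d" "dim_col Y' = m'" by auto
  have "frob_norm (Q\<^sup>T * Y') * frob_norm (Q\<^sup>T * Y') = Y' \<bullet>\<^sub>F (Q * (Q\<^sup>T * Y'))"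
    unfolding power2_eq_square[symmetric] frob_norm_sq by (subst frob_inner_mult_left) auto
  also have "\<dots> \<le> frob_norm Y' * frob_norm (Q * (Q\<^sup>T * Y'))"
    using frob_Cauchy_Schwarz[of Y' "Q * (Q\<^sup>T * Y')"] by simp
  also have "\<dots> \<le> frob_norm Y' * frob_norm (Q\<^sup>T * Y')"
    by (intro mult_left_mono 1[of _ m']) (auto intro: carrier_matI)
  finally have "frob_norm (Q\<^sup>T * Y') * frob_norm (Q\<^sup>T * Y') \<le> frob_norm (Q\<^sup>T * Y') * frob_norm Y'"
    by (simp only: mult.commute)
  then show "frob_norm (Q\<^sup>T * Y') \<le> frob_norm Y'" by (rule le) simp_all
qed

lemma frob_norm_transpose: "frob_norm A\<^sup>T = frob_norm A"
  by (simp add: frob_norm_def frob_inner_transpose)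

text \<open>The trace of Y equals <Q Q^T, Y> for a projection Q Q^T fixing Y, whose Frobenius norm
  is at most \<open>sqrt k\<close>. This is where the factor \<open>sqrt r\<close> in the error
  bound originates.\<close>

lemma trace_low_rank_bound:
  assumes Y: "Y \<in> carrier_mat d d" and r: "mrank Y \<le> k"
  shows "\<bar>1\<^sub>m d \<bullet>\<^sub>F Y\<bar> \<le> sqrt (real k) * frob_norm Y"
proof -
  obtain Q where Q: "Q \<in> carrier_mat d k" "Q * (Q\<^sup>T * Q) = Q" "Q \<bullet>\<^sub>F Q \<le> real k" "Q * (Q\<^sup>T * Y) = Y"
    using low_rank_projection[OF assms] by blast
  have [simp]: "dim_row Q = d" "dim_col Q = k" "dim_row Y = d" "dim_col Y = d" using Q Y by auto
  have "1\<^sub>m d \<bullet>\<^sub>F Y = 1\<^sub>m d \<bullet>\<^sub>F (Q * Q\<^sup>T * Y)" using Q(4) by (simp add: mat_normalize)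
  also have "\<dots> = (Q * Q\<^sup>T) \<bullet>\<^sub>F Y"
    using frob_inner_mult_left[where A = "Q * Q\<^sup>T" and B = "1\<^sub>m d" and C = Y] by (simp add: mat_normalize)
  finally have "\<bar>1\<^sub>m d \<bullet>\<^sub>F Y\<bar> \<le> frob_norm (Q * Q\<^sup>T) * frob_norm Y"
    using frob_Cauchy_Schwarz[of "Q * Q\<^sup>T" Y] by simp
  also have "frob_norm (Q * Q\<^sup>T) \<le> frob_norm Q\<^sup>T"
    using Q by (intro partial_isometry_contraction(1)[of Q d k]) auto
  also have "frob_norm Q\<^sup>T \<le> sqrt (real k)" using Q(3) by (simp add: frob_norm_transpose) (simp add: frob_norm_def)
  finally show ?thesis by (simp add: mult_right_mono)
qed

text \<open>Needed because a rank 2r matrix plus a rank one matrix exceeds the range of the isometry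
  property, while a rank r matrix plus a rank one matrix does not.\<close>

lemma sym_mat_split:
  assumes D: "sym_mat d D" and r: "mrank D \<le> 2 * r"
  shows "\<exists>A B. sym_mat d A \<and> sym_mat d B \<and> mrank A \<le> r \<and> mrank B \<le> r \<and> D = A + B \<and>
    frob_norm A \<le> frob_norm D \<and> frob_norm B \<le> frob_norm D"
proof -
  let ?k = "2 * r"
  have Dc: "D \<in> carrier_mat d d" "D\<^sup>T = D" using D by (auto simp: sym_mat_def)
  obtain Q where Q: "Q \<in> carrier_mat d ?k" "Q * (Q\<^sup>T * Q) = Q" "Q * (Q\<^sup>T * D) = D"
    using low_rank_projection[OF Dc(1) r] by blast
  have [simp]: "dim_row Q = d" "dim_col Q = ?k" "dim_row D = d" "dim_col D = d" using Q Dc by auto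
  have DQ: "D * (Q * Q\<^sup>T) = D" using arg_cong[OF Q(3), of transpose_mat] by (simp add: mat_normalize Dc)
  \<comment> \<open>Diagonalizing the compression instead of D itself gives a list of exactly 2r
    eigenvalues, which can be cut in the middle.\<close>
  define K where "K = Q\<^sup>T * (D * Q)"
  have [simp]: "dim_row K = ?k" "dim_col K = ?k" by (auto simp: K_def)
  have "sym_mat ?k K" by (auto simp: sym_mat_def K_def mat_normalize Dc intro!: carrier_matI)
  then obtain W f where W: "orth_mat ?k W" and K: "K = W * mat_diag ?k f * W\<^sup>T" using sym_mat_spectral by blast
  note [simp] = orth_matD(1,2)[OF W]
  define P where "P = Q * W"
  have [simp]: "dim_row P = d" "dim_col P = ?k" by (auto simp: P_def)
  have Pc: "P \<in> carrier_mat d ?k" by (auto intro: carrier_matI)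
  define part where "part S = P * mat_diag ?k (\<lambda>i. if i \<in> S then f i else 0) * P\<^sup>T" for S
  have Wc: "W \<in> carrier_mat ?k ?k" "W * (W\<^sup>T * W) = W" "W\<^sup>T * (W * W\<^sup>T) = W\<^sup>T"
    by (auto simp: orth_matD[OF W] mat_normalize intro: carrier_matI)
  have diag_le: "frob_norm (mat_diag ?k (\<lambda>i. if i \<in> S then f i else 0)) \<le> frob_norm (mat_diag ?k f)" for S
    unfolding frob_norm_def frob_inner_mat_diag by (intro real_sqrt_le_mono sum_mono) auto
  have conj_le: "frob_norm (R * N * R\<^sup>T) \<le> frob_norm N"
    if "R \<in> carrier_mat a b" "R * (R\<^sup>T * R) = R" "N \<in> carrier_mat b b" for R N a b
  proof -
    have [simp]: "dim_row R = a" "dim_col R = b" "dim_row N = b" "dim_col N = b" using that by auto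
    have "frob_norm (R * N * R\<^sup>T) = frob_norm (R * (N * R\<^sup>T))" by (simp add: mat_normalize)
    also have "\<dots> \<le> frob_norm (N * R\<^sup>T)" 
      using that by (intro partial_isometry_contraction(1)[of R a b _ a]) (auto intro: carrier_matI)
    also have "\<dots> = frob_norm (R * N\<^sup>T)"
      by (subst frob_norm_transpose[symmetric]) (simp add: mat_normalize)
    also have "\<dots> \<le> frob_norm N\<^sup>T"
      using that by (intro partial_isometry_contraction(1)[of R a b _ b]) (auto intro: carrier_matI)
    finally show ?thesis by (simp add: frob_norm_transpose)
  qed
  have "mat_diag ?k f = W\<^sup>T * K * W"
    unfolding K by (simp add: mat_normalize orth_mat_cancel[OF W] orth_matD(3)[OF W])
  then have "frob_norm (mat_diag ?k f) \<le> frob_norm K"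
    using conj_le[of "W\<^sup>T" ?k ?k K] Wc carrier_matI[of K ?k ?k] by simp
  also have "frob_norm K \<le> frob_norm (D * Q)"
    unfolding K_def using Q by (intro partial_isometry_contraction(2)[of Q d ?k _ ?k]) (auto intro: carrier_matI)
  also have "\<dots> = frob_norm (Q\<^sup>T * D)"
    by (subst frob_norm_transpose[symmetric]) (simp add: mat_normalize Dc)
  also have "\<dots> \<le> frob_norm D"
    using Q Dc by (intro partial_isometry_contraction(2)[of Q d ?k _ d]) auto
  finally have f_le: "frob_norm (mat_diag ?k f) \<le> frob_norm D" .
  have part_le: "frob_norm (part S) \<le> frob_norm D" for S
  proof -
    let ?N = "mat_diag ?k (\<lambda>i. if i \<in> S then f i else 0)"
    have "part S = Q * (W * ?N * W\<^sup>T) * Q\<^sup>T" by (simp add: part_def P_def mat_normalize)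
    then have "frob_norm (part S) \<le> frob_norm (W * ?N * W\<^sup>T)"
      using conj_le[of Q d ?k "W * ?N * W\<^sup>T"] Q carrier_matI[of "W * ?N * W\<^sup>T" ?k ?k] by simp
    also have "\<dots> \<le> frob_norm ?N" using conj_le[of W ?k ?k ?N] Wc by auto
    finally show ?thesis using diag_le[of S] f_le by linarith
  qed
  have part_sym: "sym_mat d (part S)" for S
    by (auto simp: sym_mat_def part_def mat_normalize intro!: carrier_matI)
  have "mat_diag ?k f = mat_diag ?k (\<lambda>i. if i \<in> {..<r} then f i else 0) + mat_diag ?k (\<lambda>i. if i \<in> {r..<?k} then f i else 0)"
    by (rule eq_matI) (auto simp: mat_diag_def)
  then have "P * mat_diag ?k f * P\<^sup>T = part {..<r} + part {r..<?k}"
    by (simp add: part_def mat_normalize)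
  moreover have "P * mat_diag ?k f * P\<^sup>T = Q * K * Q\<^sup>T" by (simp add: P_def K mat_normalize)
  moreover have "\<dots> = Q * (Q\<^sup>T * (D * (Q * Q\<^sup>T)))" by (simp add: K_def mat_normalize)
  moreover have "\<dots> = D" by (simp add: DQ Q(3))
  ultimately have "D = part {..<r} + part {r..<?k}" by simp
  moreover have "mrank (part {..<r}) \<le> r" "mrank (part {r..<?k}) \<le> r"
    unfolding part_def using mrank_diag_le[OF Pc, of "{..<r}"] mrank_diag_le[OF Pc, of "{r..<?k}"] by fastforce+
  ultimately show ?thesis using part_le part_sym by blast
qed

section \<open>Nuclear norm and square roots of positive semidefinite matrices\<close>

lemma psd_mat_spectral:
  assumes "psd_mat n A"
  shows "\<exists>Q f. orth_mat n Q \<and> A = Q * mat_diag n f * Q\<^sup>T \<and> (\<forall>i<n. 0 \<le> f i)"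
proof -
  have A: "sym_mat n A" using assms by (simp add: psd_mat_def)
  obtain Q f where Q: "orth_mat n Q" and eq: "A = Q * mat_diag n f * Q\<^sup>T" using sym_mat_spectral[OF A] by blast
  note [simp] = orth_matD(1,2)[OF Q]
  have "0 \<le> f i" if i: "i < n" for i
  proof -
    define y where "y = mat n 1 (\<lambda>(j,_). if j = i then 1 else 0 :: real)"
    have y: "y \<in> carrier_mat n 1" by (simp add: y_def)
    have [simp]: "dim_row y = n" "dim_col y = 1" by (auto simp: y_def)
    have "0 \<le> (Q * y) \<bullet>\<^sub>F (A * (Q * y))"
      by (rule psd_mat_quadratic_form[OF assms, of _ 1]) (auto intro: carrier_matI)
    also have "\<dots> = y \<bullet>\<^sub>F (mat_diag n f * y)"
      by (subst frob_inner_mult_left) (auto simp: eq mat_normalize orth_mat_cancel[OF Q])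
    also have "\<dots> = (\<Sum>j<n. f j * (if j = i then 1 else 0))"
      unfolding frob_inner_diag_mult[OF y] by (intro sum.cong) (auto simp: y_def)
    also have "\<dots> = f i" using i by (simp add: if_distrib[of "(*) _"] cong: if_cong)
    finally show ?thesis .
  qed
  then show ?thesis using Q eq by blast
qed

lemma char_poly_orth_diag:
  assumes Q: "orth_mat n Q"
  shows "char_poly (Q * mat_diag n g * Q\<^sup>T) = (\<Prod>i\<leftarrow>[0..<n]. [:- g i, 1:])"
proof -
  note [simp] = orth_matD(1,2)[OF Q]
  have "similar_mat (Q * mat_diag n g * Q\<^sup>T) (mat_diag n g)"
    by (rule similar_matI[of _ _ Q "Q\<^sup>T" n]) (auto simp: orth_matD[OF Q] intro!: carrier_matI)
  then have "char_poly (Q * mat_diag n g * Q\<^sup>T) = char_poly (mat_diag n g)" by (rule char_poly_similar)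
  also have "\<dots> = (\<Prod>a\<leftarrow>diag_mat (mat_diag n g). [:- a, 1:])"
    by (rule char_poly_upper_triangular[of _ n]) (auto simp: mat_diag_def)
  also have "diag_mat (mat_diag n g) = map g [0..<n]" unfolding diag_mat_def by (simp add: mat_diag_def)
  finally show ?thesis by (simp add: comp_def)
qed

text \<open>On the positive semidefinite cone the nuclear norm is the trace, so the penalty in
  \<open>g_obj\<close> becomes linear there. The eigenvalues of A^T A are the squares of those of A,
  and summing over distinct values with multiplicity is regrouped into a sum over indices.\<close>

lemma nuc_norm_psd:
  assumes "psd_mat n A"
  shows "nuc_norm A = 1\<^sub>m n \<bullet>\<^sub>F A"
proof -
  obtain Q f where Q: "orth_mat n Q" and A: "A = Q * mat_diag n f * Q\<^sup>T" and f: "\<And>i. i < n \<Longrightarrow> 0 \<le> f i"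
    using psd_mat_spectral[OF assms] by blast
  note [simp] = orth_matD(1,2)[OF Q]
  define g where "g = (\<lambda>i. f i * f i)"
  have AA: "A\<^sup>T * A = Q * mat_diag n g * Q\<^sup>T"
    by (simp add: A mat_normalize orth_mat_cancel[OF Q] mat_diag_mult_cancel g_def)
  define p where "p = char_poly (A\<^sup>T * A)"
  have p: "p = (\<Prod>i\<leftarrow>[0..<n]. [:- g i, 1:])" unfolding p_def AA by (rule char_poly_orth_diag[OF Q])
  have p0: "p \<noteq> 0" unfolding p by (auto simp: prod_list_zero_iff)
  have ord: "Polynomial.order \<mu> p = (\<Sum>i<n. if g i = \<mu> then 1 else 0)" for \<mu>
  proof -
    have "Polynomial.order \<mu> p = sum_list (map (Polynomial.order \<mu>) (map (\<lambda>i. [:- g i, 1:]) [0..<n]))"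
      unfolding p by (rule order_prod_list) auto
    also have "\<dots> = (\<Sum>i<n. Polynomial.order \<mu> [:- g i, 1:])"
      by (simp add: comp_def sum_list_distinct_conv_sum_set atLeast0LessThan)
    also have "\<dots> = (\<Sum>i<n. if g i = \<mu> then 1 else 0)" by (intro sum.cong) (auto simp: order_linear')
    finally show ?thesis .
  qed
  define E where "E = {\<mu>. eigenvalue (A\<^sup>T * A) \<mu>}"
  have E: "E = {\<mu>. poly p \<mu> = 0}"
    using eigenvalue_root_char_poly[of "A\<^sup>T * A" n] carrier_matI[of "A\<^sup>T * A" n n]
    by (simp add: E_def p_def A)
  have finE: "finite E" unfolding E using p0 by (rule poly_roots_finite)
  have gE: "g i \<in> E" if "i < n" for i
    using that unfolding E p by (auto simp: poly_prod_list comp_def prod_list_zero_iff)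
  have "nuc_norm A = (\<Sum>\<mu>\<in>E. (\<Sum>i<n. if g i = \<mu> then 1 else 0) * sqrt \<mu>)"
    unfolding nuc_norm_def E_def[symmetric] p_def[symmetric] ord by (simp add: of_nat_sum if_distrib cong: if_cong)
  also have "\<dots> = (\<Sum>\<mu>\<in>E. \<Sum>i<n. if g i = \<mu> then sqrt \<mu> else 0)"
    by (simp add: sum_distrib_right if_distrib[of "\<lambda>x. x * _"] cong: if_cong)
  also have "\<dots> = (\<Sum>i<n. \<Sum>\<mu>\<in>E. if g i = \<mu> then sqrt \<mu> else 0)" by (rule sum.swap)
  also have "\<dots> = (\<Sum>i<n. f i)" using gE finE f by (intro sum.cong) (auto simp: g_def)
  also have "\<dots> = 1\<^sub>m n \<bullet>\<^sub>F mat_diag n f" unfolding mat_diag_one[symmetric] frob_inner_mat_diag by simp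
  also have "\<dots> = (Q\<^sup>T * Q) \<bullet>\<^sub>F mat_diag n f" by (simp add: orth_matD(3)[OF Q])
  also have "\<dots> = Q \<bullet>\<^sub>F (Q * mat_diag n f)" by (subst frob_inner_mult_left) auto
  also have "\<dots> = (1\<^sub>m n * Q) \<bullet>\<^sub>F (Q * mat_diag n f)" by (simp add: mat_one_mult)
  also have "\<dots> = 1\<^sub>m n \<bullet>\<^sub>F A" unfolding A by (subst frob_inner_mult_right) auto
  finally show ?thesis .
qed

lemma psd_mat_factor:
  assumes "psd_mat n A"
  shows "\<exists>R. R \<in> carrier_mat n n \<and> A = R * R\<^sup>T"
proof -
  obtain Q f where Q: "orth_mat n Q" and A: "A = Q * mat_diag n f * Q\<^sup>T" and f: "\<And>i. i < n \<Longrightarrow> 0 \<le> f i"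
    using psd_mat_spectral[OF assms] by blast
  note [simp] = orth_matD(1,2)[OF Q]
  have "mat_diag n (\<lambda>i. sqrt (f i) * sqrt (f i)) = mat_diag n f" using f by (intro mat_diag_cong) auto
  then have "A = (Q * mat_diag n (\<lambda>i. sqrt (f i))) * (Q * mat_diag n (\<lambda>i. sqrt (f i)))\<^sup>T"
    by (simp add: A mat_normalize mat_diag_mult_cancel)
  then show ?thesis by (intro exI[of _ "Q * mat_diag n (\<lambda>i. sqrt (f i))"]) (auto intro: carrier_matI)
qed

lemma psd_mat_gram: "R \<in> carrier_mat d k \<Longrightarrow> psd_mat d (R * R\<^sup>T)"
proof (rule psd_matI)
  fix Y :: "real mat" assume R: "R \<in> carrier_mat d k" and Y: "Y \<in> carrier_mat d 1"
  have "Y \<bullet>\<^sub>F (R * R\<^sup>T * Y) = (R\<^sup>T * Y) \<bullet>\<^sub>F (R\<^sup>T * Y)"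
    using R Y by (subst frob_inner_mult_left) (auto simp: mat_normalize)
  then show "0 \<le> Y \<bullet>\<^sub>F (R * R\<^sup>T * Y)" by simp
qed (auto simp: mat_normalize)

text \<open>\<open>psd_sqrt\<close> is a definite description, so uniqueness of the root must be
  proved too. Entries at least 1 make C dominate the identity, which turns uniqueness into a
  coercivity argument.\<close>

lemma psd_sqrt_orth_diag:
  assumes W: "orth_mat n W" and c: "\<And>i. i < n \<Longrightarrow> 1 \<le> c i"
  shows "psd_sqrt n (W * mat_diag n (\<lambda>i. c i * c i) * W\<^sup>T) = W * mat_diag n c * W\<^sup>T"
proof -
  note [simp] = orth_matD(1,2)[OF W]
  define C where "C = W * mat_diag n c * W\<^sup>T"
  have [simp]: "dim_row C = n" "dim_col C = n" by (auto simp: C_def)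
  have CT: "C\<^sup>T = C" by (simp add: C_def mat_normalize)
  have form: "Y \<bullet>\<^sub>F Y \<le> Y \<bullet>\<^sub>F (C * Y)" if Y: "Y \<in> carrier_mat n m" for Y m
  proof -
    have [simp]: "dim_row Y = n" "dim_col Y = m" using Y by auto
    have "Y \<bullet>\<^sub>F Y = (W * (W\<^sup>T * Y)) \<bullet>\<^sub>F Y" by (simp add: orth_mat_cancel[OF W])
    also have "\<dots> = 1 * ((W\<^sup>T * Y) \<bullet>\<^sub>F (W\<^sup>T * Y))" by (subst frob_inner_mult_left) auto
    also have "\<dots> \<le> (W\<^sup>T * Y) \<bullet>\<^sub>F (mat_diag n c * (W\<^sup>T * Y))"
      by (rule diag_form_lower[of _ n m]) (auto simp: c intro: carrier_matI)
    also have "\<dots> = Y \<bullet>\<^sub>F (C * Y)"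
      by (subst frob_inner_mult_left) (auto simp: C_def mat_normalize)
    finally show ?thesis .
  qed
  have psdC: "psd_mat n C"
    using form by (intro psd_matI) (auto simp: CT intro: carrier_matI order_trans[OF frob_inner_nonneg])
  have CC: "C * C = W * mat_diag n (\<lambda>i. c i * c i) * W\<^sup>T"
    by (simp add: C_def mat_normalize orth_mat_cancel[OF W] mat_diag_mult_cancel)
  have "B = C" if B: "psd_mat n B" "B * B = C * C" for B
  proof -
    have Bd [simp]: "dim_row B = n" "dim_col B = n" and BT: "B\<^sup>T = B"
      using B by (auto simp: psd_mat_def sym_mat_def)
    define H where "H = B - C"
    have [simp]: "dim_row H = n" "dim_col H = n" by (auto simp: H_def)
    have HT: "H\<^sup>T = H" by (simp add: H_def mat_normalize BT CT)
    have Hc: "H \<in> carrier_mat n n" by (auto intro: carrier_matI)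
    \<comment> \<open>The two mixed products C * B cancel. Pairing the vanishing sum with H gives a
      nonnegative term from B plus one of at least |H|^2 from C, so H = 0.\<close>
    have "H * B + C * H = B * B - C * C"
      by (simp add: H_def mat_normalize) (rule eq_matI, auto)
    also have "\<dots> = 0\<^sub>m n n" using B(2) by (simp add: mat_normalize) (rule eq_matI, auto)
    finally have "H \<bullet>\<^sub>F (H * B + C * H) = 0" by simp
    then have "H \<bullet>\<^sub>F (H * B) + H \<bullet>\<^sub>F (C * H) = 0" by (simp add: frob_inner_linear)
    moreover have "H \<bullet>\<^sub>F (H * B) = H \<bullet>\<^sub>F (B * H)"
      using frob_inner_transpose[of H "H * B"] by (simp add: mat_normalize HT BT)
    ultimately have "H \<bullet>\<^sub>F H \<le> 0"
      using psd_mat_quadratic_form[OF B(1) Hc] form[OF Hc] by linarith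
    then have "H \<bullet>\<^sub>F H = 0" using frob_inner_nonneg[of H] by linarith
    then have "H = 0\<^sub>m n n" using frob_inner_eq_0_iff[of H] by simp
    then show ?thesis unfolding H_def by (subst mat_eq_iff_minus_zero) (auto intro: carrier_matI)
  qed
  then show ?thesis unfolding psd_sqrt_def CC[symmetric] C_def[symmetric]
    using psdC by (intro the_equality) blast+
qed

lemma mat_inv_eqI:
  assumes "A \<in> carrier_mat k k" "B \<in> carrier_mat k k" "A * B = 1\<^sub>m k" "B * A = 1\<^sub>m k"
  shows "mat_inv k A = B"
  unfolding mat_inv_def
proof (rule the_equality)
  fix D assume D: "D \<in> carrier_mat k k \<and> A * D = 1\<^sub>m k \<and> D * A = 1\<^sub>m k"
  have [simp]: "dim_row D = k" "dim_col D = k" "dim_row A = k" "dim_col A = k" "dim_row B = k" "dim_col B = k"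
    using D assms by auto
  have "D = D * (A * B)" using assms by (simp add: mat_mult_one)
  also have "\<dots> = D * A * B" by (simp add: mat_mult_assoc)
  also have "D * A = 1\<^sub>m k" using D by simp
  finally show "D = B" by (simp add: mat_one_mult)
qed (use assms in auto)

text \<open>The rotation W drops out of the outer product, and on singular values the debiasing is s
  (1 + lam / s) = s + lam.\<close>

lemma U_deb_svd:
  assumes svd: "svd_form d r U VU s W" and lam: "0 \<le> lam"
  shows "U_deb r lam U * (U_deb r lam U)\<^sup>T = VU * mat_diag r (\<lambda>i. s i + lam) * VU\<^sup>T"
proof -
  have W: "orth_mat r W" and VV: "VU\<^sup>T * VU = 1\<^sub>m r" and s: "\<And>i. i < r \<Longrightarrow> 0 < s i"
    and U: "U = VU * mat_diag r (\<lambda>i. sqrt (s i)) * W\<^sup>T"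
    using svd by (auto simp: svd_form_def orth_mat_def)
  have [simp]: "dim_row VU = d" "dim_col VU = r" using svd by (auto simp: svd_form_def)
  note [simp] = orth_matD(1,2)[OF W]
  note W_cancel = orth_mat_cancel[OF W] orth_matD(3,4)[OF W]
  have VV_cancel: "VU\<^sup>T * (VU * Y) = Y" if "dim_row Y = r" for Y
    using mat_mult_cancel_left[OF VV, of Y] that by (simp add: mat_one_mult)
  have UU: "U\<^sup>T * U = W * mat_diag r s * W\<^sup>T"
  proof -
    have "U\<^sup>T * U = W * (mat_diag r (\<lambda>i. sqrt (s i) * sqrt (s i)) * W\<^sup>T)"
      by (simp add: U mat_normalize VV_cancel mat_diag_mult_cancel)
    also have "mat_diag r (\<lambda>i. sqrt (s i) * sqrt (s i)) = mat_diag r s"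
      by (intro mat_diag_cong) (auto simp: s less_imp_le)
    finally show ?thesis by (simp add: mat_normalize)
  qed
  have nz: "s i \<noteq> 0" if "i < r" for i using s[OF that] by simp
  have one: "mat_diag r (\<lambda>i. s i * (1 / s i)) = 1\<^sub>m r" "mat_diag r (\<lambda>i. 1 / s i * s i) = 1\<^sub>m r"
    unfolding mat_diag_one[symmetric] by (rule mat_diag_cong, simp add: nz)+
  have inv: "mat_inv r (U\<^sup>T * U) = W * mat_diag r (\<lambda>i. 1 / s i) * W\<^sup>T"
  proof (rule mat_inv_eqI)
    show "U\<^sup>T * U * (W * mat_diag r (\<lambda>i. 1 / s i) * W\<^sup>T) = 1\<^sub>m r"
      unfolding UU by (simp only: mat_normalize W_cancel mat_diag_mult_cancel one orth_matD(1,2)[OF W]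
          dim_mat_diag index_mult_mat index_transpose_mat)
    show "W * mat_diag r (\<lambda>i. 1 / s i) * W\<^sup>T * (U\<^sup>T * U) = 1\<^sub>m r"
      unfolding UU by (simp only: mat_normalize W_cancel mat_diag_mult_cancel one orth_matD(1,2)[OF W]
          dim_mat_diag index_mult_mat index_transpose_mat)
  qed (auto simp: UU intro!: carrier_matI)
  define c where "c i = sqrt (1 + lam / s i)" for i
  have c: "c i * c i = 1 + lam / s i" "1 \<le> c i" if "i < r" for i
    using s[OF that] lam by (auto simp: c_def)
  have "1\<^sub>m r + lam \<cdot>\<^sub>m mat_inv r (U\<^sup>T * U) = W * (1\<^sub>m r + lam \<cdot>\<^sub>m mat_diag r (\<lambda>i. 1 / s i)) * W\<^sup>T"
    unfolding inv by (simp add: mat_normalize W_cancel)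
  also have "1\<^sub>m r + lam \<cdot>\<^sub>m mat_diag r (\<lambda>i. 1 / s i) = mat_diag r (\<lambda>i. c i * c i)"
    using c by (intro eq_matI) (auto simp: mat_diag_def)
  finally have "psd_sqrt r (1\<^sub>m r + lam \<cdot>\<^sub>m mat_inv r (U\<^sup>T * U)) = W * mat_diag r c * W\<^sup>T"
    using psd_sqrt_orth_diag[OF W c(2)] by simp
  then have "U_deb r lam U = VU * (mat_diag r (\<lambda>i. sqrt (s i) * c i) * W\<^sup>T)"
    by (simp add: U_deb_def) (simp add: U mat_normalize W_cancel mat_diag_mult_cancel)
  then have "U_deb r lam U * (U_deb r lam U)\<^sup>T = VU * mat_diag r (\<lambda>i. (sqrt (s i) * c i) * (sqrt (s i) * c i)) * VU\<^sup>T"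
    by (simp add: mat_normalize W_cancel mat_diag_mult_cancel)
  also have "mat_diag r (\<lambda>i. (sqrt (s i) * c i) * (sqrt (s i) * c i)) = mat_diag r (\<lambda>i. s i + lam)"
  proof (rule mat_diag_cong)
    fix i assume i: "i < r"
    have "(sqrt (s i) * c i) * (sqrt (s i) * c i) = (sqrt (s i) * sqrt (s i)) * (c i * c i)" by (simp only: mult_ac)
    also have "\<dots> = s i * (1 + lam / s i)" using s[OF i] c(1)[OF i] by simp
    also have "\<dots> = s i + lam" using s[OF i] by (simp add: field_simps)
    finally show "(sqrt (s i) * c i) * (sqrt (s i) * c i) = s i + lam" .
  qed
  finally show ?thesis .
qed

text \<open>The lower bound b is full column rank in quantitative form: it makes every eigenvalue of
  U^T U positive, so their square roots can be divided out.\<close>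

lemma svd_form_exists:
  assumes U: "U \<in> carrier_mat d r"
    and b: "0 < b" "\<And>a. a \<in> carrier_mat r 1 \<Longrightarrow> b * (a \<bullet>\<^sub>F a) \<le> (U * a) \<bullet>\<^sub>F (U * a)"
  shows "\<exists>VU s W. svd_form d r U VU s W"
proof -
  have [simp]: "dim_row U = d" "dim_col U = r" using U by auto
  have "sym_mat r (U\<^sup>T * U)" by (auto simp: sym_mat_def mat_normalize intro: carrier_matI)
  then obtain W s where W: "orth_mat r W" and UU: "U\<^sup>T * U = W * mat_diag r s * W\<^sup>T"
    using sym_mat_spectral by blast
  note [simp] = orth_matD(1,2)[OF W]
  note W_cancel = orth_mat_cancel[OF W] orth_matD(3,4)[OF W]
  have s: "0 < s i" if i: "i < r" for i
  proof -
    define y where "y = mat r 1 (\<lambda>(j,_). if j = i then 1 else 0 :: real)"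
    have y: "y \<in> carrier_mat r 1" by (simp add: y_def)
    have [simp]: "dim_row y = r" "dim_col y = 1" by (auto simp: y_def)
    have "b * ((W * y) \<bullet>\<^sub>F (W * y)) \<le> (U * (W * y)) \<bullet>\<^sub>F (U * (W * y))"
      by (rule b(2)) (auto intro: carrier_matI)
    also have "(W * y) \<bullet>\<^sub>F (W * y) = y \<bullet>\<^sub>F y" by (subst frob_inner_mult_left) (auto simp: W_cancel)
    also have "y \<bullet>\<^sub>F y = 1" using i by (simp add: frob_inner_def y_def if_distrib[of "(*) _"] cong: if_cong)
    also have "(U * (W * y)) \<bullet>\<^sub>F (U * (W * y)) = (W * y) \<bullet>\<^sub>F (U\<^sup>T * U * (W * y))"
      by (subst frob_inner_mult_left) (auto simp: mat_normalize)
    also have "\<dots> = y \<bullet>\<^sub>F (mat_diag r s * y)"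
      unfolding UU by (subst frob_inner_mult_left) (auto simp: mat_normalize W_cancel)
    also have "\<dots> = (\<Sum>j<r. s j * (if j = i then 1 else 0))"
      unfolding frob_inner_diag_mult[OF y] by (intro sum.cong) (auto simp: y_def)
    also have "\<dots> = s i" using i by (simp add: if_distrib[of "(*) _"] cong: if_cong)
    finally show ?thesis using b(1) by simp
  qed
  define VU where "VU = U * W * mat_diag r (\<lambda>i. 1 / sqrt (s i))"
  have "VU\<^sup>T * VU = mat_diag r (\<lambda>i. 1 / sqrt (s i)) * (W\<^sup>T * (U\<^sup>T * U * (W * mat_diag r (\<lambda>i. 1 / sqrt (s i)))))"
    by (simp add: VU_def mat_normalize)
  also have "\<dots> = mat_diag r (\<lambda>i. 1 / sqrt (s i) * (s i * (1 / sqrt (s i))))"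
    unfolding UU by (simp add: mat_normalize W_cancel)
  also have "\<dots> = 1\<^sub>m r" unfolding mat_diag_one[symmetric]
  proof (rule mat_diag_cong)
    show "1 / sqrt (s i) * (s i * (1 / sqrt (s i))) = 1" if "i < r" for i using s[OF that] by simp
  qed
  finally have VV: "VU\<^sup>T * VU = 1\<^sub>m r" .
  have "VU * mat_diag r (\<lambda>i. sqrt (s i)) * W\<^sup>T = U * (W * (mat_diag r (\<lambda>i. 1 / sqrt (s i) * sqrt (s i)) * W\<^sup>T))"
    by (simp add: VU_def mat_normalize mat_diag_mult_cancel)
  also have "mat_diag r (\<lambda>i. 1 / sqrt (s i) * sqrt (s i)) = 1\<^sub>m r" unfolding mat_diag_one[symmetric]
  proof (rule mat_diag_cong)
    show "1 / sqrt (s i) * sqrt (s i) = 1" if "i < r" for i using s[OF that] by simp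
  qed
  finally have "U = VU * mat_diag r (\<lambda>i. sqrt (s i)) * W\<^sup>T" by (simp add: mat_normalize W_cancel)
  moreover have "VU \<in> carrier_mat d r" by (auto simp: VU_def intro: carrier_matI)
  ultimately show ?thesis using VV W s unfolding svd_form_def orth_mat_def by blast
qed

section \<open>Best low-rank approximation\<close>

text \<open>Eckart-Young with uniqueness from a spectral gap. If Q Q^T projects onto the columns of
  a competitor, its error is at least |A|^2 - |A Q|^2. With \<open>p i\<close> the squared overlap
  of column i of V with Q, the V part captures the sum of a_i^2 p_i, and E at most \<tau>^2 times
  the sum of 1 - p_i, which makes the competitor worse by at least the sum of (a_i^2 - \<tau>^2) (1
  - p_i).\<close>

lemma best_rank_approx_unique:
  assumes V: "V \<in> carrier_mat d r" "V\<^sup>T * V = 1\<^sub>m r"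
    and E: "sym_mat d E" "E * V = 0\<^sub>m d r"
    and tau: "0 \<le> \<tau>" "\<And>i. i < r \<Longrightarrow> \<tau> < a i"
    and Ele: "\<And>Y. Y \<in> carrier_mat d r \<Longrightarrow> (E * Y) \<bullet>\<^sub>F (E * Y) \<le> \<tau>\<^sup>2 * (Y \<bullet>\<^sub>F Y)"
  shows "best_rank_approx r (V * mat_diag r a * V\<^sup>T + E) Y \<longleftrightarrow> Y = V * mat_diag r a * V\<^sup>T"
proof -
  define Y0 where "Y0 = V * mat_diag r a * V\<^sup>T"
  define A where "A = Y0 + E"
  have [simp]: "dim_row V = d" "dim_col V = r" "dim_row E = d" "dim_col E = d"
    using V E by (auto simp: sym_mat_def)
  have [simp]: "dim_row Y0 = d" "dim_col Y0 = d" "dim_row A = d" "dim_col A = d" by (auto simp: Y0_def A_def)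
  have ET: "E\<^sup>T = E" using E by (simp add: sym_mat_def)
  have VE: "V\<^sup>T * E = 0\<^sub>m r d" using arg_cong[OF E(2), of transpose_mat] by (simp add: mat_normalize ET)
  have V_cancel: "V\<^sup>T * (V * Y) = Y" if "dim_row Y = r" for Y
    using mat_mult_cancel_left[OF V(2), of Y] that by (simp add: mat_one_mult)
  have VE_cancel: "V\<^sup>T * (E * Y) = 0\<^sub>m r (dim_col Y)" if "dim_row Y = d" for Y
    using mat_mult_cancel_left[OF VE, of Y] that by (simp add: mat_zero_mult)
  have EV_cancel: "E * (V * Y) = 0\<^sub>m d (dim_col Y)" if "dim_row Y = r" for Y
    using mat_mult_cancel_left[OF E(2), of Y] that by (simp add: mat_zero_mult)
  have Y0E: "(Y0 * Q) \<bullet>\<^sub>F (E * Q) = 0" if "dim_row Q = d" for Q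
    unfolding Y0_def using that
    by (simp add: mat_mult_assoc) (subst frob_inner_mult_left, simp_all add: VE_cancel)
  have split: "(A * Q) \<bullet>\<^sub>F (A * Q) = (Y0 * Q) \<bullet>\<^sub>F (Y0 * Q) + (E * Q) \<bullet>\<^sub>F (E * Q)" if "dim_row Q = d" for Q
    using Y0E[OF that] frob_inner_commute[of "Y0 * Q" "E * Q"] that
    by (simp add: A_def mat_normalize frob_inner_linear)
  have Y0V: "(Y0 * Q) \<bullet>\<^sub>F (Y0 * Q) = (mat_diag r a * (V\<^sup>T * Q)) \<bullet>\<^sub>F (mat_diag r a * (V\<^sup>T * Q))"
    if "dim_row Q = d" for Q
    unfolding Y0_def using that
    by (simp add: mat_mult_assoc) (subst frob_inner_mult_left, simp_all add: V_cancel)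
  have Y0Y0: "Y0 \<bullet>\<^sub>F Y0 = (\<Sum>i<r. (a i)\<^sup>2)"
  proof -
    have "Y0 \<bullet>\<^sub>F Y0 = (Y0 * 1\<^sub>m d) \<bullet>\<^sub>F (Y0 * 1\<^sub>m d)" by (simp add: mat_mult_one)
    also have "\<dots> = (mat_diag r a * V\<^sup>T) \<bullet>\<^sub>F (mat_diag r a * V\<^sup>T)"
      by (subst Y0V) (auto simp: mat_mult_one)
    also have "\<dots> = mat_diag r a \<bullet>\<^sub>F mat_diag r a"
      by (subst frob_inner_mult_right) (auto simp: mat_normalize V)
    finally show ?thesis by (simp add: frob_inner_mat_diag power2_eq_square)
  qed
  have AA: "A \<bullet>\<^sub>F A = (\<Sum>i<r. (a i)\<^sup>2) + E \<bullet>\<^sub>F E" using split[of "1\<^sub>m d"] Y0Y0 by (simp add: mat_mult_one)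
  have AY0: "A - Y0 = E" by (rule eq_matI) (auto simp: A_def)
  have lower: "E \<bullet>\<^sub>F E \<le> (A - Y) \<bullet>\<^sub>F (A - Y) \<and> ((A - Y) \<bullet>\<^sub>F (A - Y) \<le> E \<bullet>\<^sub>F E \<longrightarrow> Y = Y0)"
    if Y: "Y \<in> carrier_mat d d" "mrank Y \<le> r" for Y
  proof -
    obtain Q where Q: "Q \<in> carrier_mat d r" "Q * (Q\<^sup>T * Q) = Q" "Q \<bullet>\<^sub>F Q \<le> real r" "Q * (Q\<^sup>T * Y) = Y"
      using low_rank_projection[OF Y] by blast
    have [simp]: "dim_row Q = d" "dim_col Q = r" "dim_row Y = d" "dim_col Y = d" using Q Y by auto
    have QT: "Q\<^sup>T * (Q * Q\<^sup>T) = Q\<^sup>T" using arg_cong[OF Q(2), of transpose_mat] by (simp add: mat_normalize)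
    have Q_cancel: "Q\<^sup>T * (Q * (Q\<^sup>T * Z)) = Q\<^sup>T * Z" if "dim_row Z = d" for Z
      using mat_mult_cancel_left[OF QT, of Z] that by (simp add: mat_mult_assoc)
    define S where "S = V\<^sup>T * Q"
    have [simp]: "dim_row S = r" "dim_col S = r" by (auto simp: S_def)
    have Sc: "S \<in> carrier_mat r r" by (auto intro: carrier_matI)
    define p where "p i = (\<Sum>j<r. (S $$ (i,j))\<^sup>2)" for i
    have SS: "S \<bullet>\<^sub>F S = (\<Sum>i<r. p i)" by (simp add: frob_inner_def p_def power2_eq_square)
    have p1: "p i \<le> 1" if i: "i < r" for i
    proof -
      define y where "y = mat r 1 (\<lambda>(j,_). if j = i then 1 else 0 :: real)"
      have [simp]: "dim_row y = r" "dim_col y = 1" by (auto simp: y_def)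
      have "(S\<^sup>T * y) $$ (j,0) = S $$ (i,j)" if "j < r" for j
        using that i by (subst mult_mat_entry) (auto simp: y_def if_distrib[of "(*) _"] cong: if_cong)
      then have "(S\<^sup>T * y) \<bullet>\<^sub>F (S\<^sup>T * y) = p i" unfolding frob_inner_def p_def
        by (simp add: power2_eq_square del: index_mult_mat(1))
      moreover have "S\<^sup>T * y = Q\<^sup>T * (V * y)" by (simp add: S_def mat_normalize)
      moreover have "frob_norm (Q\<^sup>T * (V * y)) \<le> frob_norm (V * y)"
        by (rule partial_isometry_contraction(2)[OF Q(1,2), of _ 1], rule carrier_matI) simp_all
      then have "(Q\<^sup>T * (V * y)) \<bullet>\<^sub>F (Q\<^sup>T * (V * y)) \<le> (V * y) \<bullet>\<^sub>F (V * y)"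
        by (simp add: frob_norm_def)
      moreover have "(V * y) \<bullet>\<^sub>F (V * y) = y \<bullet>\<^sub>F y" by (subst frob_inner_mult_left) (auto simp: V_cancel)
      moreover have "y \<bullet>\<^sub>F y = 1" using i by (simp add: frob_inner_def y_def if_distrib[of "(*) _"] cong: if_cong)
      ultimately show ?thesis by simp
    qed
    have Y0Q: "(Y0 * Q) \<bullet>\<^sub>F (Y0 * Q) = (\<Sum>i<r. (a i)\<^sup>2 * p i)"
      unfolding Y0V[of Q, simplified] S_def[symmetric] p_def
      using Sc by (simp add: frob_inner_def mat_diag_mult_left[OF Sc] power2_eq_square sum_distrib_left algebra_simps)
    \<comment> \<open>E annihilates the span of V and therefore sees only the part R of Q outside
      it, whose squared norm is at most r minus the total overlap.\<close>
    define R where "R = Q - V * S"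
    have [simp]: "dim_row R = d" "dim_col R = r" by (auto simp: R_def)
    have "E * Q = E * R"
      by (simp add: R_def mat_normalize EV_cancel) (rule eq_matI, auto)
    have "(V * S) \<bullet>\<^sub>F Q = S \<bullet>\<^sub>F S" by (subst frob_inner_mult_left) (auto simp: S_def)
    moreover have "(V * S) \<bullet>\<^sub>F (V * S) = S \<bullet>\<^sub>F S" by (subst frob_inner_mult_left) (auto simp: V_cancel)
    ultimately have RR: "R \<bullet>\<^sub>F R = Q \<bullet>\<^sub>F Q - S \<bullet>\<^sub>F S"
      using frob_inner_commute[of Q "V * S"] by (simp add: R_def frob_inner_linear)
    have EQ: "(E * Q) \<bullet>\<^sub>F (E * Q) \<le> \<tau>\<^sup>2 * (\<Sum>i<r. 1 - p i)"
    proof -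
      have "(E * Q) \<bullet>\<^sub>F (E * Q) \<le> \<tau>\<^sup>2 * (R \<bullet>\<^sub>F R)"
        unfolding \<open>E * Q = E * R\<close> by (rule Ele) (auto intro: carrier_matI)
      also have "\<dots> \<le> \<tau>\<^sup>2 * (\<Sum>i<r. 1 - p i)"
        using RR SS Q(3) by (intro mult_left_mono) (auto simp: sum_subtractf)
      finally show ?thesis .
    qed
    \<comment> \<open>Pythagoras: D1 lies outside the range of Q and D2 inside it.\<close>
    define D1 where "D1 = A - Q * (Q\<^sup>T * A)"
    define D2 where "D2 = Q * (Q\<^sup>T * A) - Y"
    have [simp]: "dim_row D1 = d" "dim_col D1 = d" "dim_row D2 = d" "dim_col D2 = d" by (auto simp: D1_def D2_def)
    have "A - Y = D1 + D2" unfolding D1_def D2_def by (rule eq_matI) (auto simp del: index_mult_mat(1))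
    have QD1: "Q\<^sup>T * D1 = 0\<^sub>m r d"
      by (simp add: D1_def mat_normalize Q_cancel) (rule eq_matI, auto)
    have "D2 = Q * (Q\<^sup>T * A - Q\<^sup>T * Y)" by (simp add: D2_def mat_normalize Q(4))
    then have "D2 \<bullet>\<^sub>F D1 = 0" by (simp add: frob_inner_mult_left QD1)
    then have AY: "(A - Y) \<bullet>\<^sub>F (A - Y) = D1 \<bullet>\<^sub>F D1 + D2 \<bullet>\<^sub>F D2"
      unfolding \<open>A - Y = D1 + D2\<close> using frob_inner_commute[of D1 D2] by (simp add: frob_inner_linear)
    have q1: "(Q * (Q\<^sup>T * A)) \<bullet>\<^sub>F A = (A * Q) \<bullet>\<^sub>F (A * Q)"
    proof -
      have AT: "A\<^sup>T = A" by (simp add: A_def Y0_def mat_normalize ET)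
      have "(Q * (Q\<^sup>T * A)) \<bullet>\<^sub>F A = (Q\<^sup>T * A) \<bullet>\<^sub>F (Q\<^sup>T * A)" by (subst frob_inner_mult_left) auto
      also have "\<dots> = (Q\<^sup>T * A)\<^sup>T \<bullet>\<^sub>F (Q\<^sup>T * A)\<^sup>T" by (simp add: frob_inner_transpose)
      finally show ?thesis by (simp add: mat_normalize AT)
    qed
    have q2: "(Q * (Q\<^sup>T * A)) \<bullet>\<^sub>F (Q * (Q\<^sup>T * A)) = (Q * (Q\<^sup>T * A)) \<bullet>\<^sub>F A"
      using frob_inner_mult_left[where A = Q and B = "Q\<^sup>T * A" and C = "Q * (Q\<^sup>T * A)"]
        frob_inner_mult_left[where A = Q and B = "Q\<^sup>T * A" and C = A] by (simp add: Q_cancel)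
    have D1D1: "D1 \<bullet>\<^sub>F D1 = A \<bullet>\<^sub>F A - (A * Q) \<bullet>\<^sub>F (A * Q)"
      using q1 q2 frob_inner_commute[of A "Q * (Q\<^sup>T * A)"] by (simp add: D1_def frob_inner_linear)
    have main: "E \<bullet>\<^sub>F E + (\<Sum>i<r. ((a i)\<^sup>2 - \<tau>\<^sup>2) * (1 - p i)) + D2 \<bullet>\<^sub>F D2 \<le> (A - Y) \<bullet>\<^sub>F (A - Y)"
      using EQ unfolding AY D1D1 AA split[of Q, simplified] Y0Q
      by (simp add: sum_distrib_left sum_distrib_right sum_subtractf algebra_simps sum.distrib)
    have pos: "0 < (a i)\<^sup>2 - \<tau>\<^sup>2" if "i < r" for i
      using tau that power_strict_mono[of \<tau> "a i" 2] by auto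
    have nn: "0 \<le> ((a i)\<^sup>2 - \<tau>\<^sup>2) * (1 - p i)" if "i < r" for i
      using pos[OF that] p1[OF that] by simp
    have sn: "0 \<le> (\<Sum>i<r. ((a i)\<^sup>2 - \<tau>\<^sup>2) * (1 - p i))" using nn by (intro sum_nonneg) auto
    have "Y = Y0" if le: "(A - Y) \<bullet>\<^sub>F (A - Y) \<le> E \<bullet>\<^sub>F E"
    proof -
      have "(\<Sum>i<r. ((a i)\<^sup>2 - \<tau>\<^sup>2) * (1 - p i)) = 0" and D20: "D2 \<bullet>\<^sub>F D2 = 0"
        using le main sn frob_inner_nonneg[of D2] by linarith+
      then have "((a i)\<^sup>2 - \<tau>\<^sup>2) * (1 - p i) = 0" if "i < r" for i
        using that nn by (subst (asm) sum_nonneg_eq_0_iff) auto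
      then have p: "p i = 1" if "i < r" for i using that pos[OF that] by fastforce
      \<comment> \<open>Full overlap forces Q and V to span the same space: neither has a component
        outside the other. Then Q Q^T A = V V^T A = Y0.\<close>
      then have SSr: "S \<bullet>\<^sub>F S = real r" unfolding SS by simp
      then have "R \<bullet>\<^sub>F R = 0" using RR Q(3) frob_inner_nonneg[of R] by linarith
      then have "R = 0\<^sub>m d r" using frob_inner_eq_0_iff[of R] by simp
      then have QVS: "Q = V * S" unfolding R_def
        by (subst mat_eq_iff_minus_zero[of _ d r]) (auto intro: carrier_matI)
      have VV: "V \<bullet>\<^sub>F V = real r"
      proof -
        have "V \<bullet>\<^sub>F V = (V * 1\<^sub>m r) \<bullet>\<^sub>F V" by (simp add: mat_mult_one)
        also have "\<dots> = 1\<^sub>m r \<bullet>\<^sub>F 1\<^sub>m r" by (subst frob_inner_mult_left) (auto simp: V)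
        finally show ?thesis unfolding mat_diag_one[symmetric] frob_inner_mat_diag by simp
      qed
      have x1: "(Q * (Q\<^sup>T * V)) \<bullet>\<^sub>F V = S \<bullet>\<^sub>F S"
      proof -
        have "(Q * (Q\<^sup>T * V)) \<bullet>\<^sub>F V = (Q\<^sup>T * V) \<bullet>\<^sub>F (Q\<^sup>T * V)" by (subst frob_inner_mult_left) auto
        also have "\<dots> = S\<^sup>T \<bullet>\<^sub>F S\<^sup>T" by (simp add: S_def mat_normalize)
        finally show ?thesis by (simp add: frob_inner_transpose)
      qed
      have x2: "(Q * (Q\<^sup>T * V)) \<bullet>\<^sub>F (Q * (Q\<^sup>T * V)) = (Q * (Q\<^sup>T * V)) \<bullet>\<^sub>F V"
        using frob_inner_mult_left[where A = Q and B = "Q\<^sup>T * V" and C = "Q * (Q\<^sup>T * V)"]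
          frob_inner_mult_left[where A = Q and B = "Q\<^sup>T * V" and C = V] by (simp add: Q_cancel)
      have "(V - Q * (Q\<^sup>T * V)) \<bullet>\<^sub>F (V - Q * (Q\<^sup>T * V)) = 0"
        using x1 x2 VV SSr frob_inner_commute[of V "Q * (Q\<^sup>T * V)"] by (simp add: frob_inner_linear)
      then have "V - Q * (Q\<^sup>T * V) = 0\<^sub>m d r" using frob_inner_eq_0_iff[of "V - Q * (Q\<^sup>T * V)"] by simp
      then have VQ: "V = Q * (Q\<^sup>T * V)"
        by (subst mat_eq_iff_minus_zero[of _ d r]) (auto intro: carrier_matI)
      have SQ: "S * Q\<^sup>T = V\<^sup>T"
        using arg_cong[OF VQ[symmetric], of transpose_mat] by (simp add: S_def mat_normalize)
      have "Q * (Q\<^sup>T * A) = V * (S * Q\<^sup>T * A)" by (subst (1) QVS) (simp add: mat_mult_assoc)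
      also have "\<dots> = V * (V\<^sup>T * A)" unfolding SQ ..
      also have "V\<^sup>T * A = V\<^sup>T * Y0" by (simp add: A_def mat_normalize VE) (rule eq_matI, auto simp: Y0_def)
      also have "V * (V\<^sup>T * Y0) = Y0" by (simp add: Y0_def mat_normalize V_cancel)
      finally have "Q * (Q\<^sup>T * A) = Y0" .
      moreover have "D2 = 0\<^sub>m d d" using D20 frob_inner_eq_0_iff[of D2] by simp
      ultimately have "Y0 - Y = 0\<^sub>m d d" by (simp add: D2_def)
      then have "Y0 = Y" by (subst mat_eq_iff_minus_zero[of _ d d]) (auto intro: carrier_matI)
      then show ?thesis ..
    qed
    then show ?thesis using main sn frob_inner_nonneg[of D2] by linarith
  qed
  have rank0: "mrank Y0 \<le> r"
    using mrank_mult_le[of V "mat_diag r a * V\<^sup>T"] by (simp add: Y0_def mat_mult_assoc)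
  have Y0c: "Y0 \<in> carrier_mat d d" by (auto intro: carrier_matI)
  show ?thesis unfolding Y0_def[symmetric] A_def[symmetric]
  proof
    assume "best_rank_approx r A Y"
    then have Y: "Y \<in> carrier_mat d d" "mrank Y \<le> r" and le: "frob_norm (A - Y) \<le> frob_norm (A - Y0)"
      using rank0 Y0c by (auto simp: best_rank_approx_def)
    have "(A - Y) \<bullet>\<^sub>F (A - Y) \<le> E \<bullet>\<^sub>F E" using le by (simp add: AY0 frob_norm_def)
    then show "Y = Y0" using lower[OF Y] by blast
  next
    assume Y: "Y = Y0"
    have "frob_norm (A - Y0) \<le> frob_norm (A - Y')" if "Y' \<in> carrier_mat d d" "mrank Y' \<le> r" for Y'
      unfolding AY0 frob_norm_def using lower[OF that] by simp
    then show "best_rank_approx r A Y" unfolding best_rank_approx_def Y using rank0 Y0c by simp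
  qed
qed

section \<open>Alignment of factors\<close>

text \<open>From U^T L = P S Q^T the rotation Q P^T turns U^T L into P S P^T; it is the orthogonal
  Procrustes solution aligning L with U.\<close>

lemma procrustes_alignment:
  assumes "U \<in> carrier_mat d r" "L \<in> carrier_mat d r"
  shows "\<exists>R. orth_mat r R \<and> psd_mat r (U\<^sup>T * (L * R))"
proof -
  have [simp]: "dim_row U = d" "dim_col U = r" "dim_row L = d" "dim_col L = r" using assms by auto
  have "U\<^sup>T * L \<in> carrier_mat r r" by (auto intro: carrier_matI)
  then obtain P Q s where P: "orth_mat r P" and Q: "orth_mat r Q" and s: "\<And>i. i < r \<Longrightarrow> 0 \<le> s i"
    and UL: "U\<^sup>T * L = P * mat_diag r s * Q\<^sup>T"
    using square_mat_svd by blast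
  note [simp] = orth_matD(1,2)[OF P] orth_matD(1,2)[OF Q]
  have "U\<^sup>T * (L * (Q * P\<^sup>T)) = (U\<^sup>T * L) * (Q * P\<^sup>T)" by (simp add: mat_mult_assoc)
  also have "\<dots> = P * (mat_diag r s * P\<^sup>T)" unfolding UL by (simp add: mat_normalize orth_mat_cancel[OF Q])
  also have "\<dots> = (P * mat_diag r (\<lambda>i. sqrt (s i))) * (P * mat_diag r (\<lambda>i. sqrt (s i)))\<^sup>T"
  proof -
    have "mat_diag r (\<lambda>i. sqrt (s i) * sqrt (s i)) = mat_diag r s" by (rule mat_diag_cong) (simp add: s)
    then show ?thesis by (simp add: mat_normalize mat_diag_mult_cancel)
  qed
  finally have "psd_mat r (U\<^sup>T * (L * (Q * P\<^sup>T)))"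
    using psd_mat_gram[of "P * mat_diag r (\<lambda>i. sqrt (s i))" r r] carrier_matI[of "P * mat_diag r (\<lambda>i. sqrt (s i))" r r]
    by simp
  then show ?thesis using orth_mat_mult[OF Q orth_mat_transpose[OF P]] by blast
qed

text \<open>With \<open>a = U\<^sup>T U\<close>, \<open>b = L\<^sup>T L\<close>, \<open>c = U\<^sup>T L\<close> symmetric and \<open>S = D\<^sup>T D = a - 2c + b\<close>, the difference
  of the two sides is \<open>\<parallel>a - b\<parallel>\<^sup>2 + 4 \<langle>c, S\<rangle>\<close>.\<close>
lemma aligned_gram_difference:
  assumes "U \<in> carrier_mat d r" "L \<in> carrier_mat d r" and psd: "psd_mat r (U\<^sup>T * L)"
  defines "D \<equiv> U - L"
  shows "(D * D\<^sup>T) \<bullet>\<^sub>F (D * D\<^sup>T) \<le> 2 * ((U * U\<^sup>T - L * L\<^sup>T) \<bullet>\<^sub>F (U * U\<^sup>T - L * L\<^sup>T))"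
proof -
  have [simp]: "dim_row U = d" "dim_col U = r" "dim_row L = d" "dim_col L = r" using assms by auto
  have [simp]: "dim_row D = d" "dim_col D = r" by (auto simp: D_def)
  define a b c where "a = U\<^sup>T * U" and "b = L\<^sup>T * L" and "c = U\<^sup>T * L"
  have [simp]: "dim_row a = r" "dim_col a = r" "dim_row b = r" "dim_col b = r" "dim_row c = r" "dim_col c = r"
    by (auto simp: a_def b_def c_def)
  have cT: "c\<^sup>T = c" using psd by (simp add: psd_mat_def sym_mat_def c_def)
  then have LU: "L\<^sup>T * U = c" by (simp add: c_def mat_normalize)
  have gram: "(A * A\<^sup>T) \<bullet>\<^sub>F (B * B\<^sup>T) = (A\<^sup>T * B) \<bullet>\<^sub>F (A\<^sup>T * B)"
    if "A \<in> carrier_mat d r" "B \<in> carrier_mat d r" for A B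
  proof -
    have [simp]: "dim_row A = d" "dim_col A = r" "dim_row B = d" "dim_col B = r" using that by auto
    have "(A * A\<^sup>T) \<bullet>\<^sub>F (B * B\<^sup>T) = A\<^sup>T \<bullet>\<^sub>F (A\<^sup>T * B * B\<^sup>T)"
      by (subst frob_inner_mult_left) (auto simp: mat_normalize)
    also have "\<dots> = (A\<^sup>T * B) \<bullet>\<^sub>F (A\<^sup>T * B)" by (subst frob_inner_mult_right) auto
    finally show ?thesis .
  qed
  have S: "D\<^sup>T * D = a - c - (c - b)"
    by (simp add: D_def mat_normalize a_def b_def LU) (simp add: c_def)
  have comm: "b \<bullet>\<^sub>F a = a \<bullet>\<^sub>F b" "c \<bullet>\<^sub>F a = a \<bullet>\<^sub>F c" "c \<bullet>\<^sub>F b = b \<bullet>\<^sub>F c" by (simp_all add: frob_inner_commute)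
  have Dc: "D \<in> carrier_mat d r" by (auto intro: carrier_matI)
  have lhs: "(D * D\<^sup>T) \<bullet>\<^sub>F (D * D\<^sup>T)
      = a \<bullet>\<^sub>F a + 4 * (c \<bullet>\<^sub>F c) + b \<bullet>\<^sub>F b - 4 * (a \<bullet>\<^sub>F c) - 4 * (b \<bullet>\<^sub>F c) + 2 * (a \<bullet>\<^sub>F b)"
    unfolding gram[OF Dc Dc] S by (simp add: frob_inner_linear comm)
  have rhs: "(U * U\<^sup>T - L * L\<^sup>T) \<bullet>\<^sub>F (U * U\<^sup>T - L * L\<^sup>T) = a \<bullet>\<^sub>F a - 2 * (c \<bullet>\<^sub>F c) + b \<bullet>\<^sub>F b"
    using gram[OF assms(1) assms(1)] gram[OF assms(1) assms(2)] gram[OF assms(2) assms(1)] gram[OF assms(2) assms(2)]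
    unfolding LU a_def[symmetric] b_def[symmetric] c_def[symmetric] by (simp add: frob_inner_linear)
  have ab: "0 \<le> a \<bullet>\<^sub>F a - 2 * (a \<bullet>\<^sub>F b) + b \<bullet>\<^sub>F b"
    using frob_inner_nonneg[of "a - b"] by (simp add: frob_inner_linear comm)
  have "0 \<le> D\<^sup>T \<bullet>\<^sub>F (c * D\<^sup>T)"
    using psd by (intro psd_mat_quadratic_form[of r _ _ d]) (auto simp: c_def intro: carrier_matI)
  also have "\<dots> = (c * D\<^sup>T) \<bullet>\<^sub>F D\<^sup>T" by (simp add: frob_inner_commute)
  also have "\<dots> = c \<bullet>\<^sub>F (D\<^sup>T * D)" by (subst frob_inner_mult_right) auto
  also have "\<dots> = a \<bullet>\<^sub>F c + b \<bullet>\<^sub>F c - 2 * (c \<bullet>\<^sub>F c)" unfolding S by (simp add: frob_inner_linear comm)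
  finally show ?thesis unfolding lhs rhs using ab by (simp add: algebra_simps)
qed

section \<open>Operator bounds from quadratic forms\<close>

lemma form_bound_cols:
  assumes A: "A \<in> carrier_mat d d" and bd: "\<And>x. x \<in> carrier_mat d 1 \<Longrightarrow> \<bar>x \<bullet>\<^sub>F (A * x)\<bar> \<le> \<eta> * (x \<bullet>\<^sub>F x)"
    and Y: "Y \<in> carrier_mat d k"
  shows "\<bar>Y \<bullet>\<^sub>F (A * Y)\<bar> \<le> \<eta> * (Y \<bullet>\<^sub>F Y)"
proof -
  have col: "\<bar>col Y j \<bullet> (A *\<^sub>v col Y j)\<bar> \<le> \<eta> * (col Y j \<bullet> col Y j)" if "j < k" for j
  proof -
    have c: "col Y j \<in> carrier_vec d" using Y that by (intro carrier_vecI) simp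
    have "mat_of_cols d [col Y j] \<in> carrier_mat d 1" using mat_of_cols_carrier(1)[of d "[col Y j]"] by simp
    from bd[OF this] show ?thesis
      using vec_quadratic_form[OF A c] vec_quadratic_form[of "1\<^sub>m d" d, OF _ c] c by (simp add: mat_one_mult)
  qed
  have "\<bar>Y \<bullet>\<^sub>F (A * Y)\<bar> \<le> (\<Sum>j<k. \<bar>col Y j \<bullet> (A *\<^sub>v col Y j)\<bar>)"
    unfolding quadratic_form_cols[OF A Y] by (rule sum_abs)
  also have "\<dots> \<le> (\<Sum>j<k. \<eta> * (col Y j \<bullet> col Y j))" using col by (intro sum_mono) auto
  finally show ?thesis unfolding frob_inner_cols[OF Y] by (simp add: sum_distrib_left)
qed

text \<open>Polarization between t x + y and t x - y with a free scale t. Optimizing over t through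
  the discriminant yields the product of the two norms rather than their sum.\<close>

lemma sym_form_bound_bilinear:
  assumes A: "sym_mat d A"
    and bd: "\<And>x. x \<in> carrier_mat d k \<Longrightarrow> \<bar>x \<bullet>\<^sub>F (A * x)\<bar> \<le> \<eta> * (x \<bullet>\<^sub>F x)"
    and x: "x \<in> carrier_mat d k" and y: "y \<in> carrier_mat d k"
  shows "(x \<bullet>\<^sub>F (A * y))\<^sup>2 \<le> \<eta>\<^sup>2 * (x \<bullet>\<^sub>F x) * (y \<bullet>\<^sub>F y)"
proof -
  have [simp]: "dim_row A = d" "dim_col A = d" "dim_row x = d" "dim_col x = k" "dim_row y = d" "dim_col y = k"
    using A x y by (auto simp: sym_mat_def)
  have AT: "A\<^sup>T = A" using A by (simp add: sym_mat_def)
  have sym: "y \<bullet>\<^sub>F (A * x) = x \<bullet>\<^sub>F (A * y)"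
  proof -
    have "y \<bullet>\<^sub>F (A * x) = (A * x) \<bullet>\<^sub>F y" by (simp add: frob_inner_commute)
    also have "\<dots> = x \<bullet>\<^sub>F (A * y)" by (subst frob_inner_mult_left) (auto simp: AT)
    finally show ?thesis .
  qed
  have yx: "y \<bullet>\<^sub>F x = x \<bullet>\<^sub>F y" by (simp add: frob_inner_commute)
  have "(- (x \<bullet>\<^sub>F (A * y)))\<^sup>2 \<le> (\<eta> * (x \<bullet>\<^sub>F x)) * (\<eta> * (y \<bullet>\<^sub>F y))"
  proof (rule nonneg_quadratic_discriminant)
    fix t
    let ?p = "t \<cdot>\<^sub>m x + y" and ?m = "t \<cdot>\<^sub>m x - y"
    have 1: "?p \<bullet>\<^sub>F (A * ?p) - ?m \<bullet>\<^sub>F (A * ?m) = 4 * t * (x \<bullet>\<^sub>F (A * y))"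
      by (simp add: mat_normalize frob_inner_linear sym algebra_simps)
    have 2: "?p \<bullet>\<^sub>F ?p + ?m \<bullet>\<^sub>F ?m = 2 * t\<^sup>2 * (x \<bullet>\<^sub>F x) + 2 * (y \<bullet>\<^sub>F y)"
      by (simp add: frob_inner_linear yx algebra_simps power2_eq_square)
    have 3: "?p \<bullet>\<^sub>F (A * ?p) \<le> \<eta> * (?p \<bullet>\<^sub>F ?p)" "- (?m \<bullet>\<^sub>F (A * ?m)) \<le> \<eta> * (?m \<bullet>\<^sub>F ?m)"
      using bd[of ?p] bd[of ?m] carrier_matI[of ?p d k] carrier_matI[of ?m d k] by (simp_all add: abs_le_iff)
    have "4 * t * (x \<bullet>\<^sub>F (A * y)) \<le> \<eta> * (?p \<bullet>\<^sub>F ?p) + \<eta> * (?m \<bullet>\<^sub>F ?m)"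
      unfolding 1[symmetric] using 3 by linarith
    then have "4 * t * (x \<bullet>\<^sub>F (A * y)) \<le> \<eta> * (2 * t\<^sup>2 * (x \<bullet>\<^sub>F x) + 2 * (y \<bullet>\<^sub>F y))"
      unfolding 2[symmetric] distrib_left .
    then show "0 \<le> \<eta> * (x \<bullet>\<^sub>F x) * t\<^sup>2 + 2 * - (x \<bullet>\<^sub>F (A * y)) * t + \<eta> * (y \<bullet>\<^sub>F y)"
      by (simp add: algebra_simps)
  qed
  then show ?thesis by (simp add: power2_eq_square algebra_simps)
qed

text \<open>The bilinear bound tested with x = A y, divided by |A y|^2.\<close>

lemma sym_form_bound_operator:
  assumes A: "sym_mat d A"
    and bd: "\<And>x. x \<in> carrier_mat d k \<Longrightarrow> \<bar>x \<bullet>\<^sub>F (A * x)\<bar> \<le> \<eta> * (x \<bullet>\<^sub>F x)"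
    and y: "y \<in> carrier_mat d k"
  shows "(A * y) \<bullet>\<^sub>F (A * y) \<le> \<eta>\<^sup>2 * (y \<bullet>\<^sub>F y)"
proof -
  let ?n = "(A * y) \<bullet>\<^sub>F (A * y)"
  have "A * y \<in> carrier_mat d k" using A y by (auto simp: sym_mat_def)
  from sym_form_bound_bilinear[OF A bd this y] have "?n * ?n \<le> ?n * (\<eta>\<^sup>2 * (y \<bullet>\<^sub>F y))"
    by (simp add: power2_eq_square algebra_simps)
  then show ?thesis
    using frob_inner_nonneg[of "A * y"] frob_inner_nonneg[of y] by (cases "?n = 0") auto
qed

lemma frob_norm_form_bound:
  assumes A: "A \<in> carrier_mat d d" and x: "x \<in> carrier_mat d 1"
  shows "\<bar>x \<bullet>\<^sub>F (A * x)\<bar> \<le> frob_norm A * (x \<bullet>\<^sub>F x)"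
proof -
  have [simp]: "dim_row A = d" "dim_col A = d" "dim_row x = d" "dim_col x = 1" using A x by auto
  have "(x * x\<^sup>T) \<bullet>\<^sub>F (x * x\<^sup>T) = x\<^sup>T \<bullet>\<^sub>F (x\<^sup>T * x * x\<^sup>T)"
    by (subst frob_inner_mult_left) (auto simp: mat_normalize)
  also have "\<dots> = (x \<bullet>\<^sub>F x) * (x \<bullet>\<^sub>F x)"
    unfolding col_mat_mult[OF x x] by (simp add: mat_normalize frob_inner_linear frob_inner_transpose)
  finally have n: "frob_norm (x * x\<^sup>T) = x \<bullet>\<^sub>F x" by (simp add: frob_norm_def)
  have "x \<bullet>\<^sub>F (A * x) = (A * x) \<bullet>\<^sub>F x" by (simp add: frob_inner_commute)
  also have "\<dots> = A \<bullet>\<^sub>F (x * x\<^sup>T)" by (subst frob_inner_mult_right) auto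
  finally show ?thesis using frob_Cauchy_Schwarz[of A "x * x\<^sup>T"] n by simp
qed

text \<open>T and T^T share their singular values, so a lower bound transfers and makes T^T onto. It
  is applied to T = U^T V, where one side is bounded through M and the other side is wanted for
  U.\<close>

lemma square_mat_lower_bound_transpose:
  assumes T: "T \<in> carrier_mat r r" and m: "0 < m"
    and bd: "\<And>b. b \<in> carrier_mat r 1 \<Longrightarrow> m * (b \<bullet>\<^sub>F b) \<le> (T * b) \<bullet>\<^sub>F (T * b)"
  shows "a \<in> carrier_mat r 1 \<Longrightarrow> m * (a \<bullet>\<^sub>F a) \<le> (T\<^sup>T * a) \<bullet>\<^sub>F (T\<^sup>T * a)"
    and "w \<in> carrier_mat r 1 \<Longrightarrow> \<exists>a. a \<in> carrier_mat r 1 \<and> T\<^sup>T * a = w"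
proof -
  obtain P Q s where P: "orth_mat r P" and Q: "orth_mat r Q" and s: "\<And>i. i < r \<Longrightarrow> 0 \<le> s i"
    and TT: "T = P * mat_diag r s * Q\<^sup>T" using square_mat_svd[OF T] by blast
  note [simp] = orth_matD(1,2)[OF P] orth_matD(1,2)[OF Q]
  note cancel = orth_mat_cancel[OF P] orth_mat_cancel[OF Q]
  have sm: "m \<le> s i * s i" if i: "i < r" for i
  proof -
    define y where "y = mat r 1 (\<lambda>(j,_). if j = i then 1 else 0 :: real)"
    have y: "y \<in> carrier_mat r 1" by (simp add: y_def)
    have [simp]: "dim_row y = r" "dim_col y = 1" by (auto simp: y_def)
    have "m * ((Q * y) \<bullet>\<^sub>F (Q * y)) \<le> (T * (Q * y)) \<bullet>\<^sub>F (T * (Q * y))"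
      by (rule bd) (auto intro: carrier_matI)
    also have "(Q * y) \<bullet>\<^sub>F (Q * y) = y \<bullet>\<^sub>F y" by (subst frob_inner_mult_left) (auto simp: cancel)
    also have "y \<bullet>\<^sub>F y = 1" using i by (simp add: frob_inner_def y_def if_distrib[of "(*) _"] cong: if_cong)
    also have "T * (Q * y) = P * (mat_diag r s * y)" by (simp add: TT mat_mult_assoc cancel)
    also have "(P * (mat_diag r s * y)) \<bullet>\<^sub>F (P * (mat_diag r s * y)) = (mat_diag r s * y) \<bullet>\<^sub>F (mat_diag r s * y)"
      by (subst frob_inner_mult_left) (auto simp: cancel)
    also have "\<dots> = y \<bullet>\<^sub>F (mat_diag r (\<lambda>i. s i * s i) * y)"
      by (subst frob_inner_mult_left) (auto simp: mat_diag_mult_cancel)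
    also have "\<dots> = (\<Sum>j<r. (s j * s j) * (if j = i then 1 else 0))"
      unfolding frob_inner_diag_mult[OF y] by (intro sum.cong) (auto simp: y_def)
    also have "\<dots> = s i * s i" using i by (simp add: if_distrib[of "(*) _"] cong: if_cong)
    finally show ?thesis by simp
  qed
  show "m * (a \<bullet>\<^sub>F a) \<le> (T\<^sup>T * a) \<bullet>\<^sub>F (T\<^sup>T * a)" if a: "a \<in> carrier_mat r 1"
  proof -
    have [simp]: "dim_row a = r" "dim_col a = 1" using a by auto
    have "T\<^sup>T * a = Q * (mat_diag r s * (P\<^sup>T * a))" by (simp add: TT mat_normalize)
    then have "(T\<^sup>T * a) \<bullet>\<^sub>F (T\<^sup>T * a) = (mat_diag r s * (P\<^sup>T * a)) \<bullet>\<^sub>F (mat_diag r s * (P\<^sup>T * a))"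
      by simp (subst frob_inner_mult_left, auto simp: cancel)
    also have "\<dots> = (P\<^sup>T * a) \<bullet>\<^sub>F (mat_diag r (\<lambda>i. s i * s i) * (P\<^sup>T * a))"
      by (subst frob_inner_mult_left) (auto simp: mat_diag_mult_cancel)
    also have "\<dots> \<ge> m * ((P\<^sup>T * a) \<bullet>\<^sub>F (P\<^sup>T * a))"
      by (rule diag_form_lower[of _ r 1]) (auto simp: sm intro: carrier_matI)
    also have "(P\<^sup>T * a) \<bullet>\<^sub>F (P\<^sup>T * a) = a \<bullet>\<^sub>F a" by (subst frob_inner_mult_left) (auto simp: cancel)
    finally show ?thesis .
  qed
  show "\<exists>a. a \<in> carrier_mat r 1 \<and> T\<^sup>T * a = w" if w: "w \<in> carrier_mat r 1"
  proof -
    have [simp]: "dim_row w = r" "dim_col w = 1" using w by auto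
    define a where "a = P * (mat_diag r (\<lambda>i. 1 / s i) * (Q\<^sup>T * w))"
    have "mat_diag r (\<lambda>i. s i * (1 / s i)) = 1\<^sub>m r" unfolding mat_diag_one[symmetric]
    proof (rule mat_diag_cong)
      show "s i * (1 / s i) = 1" if "i < r" for i using sm[OF that] m by auto
    qed
    then have "T\<^sup>T * a = w"
      by (simp add: TT a_def mat_normalize cancel mat_diag_mult_cancel del: times_divide_eq_right)
    moreover have "a \<in> carrier_mat r 1" by (auto simp: a_def intro: carrier_matI)
    ultimately show ?thesis by blast
  qed
qed

section \<open>The dual certificate\<close>

text \<open>\<open>G\<close> is the gradient matrix of the data fit, \<open>H\<close> the noise plus the isometry defect. For \<open>x\<close>
  orthogonal to the columns of \<open>U\<close>, pick \<open>v\<close> in the column space of \<open>U\<close> with \<open>V\<^sup>T v = V\<^sup>T x\<close>; then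
  \<open>\<langle>x, M x\<rangle> = - \<langle>x, H v\<rangle>\<close> is small because \<open>\<langle>v, M v\<rangle> = \<langle>x, M x\<rangle>\<close> controls \<open>v\<close>.\<close>
lemma dual_certificate_bounds:
  fixes U V H G M :: "real mat"
  assumes U: "U \<in> carrier_mat d r" and V: "V \<in> carrier_mat d r" "V\<^sup>T * V = 1\<^sub>m r"
    and M: "M = V * mat_diag r l * V\<^sup>T" and l: "\<And>i. i < r \<Longrightarrow> m \<le> l i"
    and H: "sym_mat d H" and Hb: "\<And>x. x \<in> carrier_mat d 1 \<Longrightarrow> \<bar>x \<bullet>\<^sub>F (H * x)\<bar> \<le> h * (x \<bullet>\<^sub>F x)"
    and G: "G = H - (U * U\<^sup>T - M)" and GU: "G * U = lam \<cdot>\<^sub>m U" and lam: "0 \<le> h" "h \<le> lam"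
    and e: "frob_norm (U * U\<^sup>T - M) \<le> e" and me: "e < m"
  shows "a \<in> carrier_mat r 1 \<Longrightarrow> (m - e) * (a \<bullet>\<^sub>F a) \<le> (U * a) \<bullet>\<^sub>F (U * a)"
    and "x \<in> carrier_mat d 1 \<Longrightarrow> U\<^sup>T * x = 0\<^sub>m r 1 \<Longrightarrow> \<bar>x \<bullet>\<^sub>F (G * x)\<bar> \<le> (h + h\<^sup>2 / (m - e)) * (x \<bullet>\<^sub>F x)"
proof -
  have [simp]: "dim_row U = d" "dim_col U = r" "dim_row V = d" "dim_col V = r" "dim_row H = d" "dim_col H = d"
    using U V H by (auto simp: sym_mat_def)
  have [simp]: "dim_row M = d" "dim_col M = d" by (auto simp: M)
  have [simp]: "dim_row G = d" "dim_col G = d" by (auto simp: G)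
  have V_cancel: "V\<^sup>T * (V * Y) = Y" if "dim_row Y = r" for Y
    using mat_mult_cancel_left[OF V(2), of Y] that by (simp add: mat_one_mult)
  have VVV: "V * (V\<^sup>T * V) = V" by (simp add: V mat_mult_one)
  let ?D = "U * U\<^sup>T - M"
  have m': "0 < m - e" using me by simp
  have T: "U\<^sup>T * V \<in> carrier_mat r r" by (auto intro: carrier_matI)
  \<comment> \<open>On the range of V, U U^T = M + \<Delta> is at least m - e, because M is at least
    m there and \<Delta> at least - e.\<close>
  have Tb: "(m - e) * (b \<bullet>\<^sub>F b) \<le> (U\<^sup>T * V * b) \<bullet>\<^sub>F (U\<^sup>T * V * b)" if b: "b \<in> carrier_mat r 1" for b
  proof -
    have [simp]: "dim_row b = r" "dim_col b = 1" using b by auto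
    define z where "z = V * b"
    have [simp]: "dim_row z = d" "dim_col z = 1" by (auto simp: z_def)
    have zz: "z \<bullet>\<^sub>F z = b \<bullet>\<^sub>F b" unfolding z_def by (subst frob_inner_mult_left) (auto simp: V_cancel)
    have "z \<bullet>\<^sub>F (M * z) = b \<bullet>\<^sub>F (mat_diag r l * b)"
      unfolding z_def by (subst frob_inner_mult_left) (auto simp: M mat_normalize V_cancel)
    then have 1: "m * (b \<bullet>\<^sub>F b) \<le> z \<bullet>\<^sub>F (M * z)" using diag_form_lower[OF b l] by simp
    have "z \<in> carrier_mat d 1" "?D \<in> carrier_mat d d" by (auto intro: carrier_matI)
    then have "\<bar>z \<bullet>\<^sub>F (?D * z)\<bar> \<le> e * (z \<bullet>\<^sub>F z)"
      using frob_norm_form_bound[of ?D d z] mult_right_mono[OF e, of "z \<bullet>\<^sub>F z"] by simp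
    then have 2: "- (e * (b \<bullet>\<^sub>F b)) \<le> z \<bullet>\<^sub>F (?D * z)" using zz by simp
    have "(U\<^sup>T * V * b) \<bullet>\<^sub>F (U\<^sup>T * V * b) = (U\<^sup>T * z) \<bullet>\<^sub>F (U\<^sup>T * z)" by (simp add: z_def mat_mult_assoc)
    also have "\<dots> = z \<bullet>\<^sub>F (U * (U\<^sup>T * z))" by (subst frob_inner_mult_left) auto
    also have "\<dots> = z \<bullet>\<^sub>F (?D * z) + z \<bullet>\<^sub>F (M * z)" by (simp add: mat_normalize frob_inner_linear)
    finally show ?thesis using 1 2 by (simp add: algebra_simps)
  qed
  have VU: "(U\<^sup>T * V)\<^sup>T = V\<^sup>T * U" by (simp add: mat_normalize)
  have Ua: "(m - e) * (a \<bullet>\<^sub>F a) \<le> (U * a) \<bullet>\<^sub>F (U * a)" if a: "a \<in> carrier_mat r 1" for a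
  proof -
    have [simp]: "dim_row a = r" "dim_col a = 1" using a by auto
    have "(m - e) * (a \<bullet>\<^sub>F a) \<le> (V\<^sup>T * U * a) \<bullet>\<^sub>F (V\<^sup>T * U * a)"
      using square_mat_lower_bound_transpose(1)[OF T m' Tb a] by (simp add: VU)
    also have "\<dots> = (frob_norm (V\<^sup>T * (U * a)))\<^sup>2" by (simp add: frob_norm_sq mat_mult_assoc)
    also have "\<dots> \<le> (frob_norm (U * a))\<^sup>2"
      by (rule power_mono, rule partial_isometry_contraction(2)[OF V(1) VVV, of _ 1], rule carrier_matI) simp_all
    finally show ?thesis by (simp add: frob_norm_sq)
  qed
  then show "a \<in> carrier_mat r 1 \<Longrightarrow> (m - e) * (a \<bullet>\<^sub>F a) \<le> (U * a) \<bullet>\<^sub>F (U * a)" .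
  assume x: "x \<in> carrier_mat d 1" and Ux: "U\<^sup>T * x = 0\<^sub>m r 1"
  have [simp]: "dim_row x = d" "dim_col x = 1" using x by auto
  have "V\<^sup>T * x \<in> carrier_mat r 1" by (auto intro: carrier_matI)
  then obtain a where a: "a \<in> carrier_mat r 1" "V\<^sup>T * U * a = V\<^sup>T * x"
    using square_mat_lower_bound_transpose(2)[OF T m' Tb] VU by metis
  have [simp]: "dim_row a = r" "dim_col a = 1" using a by auto
  define v where "v = U * a"
  have [simp]: "dim_row v = d" "dim_col v = 1" by (auto simp: v_def)
  have v: "v \<in> carrier_mat d 1" by (auto intro: carrier_matI)
  have Vv: "V\<^sup>T * v = V\<^sup>T * x" using a(2) by (simp add: v_def mat_mult_assoc)
  have Mvx: "M * v = M * x" by (simp add: M mat_mult_assoc Vv)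
  have MT: "M\<^sup>T = M" by (simp add: M mat_normalize)
  have "G * v = (G * U) * a" by (simp add: v_def mat_mult_assoc)
  then have Gv: "G * v = lam \<cdot>\<^sub>m v" unfolding GU by (simp add: v_def mat_normalize)
  \<comment> \<open>Since v lies in the column space of U, G v = lam v; solving G = H - U U^T + M
    for M v gives the identity, which is then tested with x and with v.\<close>
  have form_M: "z \<bullet>\<^sub>F (M * v) = lam * (z \<bullet>\<^sub>F v) - z \<bullet>\<^sub>F (H * v) + (U\<^sup>T * z) \<bullet>\<^sub>F (U\<^sup>T * v)"
    if "dim_row z = d" "dim_col z = 1" for z
  proof -
    have "lam * (z \<bullet>\<^sub>F v) = z \<bullet>\<^sub>F (G * v)" unfolding Gv using that by (simp add: frob_inner_linear)
    also have "\<dots> = z \<bullet>\<^sub>F (H * v) - (z \<bullet>\<^sub>F (U * (U\<^sup>T * v)) - z \<bullet>\<^sub>F (M * v))"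
      using that by (simp add: G mat_normalize frob_inner_linear)
    also have "z \<bullet>\<^sub>F (U * (U\<^sup>T * v)) = (U\<^sup>T * z) \<bullet>\<^sub>F (U\<^sup>T * v)"
      using that by (subst frob_inner_mult_left) simp_all
    finally show ?thesis by simp
  qed
  define q where "q = x \<bullet>\<^sub>F (M * x)"
  have "x \<bullet>\<^sub>F v = v \<bullet>\<^sub>F x" by (simp add: frob_inner_commute)
  also have "\<dots> = 0" unfolding v_def by (subst frob_inner_mult_left) (auto simp: Ux)
  finally have q1: "q = - (x \<bullet>\<^sub>F (H * v))" unfolding q_def using form_M[of x] by (simp add: Mvx Ux)
  have "v \<bullet>\<^sub>F (M * v) = v \<bullet>\<^sub>F (M * x)" by (simp add: Mvx)
  also have "\<dots> = (M * v) \<bullet>\<^sub>F x" by (subst frob_inner_mult_left) (auto simp: MT)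
  also have "\<dots> = q" unfolding q_def by (simp add: Mvx frob_inner_commute)
  finally have q2: "q = lam * (v \<bullet>\<^sub>F v) - v \<bullet>\<^sub>F (H * v) + (U\<^sup>T * v) \<bullet>\<^sub>F (U\<^sup>T * v)" using form_M[of v] by simp
  \<comment> \<open>U U^T inherits the lower bound of U^T U on its range: |v|^2 = <a, U^T v> for v =
    U a, and |a| is controlled by |v|.\<close>
  have UUv: "(m - e) * (v \<bullet>\<^sub>F v) \<le> (U\<^sup>T * v) \<bullet>\<^sub>F (U\<^sup>T * v)"
  proof (cases "v \<bullet>\<^sub>F v = 0")
    case False
    then have pos: "0 < v \<bullet>\<^sub>F v" using frob_inner_nonneg[of v] by linarith
    have "v \<bullet>\<^sub>F v = a \<bullet>\<^sub>F (U\<^sup>T * v)" unfolding v_def by (subst frob_inner_mult_left) auto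
    then have "\<bar>v \<bullet>\<^sub>F v\<bar> \<le> frob_norm a * frob_norm (U\<^sup>T * v)"
      using frob_Cauchy_Schwarz[of a "U\<^sup>T * v"] by simp
    then have "(v \<bullet>\<^sub>F v)\<^sup>2 \<le> (frob_norm a * frob_norm (U\<^sup>T * v))\<^sup>2"
      by (intro power_mono) simp_all
    then have "(v \<bullet>\<^sub>F v)\<^sup>2 \<le> (a \<bullet>\<^sub>F a) * ((U\<^sup>T * v) \<bullet>\<^sub>F (U\<^sup>T * v))" by (simp add: power_mult_distrib frob_norm_sq)
    then have "(m - e) * (v \<bullet>\<^sub>F v)\<^sup>2 \<le> (m - e) * ((a \<bullet>\<^sub>F a) * ((U\<^sup>T * v) \<bullet>\<^sub>F (U\<^sup>T * v)))"
      using m' by (intro mult_left_mono) auto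
    also have "\<dots> = ((m - e) * (a \<bullet>\<^sub>F a)) * ((U\<^sup>T * v) \<bullet>\<^sub>F (U\<^sup>T * v))" by simp
    also have "\<dots> \<le> (v \<bullet>\<^sub>F v) * ((U\<^sup>T * v) \<bullet>\<^sub>F (U\<^sup>T * v))"
      using Ua[OF a(1)] by (intro mult_right_mono) (auto simp: v_def)
    finally have "(v \<bullet>\<^sub>F v) * ((m - e) * (v \<bullet>\<^sub>F v)) \<le> (v \<bullet>\<^sub>F v) * ((U\<^sup>T * v) \<bullet>\<^sub>F (U\<^sup>T * v))"
      by (simp add: power2_eq_square algebra_simps)
    then show ?thesis using pos by simp
  qed simp
  \<comment> \<open>The term lam |v|^2 absorbs the H term because h <= lam.\<close>
  have "v \<bullet>\<^sub>F (H * v) \<le> lam * (v \<bullet>\<^sub>F v)"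
    using Hb[OF v] mult_right_mono[OF lam(2), of "v \<bullet>\<^sub>F v"] by simp
  then have q3: "(m - e) * (v \<bullet>\<^sub>F v) \<le> q" using q2 UUv by linarith
  have q0: "0 \<le> q" using q3 mult_nonneg_nonneg[OF less_imp_le[OF m'] frob_inner_nonneg[of v]] by linarith
  \<comment> \<open>A self-bounding inequality: q^2 is at most h^2 |x|^2 |v|^2, and |v|^2 is at most
    q / (m - e); cancelling one q gives the claim.\<close>
  have "q\<^sup>2 \<le> h\<^sup>2 * (x \<bullet>\<^sub>F x) * (v \<bullet>\<^sub>F v)"
    unfolding q1 using sym_form_bound_bilinear[OF H Hb x v] by simp
  also have "\<dots> \<le> h\<^sup>2 * (x \<bullet>\<^sub>F x) * (q / (m - e))"
    using q3 m' by (intro mult_left_mono) (auto simp: field_simps)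
  finally have qq: "q * q \<le> q * (h\<^sup>2 / (m - e) * (x \<bullet>\<^sub>F x))" by (simp add: power2_eq_square field_simps)
  have rhs0: "0 \<le> h\<^sup>2 / (m - e) * (x \<bullet>\<^sub>F x)" using m' by simp
  have q: "q \<le> h\<^sup>2 / (m - e) * (x \<bullet>\<^sub>F x)"
  proof (cases "q = 0")
    case True then show ?thesis using rhs0 by simp
  next
    case False
    then have "0 < q" using q0 by simp
    then show ?thesis using qq by (simp only: mult_le_cancel_left_pos)
  qed
  have "x \<bullet>\<^sub>F (G * x) = x \<bullet>\<^sub>F (H * x) + q"
    unfolding q_def G by (simp add: mat_normalize frob_inner_linear Ux)
  then show "\<bar>x \<bullet>\<^sub>F (G * x)\<bar> \<le> (h + h\<^sup>2 / (m - e)) * (x \<bullet>\<^sub>F x)"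
    using Hb[OF x] q q0 by (simp add: distrib_right)
qed

section \<open>Linear measurements\<close>

definition meas :: "nat \<Rightarrow> (nat \<Rightarrow> real mat) \<Rightarrow> real mat \<Rightarrow> nat \<Rightarrow> real" where
  "meas n X A i = (X i \<bullet>\<^sub>F A) / sqrt (real n)"

text \<open>The adjoint of the measurement map \<open>meas\<close>. The input of the rank projection
  is Z plus this adjoint applied to the residuals.\<close>

definition backproj :: "nat \<Rightarrow> nat \<Rightarrow> (nat \<Rightarrow> real mat) \<Rightarrow> (nat \<Rightarrow> real) \<Rightarrow> real mat" where
  "backproj d n X w = mat d d (\<lambda>(a,b). (\<Sum>i<n. w i * X i $$ (a,b)) / sqrt (real n))"

definition rip :: "nat \<Rightarrow> nat \<Rightarrow> nat \<Rightarrow> (nat \<Rightarrow> real mat) \<Rightarrow> real \<Rightarrow> bool" where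
  "rip d k n X \<delta> \<longleftrightarrow> (\<forall>A. sym_mat d A \<and> mrank A \<le> k \<longrightarrow>
     (1 - \<delta>) * (A \<bullet>\<^sub>F A) \<le> (\<Sum>i<n. (meas n X A i)\<^sup>2) \<and> (\<Sum>i<n. (meas n X A i)\<^sup>2) \<le> (1 + \<delta>) * (A \<bullet>\<^sub>F A))"

locale sym_design =
  fixes d n :: nat and X :: "nat \<Rightarrow> real mat"
  assumes sym_X: "\<And>i. i < n \<Longrightarrow> sym_mat d (X i)"
begin

lemma dim_X: "i < n \<Longrightarrow> dim_row (X i) = d" "i < n \<Longrightarrow> dim_col (X i) = d"
  using sym_X by (auto simp: sym_mat_def)

lemma meas_linear:
  assumes "i < n" "A \<in> carrier_mat d d" "B \<in> carrier_mat d d"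
  shows "meas n X (A + B) i = meas n X A i + meas n X B i"
    "meas n X (A - B) i = meas n X A i - meas n X B i"
    "meas n X (c \<cdot>\<^sub>m A) i = c * meas n X A i"
  using assms dim_X[OF assms(1)] by (simp_all add: meas_def frob_inner_linear add_divide_distrib diff_divide_distrib)

lemma backproj_dim [simp]: "dim_row (backproj d n X w) = d" "dim_col (backproj d n X w) = d"
  by (auto simp: backproj_def)

lemma sym_mat_backproj: "sym_mat d (backproj d n X w)"
proof -
  have "X i $$ (a,b) = X i $$ (b,a)" if "i < n" "a < d" "b < d" for i a b
  proof -
    have "(X i)\<^sup>T $$ (a,b) = X i $$ (a,b)" using sym_X[OF that(1)] by (simp add: sym_mat_def)
    then show ?thesis using that dim_X[OF that(1)] by simp
  qed
  then have "(backproj d n X w)\<^sup>T = backproj d n X w"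
    by (intro eq_matI) (auto simp: backproj_def intro!: sum.cong)
  then show ?thesis by (auto simp: sym_mat_def intro: carrier_matI)
qed

lemma backproj_inner:
  assumes "A \<in> carrier_mat d d"
  shows "backproj d n X w \<bullet>\<^sub>F A = (\<Sum>i<n. w i * meas n X A i)"
proof -
  have "backproj d n X w \<bullet>\<^sub>F A = (\<Sum>a<d. \<Sum>b<d. \<Sum>i<n. w i * X i $$ (a,b) / sqrt (real n) * A $$ (a,b))"
    unfolding frob_inner_def backproj_def
    by (simp add: sum_divide_distrib sum_distrib_right)
  also have "\<dots> = (\<Sum>a<d. \<Sum>i<n. \<Sum>b<d. w i * X i $$ (a,b) / sqrt (real n) * A $$ (a,b))"
    by (intro sum.cong refl sum.swap)
  also have "\<dots> = (\<Sum>i<n. \<Sum>a<d. \<Sum>b<d. w i * X i $$ (a,b) / sqrt (real n) * A $$ (a,b))" by (rule sum.swap)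
  also have "\<dots> = (\<Sum>i<n. w i * meas n X A i)"
  proof (intro sum.cong refl)
    fix i assume "i \<in> {..<n}"
    then show "(\<Sum>a<d. \<Sum>b<d. w i * X i $$ (a,b) / sqrt (real n) * A $$ (a,b)) = w i * meas n X A i"
      using dim_X[of i] by (simp add: meas_def frob_inner_def sum_distrib_left sum_divide_distrib algebra_simps)
  qed
  finally show ?thesis .
qed

text \<open>Along a line the factored objective is a quartic polynomial in t, so both optimality
  conditions can be read off its coefficients.\<close>

lemma f_obj_expansion:
  fixes y :: "nat \<Rightarrow> real"
  assumes U: "U \<in> carrier_mat d r" and D: "D \<in> carrier_mat d r"
  defines "e \<equiv> \<lambda>i. y i - meas n X (U * U\<^sup>T) i"
    and "a \<equiv> meas n X (U * D\<^sup>T + D * U\<^sup>T)" and "b \<equiv> meas n X (D * D\<^sup>T)"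
  shows "f_obj n X y lam (U + t \<cdot>\<^sub>m D) = (1/4 * (\<Sum>i<n. (e i)\<^sup>2) + lam / 2 * (U \<bullet>\<^sub>F U))
    + (lam * (U \<bullet>\<^sub>F D) - 1/2 * (\<Sum>i<n. e i * a i)) * t
    + (1/4 * (\<Sum>i<n. (a i)\<^sup>2 - 2 * (e i * b i)) + lam / 2 * (D \<bullet>\<^sub>F D)) * t^2
    + (1/2 * (\<Sum>i<n. a i * b i)) * t^3 + (1/4 * (\<Sum>i<n. (b i)\<^sup>2)) * t^4"
proof -
  have [simp]: "dim_row U = d" "dim_col U = r" "dim_row D = d" "dim_col D = r" using U D by auto
  have c: "U * U\<^sup>T \<in> carrier_mat d d" "U * D\<^sup>T + D * U\<^sup>T \<in> carrier_mat d d" "D * D\<^sup>T \<in> carrier_mat d d"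
    "t \<cdot>\<^sub>m (U * D\<^sup>T + D * U\<^sup>T) + t\<^sup>2 \<cdot>\<^sub>m (D * D\<^sup>T) \<in> carrier_mat d d"
    "t \<cdot>\<^sub>m (U * D\<^sup>T + D * U\<^sup>T) \<in> carrier_mat d d" "t\<^sup>2 \<cdot>\<^sub>m (D * D\<^sup>T) \<in> carrier_mat d d"
    by (auto intro: carrier_matI)
  have eq: "(U + t \<cdot>\<^sub>m D) * (U + t \<cdot>\<^sub>m D)\<^sup>T
      = U * U\<^sup>T + (t \<cdot>\<^sub>m (U * D\<^sup>T + D * U\<^sup>T) + t\<^sup>2 \<cdot>\<^sub>m (D * D\<^sup>T))"
    by (simp add: mat_normalize) (rule eq_matI, auto simp: power2_eq_square algebra_simps)
  have m: "y i - (X i \<bullet>\<^sub>F ((U + t \<cdot>\<^sub>m D) * (U + t \<cdot>\<^sub>m D)\<^sup>T)) / sqrt (real n) = e i - t * a i - t\<^sup>2 * b i" if "i < n" for i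
    unfolding eq meas_def[symmetric] e_def a_def b_def using c that by (simp add: meas_linear)
  have normUD: "(frob_norm (U + t \<cdot>\<^sub>m D))\<^sup>2 = U \<bullet>\<^sub>F U + 2 * t * (U \<bullet>\<^sub>F D) + t\<^sup>2 * (D \<bullet>\<^sub>F D)"
    unfolding frob_norm_sq using frob_inner_commute[of D U]
    by (simp add: frob_inner_linear power2_eq_square algebra_simps)
  have sq: "(\<Sum>i<n. (e i - t * a i - t\<^sup>2 * b i)\<^sup>2) = (\<Sum>i<n. (e i)\<^sup>2) - 2 * (\<Sum>i<n. e i * a i) * t
      + (\<Sum>i<n. (a i)\<^sup>2 - 2 * (e i * b i)) * t^2 + 2 * (\<Sum>i<n. a i * b i) * t^3 + (\<Sum>i<n. (b i)\<^sup>2) * t^4"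
    unfolding sum_distrib_left sum_distrib_right sum_subtractf[symmetric] sum.distrib[symmetric]
    by (intro sum.cong refl) (simp add: power2_eq_square power3_eq_cube power4_eq_xxxx algebra_simps)
  have "f_obj n X y lam (U + t \<cdot>\<^sub>m D) = 1/4 * (\<Sum>i<n. (e i - t * a i - t\<^sup>2 * b i)\<^sup>2)
      + lam / 2 * (U \<bullet>\<^sub>F U + 2 * t * (U \<bullet>\<^sub>F D) + t\<^sup>2 * (D \<bullet>\<^sub>F D))"
    unfolding f_obj_def normUD using m by simp
  then show ?thesis unfolding sq by (simp add: algebra_simps)
qed

lemma f_stationary_conditions:
  assumes st: "f_stationary_2nd d r n X y lam U" and D: "D \<in> carrier_mat d r"
  defines "e \<equiv> \<lambda>i. y i - meas n X (U * U\<^sup>T) i"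
    and "a \<equiv> meas n X (U * D\<^sup>T + D * U\<^sup>T)" and "b \<equiv> meas n X (D * D\<^sup>T)"
  shows "(\<Sum>i<n. e i * a i) = 2 * lam * (U \<bullet>\<^sub>F D)"
    and "0 \<le> (\<Sum>i<n. (a i)\<^sup>2 - 2 * (e i * b i)) + 2 * lam * (D \<bullet>\<^sub>F D)"
proof -
  have U: "U \<in> carrier_mat d r" using st by (simp add: f_stationary_2nd_def)
  define c0 c1 c2 c3 c4 where "c0 = 1/4 * (\<Sum>i<n. (e i)\<^sup>2) + lam / 2 * (U \<bullet>\<^sub>F U)"
    and "c1 = lam * (U \<bullet>\<^sub>F D) - 1/2 * (\<Sum>i<n. e i * a i)"
    and "c2 = 1/4 * (\<Sum>i<n. (a i)\<^sup>2 - 2 * (e i * b i)) + lam / 2 * (D \<bullet>\<^sub>F D)"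
    and "c3 = 1/2 * (\<Sum>i<n. a i * b i)" and "c4 = 1/4 * (\<Sum>i<n. (b i)\<^sup>2)"
  have f: "(\<lambda>t. f_obj n X y lam (U + t \<cdot>\<^sub>m D)) = (\<lambda>t. c0 + c1 * t + c2 * t^2 + c3 * t^3 + c4 * t^4)"
    unfolding f_obj_expansion[OF U D] c0_def c1_def c2_def c3_def c4_def e_def a_def b_def ..
  have d1: "((\<lambda>t. c0 + c1 * t + c2 * t^2 + c3 * t^3 + c4 * t^4) has_real_derivative
      c1 + 2 * c2 * t + 3 * c3 * t^2 + 4 * c4 * t^3) (at t)" for t
    by (auto intro!: derivative_eq_intros simp: algebra_simps)
  have d2: "((\<lambda>t. c1 + 2 * c2 * t + 3 * c3 * t^2 + 4 * c4 * t^3) has_real_derivative 2 * c2) (at 0)"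
    by (auto intro!: derivative_eq_intros)
  have "((\<lambda>t. f_obj n X y lam (U + t \<cdot>\<^sub>m D)) has_real_derivative 0) (at 0)"
    "0 \<le> deriv (deriv (\<lambda>t. f_obj n X y lam (U + t \<cdot>\<^sub>m D))) 0"
    using st D by (auto simp: f_stationary_2nd_def)
  \<comment> \<open>The inner derivative is needed as a function, not only at 0, before it can be
    differentiated again.\<close>
  moreover have "deriv (\<lambda>t. c0 + c1 * t + c2 * t^2 + c3 * t^3 + c4 * t^4)
      = (\<lambda>t. c1 + 2 * c2 * t + 3 * c3 * t^2 + 4 * c4 * t^3)"
    using DERIV_imp_deriv[OF d1] by blast
  ultimately have "c1 = 0" "0 \<le> 2 * c2"
    using DERIV_unique[OF d1[of 0]] DERIV_imp_deriv[OF d2] unfolding f by auto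
  then show "(\<Sum>i<n. e i * a i) = 2 * lam * (U \<bullet>\<^sub>F D)"
    "0 \<le> (\<Sum>i<n. (a i)\<^sup>2 - 2 * (e i * b i)) + 2 * lam * (D \<bullet>\<^sub>F D)"
    unfolding c1_def c2_def by auto
qed

text \<open>The directional derivative along D is <lam U - G U, D>; testing it with D = G U - lam U
  makes the norm of D vanish.\<close>

lemma f_stationary_gradient:
  assumes st: "f_stationary_2nd d r n X y lam U"
  defines "G \<equiv> backproj d n X (\<lambda>i. y i - meas n X (U * U\<^sup>T) i)"
  shows "G * U = lam \<cdot>\<^sub>m U"
proof -
  have U: "U \<in> carrier_mat d r" using st by (simp add: f_stationary_2nd_def)
  have GT: "G\<^sup>T = G" using sym_mat_backproj by (simp add: G_def sym_mat_def)
  have [simp]: "dim_row U = d" "dim_col U = r" "dim_row G = d" "dim_col G = d" using U by (auto simp: G_def)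
  define D where "D = G * U - lam \<cdot>\<^sub>m U"
  have [simp]: "dim_row D = d" "dim_col D = r" by (auto simp: D_def)
  have D: "D \<in> carrier_mat d r" by (auto intro: carrier_matI)
  have "G \<bullet>\<^sub>F (U * D\<^sup>T + D * U\<^sup>T) = 2 * lam * (U \<bullet>\<^sub>F D)"
    unfolding G_def using f_stationary_conditions(1)[OF st D]
    by (subst backproj_inner) (auto intro: carrier_matI)
  moreover have "G \<bullet>\<^sub>F (D * U\<^sup>T) = (G * U) \<bullet>\<^sub>F D"
  proof -
    have "G \<bullet>\<^sub>F (D * U\<^sup>T) = (D * U\<^sup>T) \<bullet>\<^sub>F G" by (simp add: frob_inner_commute)
    also have "\<dots> = D \<bullet>\<^sub>F (G * U)" by (subst frob_inner_mult_right) auto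
    finally show ?thesis by (simp add: frob_inner_commute)
  qed
  moreover have "G \<bullet>\<^sub>F (U * D\<^sup>T) = G \<bullet>\<^sub>F (D * U\<^sup>T)"
    using frob_inner_transpose[of G "U * D\<^sup>T"] by (simp add: mat_normalize GT)
  ultimately have "(G * U) \<bullet>\<^sub>F D = lam * (U \<bullet>\<^sub>F D)" by (simp add: frob_inner_linear)
  moreover have "D \<bullet>\<^sub>F D = (G * U - lam \<cdot>\<^sub>m U) \<bullet>\<^sub>F D" by (simp only: D_def)
  then have "D \<bullet>\<^sub>F D = (G * U) \<bullet>\<^sub>F D - lam * (U \<bullet>\<^sub>F D)" by (simp add: frob_inner_linear)
  ultimately have "D \<bullet>\<^sub>F D = 0" by simp
  then have "D = 0\<^sub>m d r" using frob_inner_eq_0_iff[of D] by simp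
  then show ?thesis unfolding D_def by (subst mat_eq_iff_minus_zero[of _ d r]) (auto intro: carrier_matI)
qed

text \<open>The second-order condition in the direction \<open>D = U - L\<close>, with the first-order condition used to
  eliminate the cross term, gives
  \<open>3 \<parallel>\<X>(\<Delta>)\<parallel>\<^sup>2 - \<parallel>\<X>(D D\<^sup>T)\<parallel>\<^sup>2 \<le> 4 \<langle>\<epsilon>, \<X>(\<Delta>)\<rangle> + 2 \<langle>\<epsilon>, \<X>(D D\<^sup>T)\<rangle> + 2 \<lambda> (\<parallel>D\<parallel>\<^sup>2 - 4 \<langle>U, D\<rangle>)\<close>.\<close>
lemma stationary_point_error:
  assumes st: "f_stationary_2nd d r n X y lam U"
    and L: "L \<in> carrier_mat d r" and psd: "psd_mat r (U\<^sup>T * L)"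
    and y: "\<And>i. i < n \<Longrightarrow> y i = meas n X (L * L\<^sup>T) i + eps i"
    and rip: "rip d (2 * r) n X \<delta>" and \<delta>: "\<delta> \<le> 1/10"
    and noise: "\<And>A. sym_mat d A \<Longrightarrow> mrank A \<le> 2 * r \<Longrightarrow> \<bar>\<Sum>i<n. eps i * meas n X A i\<bar> \<le> \<nu> * frob_norm A"
    and nu: "0 \<le> \<nu>" and lam: "0 \<le> lam"
  shows "frob_norm (U * U\<^sup>T - L * L\<^sup>T) \<le> 14 * \<nu> + 12 * lam * sqrt (real r)"
proof -
  have U: "U \<in> carrier_mat d r" using st by (simp add: f_stationary_2nd_def)
  have [simp]: "dim_row U = d" "dim_col U = r" "dim_row L = d" "dim_col L = r" using U L by auto
  define D where "D = U - L"
  define E where "E = U * U\<^sup>T - L * L\<^sup>T"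
  have [simp]: "dim_row D = d" "dim_col D = r" "dim_row E = d" "dim_col E = d" by (auto simp: D_def E_def)
  have c: "D \<in> carrier_mat d r" "E \<in> carrier_mat d d" "D * D\<^sup>T \<in> carrier_mat d d"
    "U * U\<^sup>T \<in> carrier_mat d d" "L * L\<^sup>T \<in> carrier_mat d d" by (auto intro: carrier_matI)
  have symE: "sym_mat d E" by (auto simp: sym_mat_def E_def mat_normalize intro: carrier_matI)
  have symD: "sym_mat d (D * D\<^sup>T)" by (auto simp: sym_mat_def mat_normalize intro: carrier_matI)
  have rD: "mrank (D * D\<^sup>T) \<le> 2 * r" using mrank_mult_le[of D "D\<^sup>T"] by simp
  have "E = U * U\<^sup>T + L * ((-1) \<cdot>\<^sub>m L\<^sup>T)"
    unfolding E_def by (simp add: mat_normalize) (rule eq_matI, auto)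
  then have "mrank E \<le> mrank (U * U\<^sup>T) + mrank (L * ((-1) \<cdot>\<^sub>m L\<^sup>T))"
    using mrank_add_le[of "U * U\<^sup>T" d d "L * ((-1) \<cdot>\<^sub>m L\<^sup>T)"] carrier_matI[of "L * ((-1) \<cdot>\<^sub>m L\<^sup>T)" d d] c by simp
  then have rE: "mrank E \<le> 2 * r"
    using mrank_mult_le[of U "U\<^sup>T"] mrank_mult_le[of L "(-1) \<cdot>\<^sub>m L\<^sup>T"] by simp
  define p where "p = meas n X E"
  define w where "w = meas n X (D * D\<^sup>T)"
  \<comment> \<open>Key to the choice D = U - L: the linear variation of U U^T in this direction is
    the error itself plus a second-order term.\<close>
  have "U * D\<^sup>T + D * U\<^sup>T = E + D * D\<^sup>T"
    unfolding E_def D_def by (simp add: mat_normalize) (rule eq_matI, auto)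
  then have a: "meas n X (U * D\<^sup>T + D * U\<^sup>T) i = p i + w i" if "i < n" for i
    using c that by (simp add: p_def w_def meas_linear)
  have e: "y i - meas n X (U * U\<^sup>T) i = eps i - p i" if "i < n" for i
    using c that by (simp add: y p_def E_def meas_linear)
  define Spp Sww Spw Sep Sew where "Spp = (\<Sum>i<n. (p i)\<^sup>2)" and "Sww = (\<Sum>i<n. (w i)\<^sup>2)"
    and "Spw = (\<Sum>i<n. p i * w i)" and "Sep = (\<Sum>i<n. eps i * p i)" and "Sew = (\<Sum>i<n. eps i * w i)"
  have 1: "Sep + Sew - Spp - Spw = 2 * lam * (U \<bullet>\<^sub>F D)"
  proof -
    have "(\<Sum>i<n. (eps i - p i) * (p i + w i)) = 2 * lam * (U \<bullet>\<^sub>F D)"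
      using f_stationary_conditions(1)[OF st c(1)] a e by simp
    then show ?thesis unfolding Spp_def Spw_def Sep_def Sew_def
      by (simp add: algebra_simps sum.distrib sum_subtractf power2_eq_square)
  qed
  have 2: "0 \<le> Spp + 4 * Spw + Sww - 2 * Sew + 2 * lam * (D \<bullet>\<^sub>F D)"
  proof -
    have "0 \<le> (\<Sum>i<n. (p i + w i)\<^sup>2 - 2 * ((eps i - p i) * w i)) + 2 * lam * (D \<bullet>\<^sub>F D)"
      using f_stationary_conditions(2)[OF st c(1)] a e by (simp add: w_def)
    also have "(\<Sum>i<n. (p i + w i)\<^sup>2 - 2 * ((eps i - p i) * w i)) = Spp + 4 * Spw + Sww - 2 * Sew"
      unfolding Spp_def Spw_def Sww_def Sew_def sum_distrib_left sum_subtractf[symmetric] sum.distrib[symmetric]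
      by (intro sum.cong refl) (simp add: power2_eq_square algebra_simps)
    finally show ?thesis .
  qed
  define N where "N = frob_norm E"
  have N: "0 \<le> N" "E \<bullet>\<^sub>F E = N * N" by (auto simp: N_def frob_norm_sq[symmetric] power2_eq_square)
  have DD: "(D * D\<^sup>T) \<bullet>\<^sub>F (D * D\<^sup>T) \<le> 2 * (N * N)"
    using aligned_gram_difference[OF U L psd] by (simp add: D_def E_def N(2)[unfolded E_def])
  \<comment> \<open>3/2 is a rational upper bound for the square root of 2; the same replacement is
    made in the trace bound below.\<close>
  have nD: "frob_norm (D * D\<^sup>T) \<le> 3/2 * N"
  proof (rule power2_le_imp_le)
    show "(frob_norm (D * D\<^sup>T))\<^sup>2 \<le> (3/2 * N)\<^sup>2"
    proof -
      have "(3/2 * N)\<^sup>2 = 9/4 * (N * N)" by (simp add: power2_eq_square)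
      then show ?thesis unfolding frob_norm_sq using DD mult_nonneg_nonneg[OF N(1) N(1)] by linarith
    qed
  qed (use N in simp)
  have "(1 - \<delta>) * (E \<bullet>\<^sub>F E) \<le> Spp"
    using rip symE rE unfolding rip_def Spp_def p_def by blast
  then have 3: "9/10 * (N * N) \<le> Spp"
    using mult_right_mono[of "9/10" "1 - \<delta>" "N * N"] \<delta> N by simp
  have "Sww \<le> (1 + \<delta>) * ((D * D\<^sup>T) \<bullet>\<^sub>F (D * D\<^sup>T))"
    using rip symD rD unfolding rip_def Sww_def w_def by blast
  also have "\<dots> \<le> 11/10 * ((D * D\<^sup>T) \<bullet>\<^sub>F (D * D\<^sup>T))" using \<delta> by (intro mult_right_mono) auto
  finally have 4: "Sww \<le> 22/10 * (N * N)" using DD by simp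
  have 5: "Sep \<le> \<nu> * N"
    using noise[OF symE rE] unfolding Sep_def p_def N_def by linarith
  have "Sew \<le> \<nu> * frob_norm (D * D\<^sup>T)"
    using noise[OF symD rD] unfolding Sew_def w_def by linarith
  also have "\<dots> \<le> \<nu> * (3/2 * N)" using nu nD by (intro mult_left_mono) auto
  finally have 6: "Sew \<le> 3/2 * (\<nu> * N)" by simp
  have tr: "1\<^sub>m d \<bullet>\<^sub>F (A * A\<^sup>T) = A \<bullet>\<^sub>F A" if "A \<in> carrier_mat d r" for A
  proof -
    have "(1\<^sub>m d * A) \<bullet>\<^sub>F A = 1\<^sub>m d \<bullet>\<^sub>F (A * A\<^sup>T)" using that by (subst frob_inner_mult_right) auto
    then show ?thesis using that by (simp add: mat_one_mult)
  qed
  have "\<bar>1\<^sub>m d \<bullet>\<^sub>F E\<bar> \<le> sqrt (real (2 * r)) * N"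
    unfolding N_def by (rule trace_low_rank_bound[OF c(2) rE])
  moreover have "sqrt (real (2 * r)) \<le> 3/2 * sqrt (real r)"
    by (rule real_le_lsqrt) (auto simp: power_mult_distrib power2_eq_square)
  then have "sqrt (real (2 * r)) * N \<le> 3/2 * sqrt (real r) * N" using N by (intro mult_right_mono) auto
  moreover have "1\<^sub>m d \<bullet>\<^sub>F E = U \<bullet>\<^sub>F U - L \<bullet>\<^sub>F L"
    unfolding E_def using tr[OF U] tr[OF L] by (simp add: frob_inner_linear)
  ultimately have t: "2 * (L \<bullet>\<^sub>F L - U \<bullet>\<^sub>F U) \<le> 3 * sqrt (real r) * N" by argo
  have LU: "L \<bullet>\<^sub>F U = U \<bullet>\<^sub>F L" by (simp add: frob_inner_commute)
  \<comment> \<open>The penalty terms reduce to a difference of traces, that is, to the trace of E,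
    which the low-rank trace bound controls.\<close>
  have "D \<bullet>\<^sub>F D - 4 * (U \<bullet>\<^sub>F D) = 2 * (L \<bullet>\<^sub>F L - U \<bullet>\<^sub>F U) - D \<bullet>\<^sub>F D"
    unfolding D_def by (simp add: frob_inner_linear LU)
  then have "D \<bullet>\<^sub>F D - 4 * (U \<bullet>\<^sub>F D) \<le> 3 * sqrt (real r) * N" using t frob_inner_nonneg[of D] by argo
  then have "lam * (D \<bullet>\<^sub>F D - 4 * (U \<bullet>\<^sub>F D)) \<le> lam * (3 * sqrt (real r) * N)"
    using lam by (rule mult_left_mono)
  then have 7: "lam * (D \<bullet>\<^sub>F D) - 4 * (lam * (U \<bullet>\<^sub>F D)) \<le> 3 * (lam * sqrt (real r) * N)"
    by (simp add: algebra_simps)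
  \<comment> \<open>Eliminating \<open>Spw\<close> from 1 and 2 leaves 3 Spp - Sww on the left; with
    isometry constant 1/10 this is at least (27/10 - 22/10) N^2. This margin is why \<delta> is kept
    below 1/10.\<close>
  have "1/2 * (N * N) \<le> 7 * (\<nu> * N) + 6 * (lam * sqrt (real r) * N)"
    using 1 2 3 4 5 6 7 by linarith
  then have "N * N \<le> N * (14 * \<nu> + 12 * lam * sqrt (real r))" by (simp add: algebra_simps)
  moreover have "0 \<le> 14 * \<nu> + 12 * lam * sqrt (real r)" using nu lam by simp
  ultimately have "N \<le> 14 * \<nu> + 12 * lam * sqrt (real r)"
    using N(1) by (cases "N = 0") auto
  then show ?thesis by (simp add: N_def E_def)
qed

text \<open>The isometry property speaks of squares only; polarizing it against x x^T needs rank r +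
  1 <= 2r, which holds for a rank r matrix but not for E. So E is split into two halves, whence the
  factor 2.\<close>

lemma isometry_defect_bound:
  assumes rip: "rip d (2 * r) n X \<delta>" and r: "0 < r" and \<delta>: "0 \<le> \<delta>"
    and E: "sym_mat d E" "mrank E \<le> 2 * r" and x: "x \<in> carrier_mat d 1"
  shows "\<bar>(\<Sum>i<n. meas n X E i * meas n X (x * x\<^sup>T) i) - E \<bullet>\<^sub>F (x * x\<^sup>T)\<bar> \<le> 2 * \<delta> * frob_norm E * (x \<bullet>\<^sub>F x)"
proof -
  have [simp]: "dim_row x = d" "dim_col x = 1" using x by auto
  define B where "B = x * x\<^sup>T"
  have [simp]: "dim_row B = d" "dim_col B = d" by (auto simp: B_def)
  have Bc: "B \<in> carrier_mat d d" by (auto intro: carrier_matI)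
  have BB: "B \<bullet>\<^sub>F B = (x \<bullet>\<^sub>F x) * (x \<bullet>\<^sub>F x)"
  proof -
    have "B \<bullet>\<^sub>F B = x\<^sup>T \<bullet>\<^sub>F (x\<^sup>T * x * x\<^sup>T)" unfolding B_def
      by (subst frob_inner_mult_left) (auto simp: mat_normalize)
    then show ?thesis
      unfolding col_mat_mult[OF x x] by (simp add: mat_normalize frob_inner_linear frob_inner_transpose)
  qed
  have half: "\<bar>(\<Sum>i<n. meas n X A i * meas n X B i) - A \<bullet>\<^sub>F B\<bar> \<le> \<delta> * frob_norm A * (x \<bullet>\<^sub>F x)"
    if A: "sym_mat d A" "mrank A \<le> r" for A
  proof -
    have Ac: "A \<in> carrier_mat d d" using A by (simp add: sym_mat_def)
    have [simp]: "dim_row A = d" "dim_col A = d" using Ac by auto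
    have AB: "A \<bullet>\<^sub>F B = B \<bullet>\<^sub>F A" by (simp add: frob_inner_commute)
    define z where "z = (\<Sum>i<n. meas n X A i * meas n X B i) - A \<bullet>\<^sub>F B"
    have rk: "mrank (A + t \<cdot>\<^sub>m B) \<le> 2 * r" and sm: "sym_mat d (A + t \<cdot>\<^sub>m B)" for t
    proof -
      have "mrank (t \<cdot>\<^sub>m B) \<le> 1"
        using mrank_mult_le[of "t \<cdot>\<^sub>m x" "x\<^sup>T"] by (simp add: B_def mat_normalize)
      then show "mrank (A + t \<cdot>\<^sub>m B) \<le> 2 * r"
        using mrank_add_le[OF Ac, of "t \<cdot>\<^sub>m B"] Bc A(2) r by simp
      show "sym_mat d (A + t \<cdot>\<^sub>m B)" using A(1)
        by (auto simp: sym_mat_def mat_normalize B_def intro: carrier_matI)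
    qed
    have q: "(\<Sum>i<n. (meas n X (A + t \<cdot>\<^sub>m B) i)\<^sup>2) = (\<Sum>i<n. (meas n X A i)\<^sup>2)
        + 2 * t * (\<Sum>i<n. meas n X A i * meas n X B i) + t\<^sup>2 * (\<Sum>i<n. (meas n X B i)\<^sup>2)" for t
    proof -
      have "(\<Sum>i<n. (meas n X (A + t \<cdot>\<^sub>m B) i)\<^sup>2) = (\<Sum>i<n. (meas n X A i + t * meas n X B i)\<^sup>2)"
        using Ac Bc by (intro sum.cong refl) (simp add: meas_linear)
      also have "\<dots> = (\<Sum>i<n. (meas n X A i)\<^sup>2)
        + 2 * t * (\<Sum>i<n. meas n X A i * meas n X B i) + t\<^sup>2 * (\<Sum>i<n. (meas n X B i)\<^sup>2)"
        unfolding sum_distrib_left sum.distrib[symmetric]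
        by (intro sum.cong refl) (simp add: power2_eq_square algebra_simps)
      finally show ?thesis .
    qed
    have ip: "(A + t \<cdot>\<^sub>m B) \<bullet>\<^sub>F (A + t \<cdot>\<^sub>m B) = A \<bullet>\<^sub>F A + 2 * t * (A \<bullet>\<^sub>F B) + t\<^sup>2 * (B \<bullet>\<^sub>F B)" for t
      by (simp add: frob_inner_linear AB power2_eq_square algebra_simps)
    \<comment> \<open>Upper isometry at t and lower isometry at - t: on subtraction the pure squares
      of the measurements cancel and 4 t z is bounded by a multiple of \<delta>.\<close>
    have "(- z)\<^sup>2 \<le> (\<delta> * (B \<bullet>\<^sub>F B)) * (\<delta> * (A \<bullet>\<^sub>F A))"
    proof (rule nonneg_quadratic_discriminant)
      fix t
      have "(\<Sum>i<n. (meas n X (A + t \<cdot>\<^sub>m B) i)\<^sup>2) \<le> (1 + \<delta>) * ((A + t \<cdot>\<^sub>m B) \<bullet>\<^sub>F (A + t \<cdot>\<^sub>m B))"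
        using rip rk[of t] sm[of t] unfolding rip_def by blast
      moreover have "(1 - \<delta>) * ((A + (-t) \<cdot>\<^sub>m B) \<bullet>\<^sub>F (A + (-t) \<cdot>\<^sub>m B)) \<le> (\<Sum>i<n. (meas n X (A + (-t) \<cdot>\<^sub>m B) i)\<^sup>2)"
        using rip rk[of "- t"] sm[of "- t"] unfolding rip_def by blast
      ultimately show "0 \<le> \<delta> * (B \<bullet>\<^sub>F B) * t\<^sup>2 + 2 * - z * t + \<delta> * (A \<bullet>\<^sub>F A)"
        unfolding q ip z_def by (simp add: algebra_simps)
    qed
    also have "\<dots> = (\<delta> * frob_norm A * (x \<bullet>\<^sub>F x))\<^sup>2"
      by (simp add: BB power_mult_distrib frob_norm_sq) (simp add: power2_eq_square)
    finally have "z\<^sup>2 \<le> (\<delta> * frob_norm A * (x \<bullet>\<^sub>F x))\<^sup>2" by simp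
    then show ?thesis unfolding z_def[symmetric] using \<delta> by (simp add: abs_le_square_iff[symmetric])
  qed
  obtain A C where AC: "sym_mat d A" "sym_mat d C" "mrank A \<le> r" "mrank C \<le> r" "E = A + C"
    "frob_norm A \<le> frob_norm E" "frob_norm C \<le> frob_norm E"
    using sym_mat_split[OF E] by blast
  have ACc: "A \<in> carrier_mat d d" "C \<in> carrier_mat d d" using AC by (auto simp: sym_mat_def)
  have "(\<Sum>i<n. meas n X E i * meas n X B i) - E \<bullet>\<^sub>F B
      = ((\<Sum>i<n. meas n X A i * meas n X B i) - A \<bullet>\<^sub>F B) + ((\<Sum>i<n. meas n X C i * meas n X B i) - C \<bullet>\<^sub>F B)"
    using ACc by (simp add: AC(5) meas_linear frob_inner_linear distrib_right sum.distrib)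
  also have "\<bar>\<dots>\<bar> \<le> \<delta> * frob_norm A * (x \<bullet>\<^sub>F x) + \<delta> * frob_norm C * (x \<bullet>\<^sub>F x)"
    using half[OF AC(1,3)] half[OF AC(2,4)] by linarith
  also have "\<dots> \<le> \<delta> * frob_norm E * (x \<bullet>\<^sub>F x) + \<delta> * frob_norm E * (x \<bullet>\<^sub>F x)"
    using AC(6,7) \<delta> by (intro add_mono mult_right_mono mult_left_mono) auto
  finally show ?thesis unfolding B_def by simp
qed

text \<open>\<open>\<lambda> I - G\<close> is a dual certificate: it vanishes on the columns of \<open>V\<close> and is positive definite on
  their complement, which forces every minimizer to have column space in that of \<open>V\<close>.\<close>
lemma g_minimizer_unique:
  assumes Z: "g_minimizer d n X y lam Z"
    and U: "U \<in> carrier_mat d r" and V: "V \<in> carrier_mat d r" "V\<^sup>T * V = 1\<^sub>m r" and UV: "U * U\<^sup>T = V * K0 * V\<^sup>T"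
    and K0: "K0 \<in> carrier_mat r r"
    and G: "G = backproj d n X (\<lambda>i. y i - meas n X (U * U\<^sup>T) i)" and GV: "G * V = lam \<cdot>\<^sub>m V"
    and tau: "\<tau> < lam" and Gb: "\<And>x. x \<in> carrier_mat d 1 \<Longrightarrow> V\<^sup>T * x = 0\<^sub>m r 1 \<Longrightarrow> \<bar>x \<bullet>\<^sub>F (G * x)\<bar> \<le> \<tau> * (x \<bullet>\<^sub>F x)"
    and rip: "rip d (2 * r) n X \<delta>" and \<delta>: "\<delta> < 1"
  shows "Z = U * U\<^sup>T"
proof -
  have psdZ: "psd_mat d Z" and min: "g_obj n X y lam Z \<le> g_obj n X y lam (U * U\<^sup>T)"
    using Z psd_mat_gram[OF U] by (auto simp: g_minimizer_def)
  have [simp]: "dim_row U = d" "dim_col U = r" "dim_row V = d" "dim_col V = r" "dim_row K0 = r" "dim_col K0 = r"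
    using U V K0 by auto
  have [simp]: "dim_row G = d" "dim_col G = d" by (auto simp: G)
  have Zc: "Z \<in> carrier_mat d d" and ZT: "Z\<^sup>T = Z" using psdZ by (auto simp: psd_mat_def sym_mat_def)
  have [simp]: "dim_row Z = d" "dim_col Z = d" using Zc by auto
  have GT: "G\<^sup>T = G" using sym_mat_backproj by (simp add: G sym_mat_def)
  have V_cancel: "V\<^sup>T * (V * Y) = Y" if "dim_row Y = r" for Y
    using mat_mult_cancel_left[OF V(2), of Y] that by (simp add: mat_one_mult)
  define K where "K = Z - U * U\<^sup>T"
  have [simp]: "dim_row K = d" "dim_col K = d" by (auto simp: K_def)
  have Kc: "K \<in> carrier_mat d d" "U * U\<^sup>T \<in> carrier_mat d d" by (auto intro: carrier_matI)
  define e where "e i = y i - meas n X (U * U\<^sup>T) i" for i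
  define k where "k = meas n X K"
  have ek: "y i - meas n X Z i = e i - k i" if "i < n" for i
    using that Kc Zc by (simp add: e_def k_def K_def meas_linear)
  have "g_obj n X y lam Z = 1/2 * (\<Sum>i<n. (e i - k i)\<^sup>2) + lam * (1\<^sub>m d \<bullet>\<^sub>F Z)"
    unfolding g_obj_def nuc_norm_psd[OF psdZ] meas_def[symmetric] using ek by simp
  moreover have "g_obj n X y lam (U * U\<^sup>T) = 1/2 * (\<Sum>i<n. (e i)\<^sup>2) + lam * (1\<^sub>m d \<bullet>\<^sub>F (U * U\<^sup>T))"
    unfolding g_obj_def nuc_norm_psd[OF psd_mat_gram[OF U]] meas_def[symmetric] e_def ..
  moreover have "(\<Sum>i<n. (e i - k i)\<^sup>2) = (\<Sum>i<n. (e i)\<^sup>2) - 2 * (\<Sum>i<n. e i * k i) + (\<Sum>i<n. (k i)\<^sup>2)"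
    unfolding sum_distrib_left sum_subtractf[symmetric] sum.distrib[symmetric]
    by (intro sum.cong refl) (simp add: power2_eq_square algebra_simps)
  moreover have "(\<Sum>i<n. e i * k i) = G \<bullet>\<^sub>F K"
    unfolding G k_def e_def using backproj_inner[OF Kc(1)] by simp
  moreover have "lam * (1\<^sub>m d \<bullet>\<^sub>F K) = lam * (1\<^sub>m d \<bullet>\<^sub>F Z) - lam * (1\<^sub>m d \<bullet>\<^sub>F (U * U\<^sup>T))"
    unfolding K_def by (simp add: frob_inner_linear right_diff_distrib)
  \<comment> \<open>The exact second-order expansion of the convex objective around U U^T, with the
    quadratic term kept for use at the end.\<close>
  ultimately have le: "lam * (1\<^sub>m d \<bullet>\<^sub>F K) - G \<bullet>\<^sub>F K + 1/2 * (\<Sum>i<n. (k i)\<^sup>2) \<le> 0"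
    using min by argo
  define F where "F = lam \<cdot>\<^sub>m 1\<^sub>m d - G"
  have [simp]: "dim_row F = d" "dim_col F = d" by (auto simp: F_def)
  have FT: "F\<^sup>T = F" by (simp add: F_def mat_normalize GT)
  have FV: "F * V = 0\<^sub>m d r" by (simp add: F_def mat_normalize GV) (rule eq_matI, auto)
  have FV_cancel: "F * (V * Y) = 0\<^sub>m d (dim_col Y)" if "dim_row Y = r" for Y
    using mat_mult_cancel_left[OF FV, of Y] that by (simp add: mat_zero_mult)
  have "F \<bullet>\<^sub>F (U * U\<^sup>T) = 0"
  proof -
    have "F \<bullet>\<^sub>F (U * U\<^sup>T) = (V * (K0 * V\<^sup>T)) \<bullet>\<^sub>F F" unfolding UV by (simp add: frob_inner_commute mat_mult_assoc)
    also have "\<dots> = (K0 * V\<^sup>T) \<bullet>\<^sub>F (V\<^sup>T * F)" by (subst frob_inner_mult_left) auto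
    also have "V\<^sup>T * F = 0\<^sub>m r d" using arg_cong[OF FV, of transpose_mat] by (simp add: mat_normalize FT)
    finally show ?thesis by simp
  qed
  then have FZ: "F \<bullet>\<^sub>F Z + 1/2 * (\<Sum>i<n. (k i)\<^sup>2) \<le> 0"
    using le unfolding K_def F_def by (simp add: frob_inner_linear algebra_simps)
  define P where "P = 1\<^sub>m d - V * V\<^sup>T"
  have [simp]: "dim_row P = d" "dim_col P = d" by (auto simp: P_def)
  have PT: "P\<^sup>T = P" by (simp add: P_def mat_normalize)
  have VP: "V\<^sup>T * P = 0\<^sub>m r d" by (simp add: P_def mat_normalize V_cancel) (rule eq_matI, auto)
  have PP: "P * P = P"
    by (simp add: P_def mat_normalize V_cancel) (rule eq_matI, auto)
  have FP: "F * (P * Y) = F * Y" if "dim_row Y = d" for Y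
    using that by (simp add: P_def mat_normalize FV_cancel) (rule eq_matI, auto)
  define \<mu> where "\<mu> = lam - \<tau>"
  have mu: "0 < \<mu>" using tau by (simp add: \<mu>_def)
  \<comment> \<open>Strictness of the certificate: F is at least \<mu> times the projection onto the
    complement of V.\<close>
  have psdF: "psd_mat d (F - \<mu> \<cdot>\<^sub>m P)"
  proof (rule psd_matI)
    fix x :: "real mat" assume x: "x \<in> carrier_mat d 1"
    have [simp]: "dim_row x = d" "dim_col x = 1" using x by auto
    define z where "z = P * x"
    have [simp]: "dim_row z = d" "dim_col z = 1" by (auto simp: z_def)
    have "V\<^sup>T * z = 0\<^sub>m r 1" unfolding z_def using mat_mult_cancel_left[OF VP, of x] by (simp add: mat_zero_mult)
    then have b: "\<bar>z \<bullet>\<^sub>F (G * z)\<bar> \<le> \<tau> * (z \<bullet>\<^sub>F z)" by (intro Gb) (auto intro: carrier_matI)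
    have "x \<bullet>\<^sub>F (F * x) = x \<bullet>\<^sub>F (F * z)" by (simp add: z_def FP)
    also have "\<dots> = (F * x) \<bullet>\<^sub>F z" by (subst frob_inner_mult_left) (auto simp: FT)
    also have "\<dots> = (F * z) \<bullet>\<^sub>F z" by (simp add: z_def FP)
    also have "\<dots> = lam * (z \<bullet>\<^sub>F z) - z \<bullet>\<^sub>F (G * z)"
      using frob_inner_commute[of "G * z" z] by (simp add: F_def mat_normalize frob_inner_linear)
    finally have xF: "x \<bullet>\<^sub>F (F * x) = lam * (z \<bullet>\<^sub>F z) - z \<bullet>\<^sub>F (G * z)" .
    have "x \<bullet>\<^sub>F (P * x) = x \<bullet>\<^sub>F (P * z)" unfolding z_def using mat_mult_cancel_left[OF PP, of x] by simp
    also have "\<dots> = (P * x) \<bullet>\<^sub>F z" by (subst frob_inner_mult_left) (auto simp: PT)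
    finally have xP: "x \<bullet>\<^sub>F (P * x) = z \<bullet>\<^sub>F z" by (simp add: z_def)
    show "0 \<le> x \<bullet>\<^sub>F ((F - \<mu> \<cdot>\<^sub>m P) * x)"
      using b xF xP by (simp add: mat_normalize frob_inner_linear \<mu>_def left_diff_distrib)
  qed (auto simp: mat_normalize FT PT intro: carrier_matI)
  obtain R where R: "R \<in> carrier_mat d d" "Z = R * R\<^sup>T" using psd_mat_factor[OF psdZ] by blast
  have [simp]: "dim_row R = d" "dim_col R = d" using R by auto
  have "F \<bullet>\<^sub>F Z = (R * R\<^sup>T) \<bullet>\<^sub>F F" by (simp add: R(2) frob_inner_commute)
  also have "\<dots> = R \<bullet>\<^sub>F (F * R)" by (subst frob_inner_mult_right) auto
  finally have FR: "F \<bullet>\<^sub>F Z = R \<bullet>\<^sub>F (F * R)" .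
  have "0 \<le> R \<bullet>\<^sub>F ((F - \<mu> \<cdot>\<^sub>m P) * R)" by (rule psd_mat_quadratic_form[OF psdF R(1)])
  then have RF: "\<mu> * (R \<bullet>\<^sub>F (P * R)) \<le> R \<bullet>\<^sub>F (F * R)" by (simp add: mat_normalize frob_inner_linear)
  have "R \<bullet>\<^sub>F (P * R) = R \<bullet>\<^sub>F (P * (P * R))" using mat_mult_cancel_left[OF PP, of R] by simp
  also have "\<dots> = (P * R) \<bullet>\<^sub>F (P * R)"
    using frob_inner_mult_left[where A = P and B = R and C = "P * R"] by (simp add: PT)
  finally have RP: "R \<bullet>\<^sub>F (P * R) = (P * R) \<bullet>\<^sub>F (P * R)" .
  have nn: "0 \<le> (\<Sum>i<n. (k i)\<^sup>2)" "0 \<le> \<mu> * ((P * R) \<bullet>\<^sub>F (P * R))"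
    using mu by (auto intro: sum_nonneg)
  \<comment> \<open>Two nonnegative quantities have a nonpositive sum. P R = 0 confines Z to the
    column space of V, and k = 0 says that K is invisible to the measurements; K then has low rank,
    so the isometry property forces K = 0.\<close>
  then have k0: "(\<Sum>i<n. (k i)\<^sup>2) = 0" and "\<mu> * ((P * R) \<bullet>\<^sub>F (P * R)) = 0"
    using FZ FR RF[unfolded RP] by linarith+
  then have "(P * R) \<bullet>\<^sub>F (P * R) = 0" using mu by simp
  then have "P * R = 0\<^sub>m d d" using frob_inner_eq_0_iff[of "P * R"] by simp
  then have "R - V * (V\<^sup>T * R) = 0\<^sub>m d d" by (simp add: P_def mat_normalize)
  then have "R = V * (V\<^sup>T * R)" by (subst mat_eq_iff_minus_zero[of _ d d]) (auto intro: carrier_matI)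
  then have "Z = V * (V\<^sup>T * R * R\<^sup>T)" unfolding R(2) using mat_mult_assoc[of V "V\<^sup>T * R" "R\<^sup>T"] by simp
  then have "K = V * (V\<^sup>T * R * R\<^sup>T) - V * (K0 * V\<^sup>T)"
    unfolding K_def UV by (simp add: mat_mult_assoc)
  then have "K = V * (V\<^sup>T * R * R\<^sup>T - K0 * V\<^sup>T)" by (simp add: mat_normalize)
  then have "mrank K \<le> 2 * r" using mrank_mult_le[of V "V\<^sup>T * R * R\<^sup>T - K0 * V\<^sup>T"] by simp
  moreover have "sym_mat d K" by (auto simp: sym_mat_def K_def mat_normalize ZT intro: carrier_matI)
  ultimately have "(1 - \<delta>) * (K \<bullet>\<^sub>F K) \<le> 0" using rip k0 unfolding rip_def k_def by metis
  then have "K \<bullet>\<^sub>F K = 0" using \<delta> frob_inner_nonneg[of K] by (simp add: mult_le_0_iff)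
  then have "K = 0\<^sub>m d d" using frob_inner_eq_0_iff[of K] by simp
  then show ?thesis unfolding K_def by (subst mat_eq_iff_minus_zero[of _ d d]) (auto intro: carrier_matI)
qed

end

section \<open>The spectral norm\<close>

lemma frob_norm_col: "Y \<in> carrier_mat d 1 \<Longrightarrow> frob_norm Y = vnorm (col Y 0)"
  using frob_inner_cols[of Y d 1] by (simp add: frob_norm_def vnorm_def)

text \<open>A real \<open>Sup\<close> bounds the members of its set only if the set is bounded
  above. The crude estimate |A z|^2 <= |A^T A| |z|^2 with the Frobenius norm provides this.\<close>

lemma spec_norm_form_bound:
  assumes A: "A \<in> carrier_mat d d" and x: "x \<in> carrier_mat d 1"
  shows "\<bar>x \<bullet>\<^sub>F (A * x)\<bar> \<le> spec_norm A * (x \<bullet>\<^sub>F x)"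
proof -
  have [simp]: "dim_row A = d" "dim_col A = d" "dim_row x = d" "dim_col x = 1" using A x by auto
  let ?S = "{vnorm (A *\<^sub>v x) | x. x \<in> carrier_vec (dim_col A) \<and> vnorm x = 1}"
  have le: "(A * z) \<bullet>\<^sub>F (A * z) \<le> frob_norm (A\<^sup>T * A) * (z \<bullet>\<^sub>F z)" if "z \<in> carrier_mat d 1" for z
  proof -
    have [simp]: "dim_row z = d" "dim_col z = 1" using that by auto
    have "(A * z) \<bullet>\<^sub>F (A * z) = z \<bullet>\<^sub>F (A\<^sup>T * A * z)"
      by (subst frob_inner_mult_left) (auto simp: mat_mult_assoc)
    then show ?thesis using frob_norm_form_bound[of "A\<^sup>T * A" d z] that carrier_matI[of "A\<^sup>T * A" d d] by simp
  qed
  have bdd: "bdd_above ?S"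
  proof (rule bdd_aboveI)
    fix s assume "s \<in> ?S"
    then obtain v where v: "v \<in> carrier_vec d" "vnorm v = 1" "s = vnorm (A *\<^sub>v v)" by auto
    let ?z = "mat_of_cols d [v]"
    have z: "?z \<in> carrier_mat d 1" using mat_of_cols_carrier(1)[of d "[v]"] by simp
    have "col ?z 0 = v" using v(1) by (intro eq_vecI) (auto simp: mat_of_cols_def)
    then have "frob_norm ?z = 1" using frob_norm_col[OF z] v by simp
    then have zz: "?z \<bullet>\<^sub>F ?z = 1" using frob_norm_sq[of ?z] by simp
    have "A *\<^sub>v v \<in> carrier_vec d" by (intro carrier_vecI) simp
    then have "col (A * ?z) 0 = A *\<^sub>v v"
      unfolding mult_mat_of_col[OF A v(1)] by (intro eq_vecI) (auto simp: mat_of_cols_def)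
    moreover have "A * ?z \<in> carrier_mat d 1" using z by (auto intro: carrier_matI)
    ultimately have "s = frob_norm (A * ?z)" using frob_norm_col[of "A * ?z" d] v by simp
    then show "s \<le> sqrt (frob_norm (A\<^sup>T * A))" using le[OF z] zz by (simp add: frob_norm_def)
  qed
  show ?thesis
  proof (cases "x = 0\<^sub>m d 1")
    case True
    then show ?thesis by (simp add: mat_mult_zero)
  next
    case False
    define c where "c = frob_norm x"
    define u where "u = (1 / c) \<cdot>\<^sub>m x"
    have [simp]: "dim_row u = d" "dim_col u = 1" by (auto simp: u_def)
    have uc: "u \<in> carrier_mat d 1" by (auto intro: carrier_matI)
    have c: "c \<noteq> 0" and uu: "u \<bullet>\<^sub>F u = 1" using normalize_col[OF x False] by (auto simp: c_def u_def)
    have xu: "x = c \<cdot>\<^sub>m u" using c by (intro eq_matI) (auto simp: u_def)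
    have "vnorm (col u 0) = 1" using frob_norm_col[OF uc] uu by (simp add: frob_norm_def)
    moreover have "col u 0 \<in> carrier_vec d" by (intro carrier_vecI) simp
    ultimately have "vnorm (A *\<^sub>v col u 0) \<in> ?S" by auto
    then have "vnorm (A *\<^sub>v col u 0) \<le> spec_norm A" unfolding spec_norm_def using bdd by (rule cSup_upper)
    moreover have "A *\<^sub>v col u 0 = col (A * u) 0" by (rule eq_vecI) auto
    moreover have "A * u \<in> carrier_mat d 1" by (auto intro: carrier_matI)
    ultimately have Au: "frob_norm (A * u) \<le> spec_norm A" using frob_norm_col[of "A * u" d] by simp
    have "\<bar>u \<bullet>\<^sub>F (A * u)\<bar> \<le> frob_norm u * frob_norm (A * u)" by (rule frob_Cauchy_Schwarz) auto
    also have "\<dots> = frob_norm (A * u)" using uu by (simp add: frob_norm_def)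
    finally have u: "\<bar>u \<bullet>\<^sub>F (A * u)\<bar> \<le> spec_norm A" using Au by linarith
    have "x \<bullet>\<^sub>F (A * x) = c\<^sup>2 * (u \<bullet>\<^sub>F (A * u))"
      unfolding xu by (simp add: mat_normalize frob_inner_linear power2_eq_square)
    moreover have "x \<bullet>\<^sub>F x = c\<^sup>2" by (simp add: c_def frob_norm_sq)
    ultimately show ?thesis using mult_left_mono[OF u, of "c\<^sup>2"] by (simp add: abs_mult mult.commute)
  qed
qed

section \<open>Debiased estimators\<close>

lemma (in sym_design) debiased_of_certificate:
  assumes svd: "svd_form d r U VU s W" and U: "U \<in> carrier_mat d r"
    and Z: "g_minimizer d n X y lam Z"
    and G: "G = backproj d n X (\<lambda>i. y i - meas n X (U * U\<^sup>T) i)" and GU: "G * U = lam \<cdot>\<^sub>m U"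
    and tau: "0 \<le> \<tau>" "\<tau> < lam"
    and Gb: "\<And>x. x \<in> carrier_mat d 1 \<Longrightarrow> U\<^sup>T * x = 0\<^sub>m r 1 \<Longrightarrow> \<bar>x \<bullet>\<^sub>F (G * x)\<bar> \<le> \<tau> * (x \<bullet>\<^sub>F x)"
    and rip: "rip d (2 * r) n X \<delta>" and \<delta>: "\<delta> < 1"
  shows "best_rank_approx r (deb_input d n X y Z) Y \<longleftrightarrow> Y = VU * mat_diag r (\<lambda>i. s i + lam) * VU\<^sup>T"
proof -
  have W: "orth_mat r W" and VV: "VU\<^sup>T * VU = 1\<^sub>m r" and s: "\<And>i. i < r \<Longrightarrow> 0 < s i"
    and V: "VU \<in> carrier_mat d r" and UV: "U = VU * mat_diag r (\<lambda>i. sqrt (s i)) * W\<^sup>T"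
    using svd by (auto simp: svd_form_def orth_mat_def)
  have [simp]: "dim_row VU = d" "dim_col VU = r" "dim_row U = d" "dim_col U = r" using V U by auto
  note [simp] = orth_matD(1,2)[OF W]
  note W_cancel = orth_mat_cancel[OF W] orth_matD(3,4)[OF W]
  have [simp]: "dim_row G = d" "dim_col G = d" by (auto simp: G)
  have GT: "G\<^sup>T = G" using sym_mat_backproj by (simp add: G sym_mat_def)
  have V_cancel: "VU\<^sup>T * (VU * Y) = Y" if "dim_row Y = r" for Y
    using mat_mult_cancel_left[OF VV, of Y] that by (simp add: mat_one_mult)
  have UU: "U * U\<^sup>T = VU * mat_diag r s * VU\<^sup>T"
  proof -
    have "mat_diag r (\<lambda>i. sqrt (s i) * sqrt (s i)) = mat_diag r s"
      by (rule mat_diag_cong) (simp add: s less_imp_le)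
    then show ?thesis by (simp add: UV mat_normalize W_cancel mat_diag_mult_cancel)
  qed
  \<comment> \<open>Writing VU through U transfers the eigenvector equation from U to its
    orthonormal factor.\<close>
  have VUW: "VU = U * (W * mat_diag r (\<lambda>i. 1 / sqrt (s i)))"
  proof -
    have "U * (W * mat_diag r (\<lambda>i. 1 / sqrt (s i))) = VU * mat_diag r (\<lambda>i. sqrt (s i) * (1 / sqrt (s i)))"
      unfolding UV by (simp add: mat_normalize W_cancel)
    also have "mat_diag r (\<lambda>i. sqrt (s i) * (1 / sqrt (s i))) = 1\<^sub>m r" unfolding mat_diag_one[symmetric]
    proof (rule mat_diag_cong)
      show "sqrt (s i) * (1 / sqrt (s i)) = 1" if "i < r" for i using s[OF that] by simp
    qed
    finally show ?thesis by (simp add: mat_mult_one)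
  qed
  have "G * VU = (G * U) * (W * mat_diag r (\<lambda>i. 1 / sqrt (s i)))"
    by (subst VUW) (simp add: mat_mult_assoc)
  also have "\<dots> = lam \<cdot>\<^sub>m VU" unfolding GU using VUW by (simp add: mat_smult_mult)
  finally have GV: "G * VU = lam \<cdot>\<^sub>m VU" .
  have Gb': "\<bar>x \<bullet>\<^sub>F (G * x)\<bar> \<le> \<tau> * (x \<bullet>\<^sub>F x)" if x: "x \<in> carrier_mat d 1" "VU\<^sup>T * x = 0\<^sub>m r 1" for x
  proof (rule Gb[OF x(1)])
    have [simp]: "dim_row x = d" "dim_col x = 1" using x by auto
    show "U\<^sup>T * x = 0\<^sub>m r 1" by (simp add: UV mat_normalize x(2))
  qed
  have ZU: "Z = U * U\<^sup>T"
    by (rule g_minimizer_unique[OF Z U V VV UU _ G GV tau(2) Gb' rip \<delta>]) simp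
  \<comment> \<open>The part of G acting on the complement of VU: G equals lam on the columns of VU,
    and the removed lam is exactly what turns s into s + lam.\<close>
  define E where "E = G - lam \<cdot>\<^sub>m (VU * VU\<^sup>T)"
  have [simp]: "dim_row E = d" "dim_col E = d" by (auto simp: E_def)
  have Ec: "E \<in> carrier_mat d d" by (auto intro: carrier_matI)
  have ET: "E\<^sup>T = E" by (simp add: E_def mat_normalize GT)
  have symE: "sym_mat d E" using ET Ec by (simp add: sym_mat_def)
  have EV: "E * VU = 0\<^sub>m d r"
    by (simp add: E_def mat_normalize GV VV) (rule eq_matI, auto)
  have Eb: "\<bar>x \<bullet>\<^sub>F (E * x)\<bar> \<le> \<tau> * (x \<bullet>\<^sub>F x)" if x: "x \<in> carrier_mat d 1" for x
  proof -
    have [simp]: "dim_row x = d" "dim_col x = 1" using x by auto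
    define u where "u = VU * (VU\<^sup>T * x)"
    define z where "z = x - u"
    have [simp]: "dim_row u = d" "dim_col u = 1" "dim_row z = d" "dim_col z = 1" by (auto simp: u_def z_def)
    have Vz: "VU\<^sup>T * z = 0\<^sub>m r 1" by (simp add: z_def u_def mat_normalize V_cancel) (rule eq_matI, auto)
    have Eu: "E * u = 0\<^sub>m d 1" unfolding u_def using mat_mult_cancel_left[OF EV, of "VU\<^sup>T * x"] by (simp add: mat_zero_mult)
    have Ez: "E * z = E * x" by (simp add: z_def mat_normalize Eu) (rule eq_matI, auto)
    have "x \<bullet>\<^sub>F (E * x) = x \<bullet>\<^sub>F (E * z)" by (simp add: Ez)
    also have "\<dots> = (E * x) \<bullet>\<^sub>F z" by (subst frob_inner_mult_left) (auto simp: ET)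
    also have "\<dots> = z \<bullet>\<^sub>F (E * z)" by (simp add: Ez frob_inner_commute)
    also have "\<dots> = z \<bullet>\<^sub>F (G * z)"
      by (simp add: E_def mat_normalize Vz frob_inner_linear)
    finally have "\<bar>x \<bullet>\<^sub>F (E * x)\<bar> \<le> \<tau> * (z \<bullet>\<^sub>F z)" using Gb'[of z] Vz carrier_matI[of z d 1] by simp
    also have "z \<bullet>\<^sub>F z \<le> x \<bullet>\<^sub>F x"
    proof -
      have "u \<bullet>\<^sub>F z = (VU\<^sup>T * x) \<bullet>\<^sub>F (VU\<^sup>T * z)" unfolding u_def by (subst frob_inner_mult_left) auto
      then have uz: "u \<bullet>\<^sub>F z = 0" unfolding Vz by simp
      have "x = u + z" by (rule eq_matI) (auto simp: z_def)
      then have "x \<bullet>\<^sub>F x = (u + z) \<bullet>\<^sub>F (u + z)" by simp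
      also have "\<dots> = u \<bullet>\<^sub>F u + z \<bullet>\<^sub>F z"
        using uz frob_inner_commute[of u z] by (simp add: frob_inner_linear)
      finally show ?thesis by simp
    qed
    finally show ?thesis using tau(1) by (simp add: mult_left_mono)
  qed
  have Ele: "(E * Y) \<bullet>\<^sub>F (E * Y) \<le> \<tau>\<^sup>2 * (Y \<bullet>\<^sub>F Y)" if "Y \<in> carrier_mat d r" for Y
    using sym_form_bound_operator[OF symE form_bound_cols[OF Ec Eb] that] by blast
  have "deb_input d n X y Z = U * U\<^sup>T + G"
    unfolding ZU G deb_input_def backproj_def meas_def ..
  also have "\<dots> = VU * mat_diag r (\<lambda>i. s i + lam) * VU\<^sup>T + E"
  proof -
    have "mat_diag r (\<lambda>i. s i + lam) = mat_diag r s + lam \<cdot>\<^sub>m 1\<^sub>m r" by (rule eq_matI) (auto simp: mat_diag_def)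
    then have "VU * mat_diag r (\<lambda>i. s i + lam) * VU\<^sup>T = U * U\<^sup>T + lam \<cdot>\<^sub>m (VU * VU\<^sup>T)"
      unfolding UU by (simp add: mat_normalize)
    then show ?thesis unfolding E_def by (intro eq_matI) auto
  qed
  finally have deb: "deb_input d n X y Z = VU * mat_diag r (\<lambda>i. s i + lam) * VU\<^sup>T + E" .
  show ?thesis unfolding deb
  proof (rule best_rank_approx_unique[OF V VV symE EV tau(1) _ Ele])
    show "\<tau> < s i + lam" if "i < r" for i using s[OF that] tau(2) by linarith
  qed
qed

lemma (in sym_design) debiased_estimators:
  fixes V M U Z :: "real mat" and lv eps :: "nat \<Rightarrow> real" and r :: nat and sigma lam C C5 c0 K :: real
  defines "y \<equiv> obs n X M eps" and "lr \<equiv> Min (lv ` {..<r})"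
  assumes pos: "0 < d" "0 < n" "0 < r" "0 < sigma" "0 \<le> C"
    and V: "V \<in> carrier_mat d r" "V\<^sup>T * V = 1\<^sub>m r" and lv: "\<And>i. i < r \<Longrightarrow> 0 < lv i"
    and M: "M = sqrt (real d) \<cdot>\<^sub>m (V * mat_diag r lv * V\<^sup>T)"
    and K: "K = 14 * C + 12 * C5" and lr: "(K + 81) * sqrt (real r) * sigma < lr"
    and lam: "11 * sqrt (real d) * sigma \<le> lam" "lam \<le> C5 * sqrt (real d) * sigma"
    and c0: "0 < c0" "c0 \<le> 1/10" "2 * c0 * K \<le> 1"
    and good: "good_event d n r sigma (c0 / sqrt (real r)) C X eps"
    and st: "f_stationary_2nd d r n X y lam U" and Z: "g_minimizer d n X y lam Z"
  shows "\<exists>VU s W. svd_form d r U VU s W"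
    and "svd_form d r U VU s W \<Longrightarrow>
      best_rank_approx r (deb_input d n X y Z) Y \<longleftrightarrow> Y = VU * mat_diag r (\<lambda>i. s i + lam) * VU\<^sup>T"
    and "svd_form d r U VU s W \<Longrightarrow>
      U_deb r lam U * (U_deb r lam U)\<^sup>T = VU * mat_diag r (\<lambda>i. s i + lam) * VU\<^sup>T"
proof -
  define b where "b = sigma * sqrt (real d)"
  define q where "q = sqrt (real r)"
  define \<delta> where "\<delta> = c0 / q"
  have b: "0 < b" using pos by (simp add: b_def)
  have q: "1 \<le> q" using pos by (simp add: q_def)
  have lamb: "11 * b \<le> lam" "lam \<le> C5 * b" using lam by (simp_all add: b_def mult_ac)
  have lam0: "0 \<le> lam" using lamb b by linarith
  \<comment> \<open>Forced by 11 b <= lam <= C5 b with b > 0.\<close>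
  have C5: "0 \<le> C5"
  proof (rule ccontr)
    assume "\<not> 0 \<le> C5"
    then have "C5 * b < 0" using b by (simp add: mult_neg_pos)
    then show False using lamb lam0 by linarith
  qed
  have K0: "0 \<le> K" using pos C5 by (simp add: K)
  have \<delta>: "0 \<le> \<delta>" "\<delta> \<le> 1/10"
  proof -
    show "0 \<le> \<delta>" using c0 q by (simp add: \<delta>_def)
    have "\<delta> \<le> c0" using c0 q by (simp add: \<delta>_def field_simps)
    then show "\<delta> \<le> 1/10" using c0 by linarith
  qed
  have U: "U \<in> carrier_mat d r" using st by (simp add: f_stationary_2nd_def)
  have [simp]: "dim_row U = d" "dim_col U = r" "dim_row V = d" "dim_col V = r" using U V by auto

  define l where "l i = sqrt (real d) * lv i" for i
  have Ml: "M = V * mat_diag r l * V\<^sup>T"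
  proof -
    have "mat_diag r l = sqrt (real d) \<cdot>\<^sub>m mat_diag r lv" by (rule eq_matI) (auto simp: mat_diag_def l_def)
    then show ?thesis unfolding M by (simp add: mat_normalize)
  qed
  have [simp]: "dim_row M = d" "dim_col M = d" by (auto simp: Ml)
  have Mc: "M \<in> carrier_mat d d" by (auto intro: carrier_matI)
  define m where "m = sqrt (real d) * lr"
  have ml: "m \<le> l i" if "i < r" for i
    unfolding m_def l_def lr_def using that by (intro mult_left_mono Min_le) auto
  have l0: "0 \<le> l i" if "i < r" for i using lv[OF that] by (simp add: l_def)

  define L0 where "L0 = V * mat_diag r (\<lambda>i. sqrt (l i))"
  have L0: "L0 \<in> carrier_mat d r" by (auto simp: L0_def intro: carrier_matI)
  have [simp]: "dim_row L0 = d" "dim_col L0 = r" using L0 by auto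
  obtain R where R: "orth_mat r R" "psd_mat r (U\<^sup>T * (L0 * R))" using procrustes_alignment[OF U L0] by blast
  note [simp] = orth_matD(1,2)[OF R(1)]
  define L where "L = L0 * R"
  have L: "L \<in> carrier_mat d r" by (auto simp: L_def intro: carrier_matI)
  have LL: "L * L\<^sup>T = M"
  proof -
    have "mat_diag r (\<lambda>i. sqrt (l i) * sqrt (l i)) = mat_diag r l" by (rule mat_diag_cong) (simp add: l0)
    then show ?thesis
      by (simp add: L_def L0_def Ml mat_normalize orth_mat_cancel[OF R(1)] mat_diag_mult_cancel)
  qed

  have rip: "rip d (2 * r) n X \<delta>"
    using good unfolding good_event_def rip_def meas_def frob_norm_sq \<delta>_def q_def by blast
  have n0: "sqrt (real n) * sqrt (real n) = real n" "sqrt (real n) > 0" using pos by auto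
  define \<nu> where "\<nu> = C * sigma * (sqrt (real d) * q)"
  have noise: "\<bar>\<Sum>i<n. eps i * meas n X A i\<bar> \<le> \<nu> * frob_norm A" if A: "sym_mat d A" "mrank A \<le> 2 * r" for A
  proof -
    define S where "S = (\<Sum>i<n. eps i * (X i \<bullet>\<^sub>F A))"
    have "\<bar>S / real n\<bar> \<le> C * sigma * sqrt (real d * real r / real n) * frob_norm A"
      using good A unfolding good_event_def S_def by blast
    \<comment> \<open>The event normalizes the noise by 1 / n but \<open>meas\<close> carries 1 /
      sqrt n; multiplying by sqrt n removes n from the bound.\<close>
    then have "sqrt (real n) * \<bar>S / real n\<bar> \<le> sqrt (real n) * (C * sigma * sqrt (real d * real r / real n) * frob_norm A)"
      using n0 by (intro mult_left_mono) auto
    also have "\<dots> = \<nu> * frob_norm A"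
      using n0 by (simp add: \<nu>_def q_def real_sqrt_divide real_sqrt_mult)
    also have "sqrt (real n) * \<bar>S / real n\<bar> = \<bar>S / sqrt (real n)\<bar>"
      by (subst (2) n0(1)[symmetric]) (use n0 in \<open>simp add: abs_mult abs_divide field_simps\<close>)
    also have "S / sqrt (real n) = (\<Sum>i<n. eps i * meas n X A i)"
      by (simp add: S_def meas_def sum_divide_distrib)
    finally show ?thesis .
  qed
  have yi: "y i = meas n X M i + eps i" for i by (simp add: y_def obs_def meas_def)

  define D where "D = U * U\<^sup>T - M"
  have [simp]: "dim_row D = d" "dim_col D = d" by (auto simp: D_def)
  have Dc: "D \<in> carrier_mat d d" "U * U\<^sup>T \<in> carrier_mat d d" by (auto intro: carrier_matI)
  define e where "e = K * b * q"
  have De: "frob_norm D \<le> e"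
  proof -
    have "frob_norm (U * U\<^sup>T - L * L\<^sup>T) \<le> 14 * \<nu> + 12 * lam * sqrt (real r)"
      using R(2) yi \<delta>(2) noise pos lam0 q
      by (intro stationary_point_error[OF st L _ _ rip]) (auto simp: LL L_def[symmetric] \<nu>_def)
    also have "\<dots> \<le> 14 * (C * b * q) + 12 * (C5 * b * q)"
      using mult_right_mono[OF lamb(2), of q] q by (simp add: \<nu>_def b_def q_def mult_ac)
    also have "\<dots> = e" by (simp add: e_def K algebra_simps)
    finally show ?thesis by (simp add: D_def LL)
  qed
  have symD: "sym_mat d D"
    by (auto simp: sym_mat_def D_def Ml mat_normalize intro: carrier_matI)
  have rankD: "mrank D \<le> 2 * r"
  proof -
    have "D = U * U\<^sup>T + V * ((-1) \<cdot>\<^sub>m (mat_diag r l * V\<^sup>T))"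
      unfolding D_def Ml by (simp add: mat_normalize) (rule eq_matI, auto)
    then have "mrank D \<le> mrank (U * U\<^sup>T) + mrank (V * ((-1) \<cdot>\<^sub>m (mat_diag r l * V\<^sup>T)))"
      using mrank_add_le[of "U * U\<^sup>T" d d "V * ((-1) \<cdot>\<^sub>m (mat_diag r l * V\<^sup>T))"]
        carrier_matI[of "V * ((-1) \<cdot>\<^sub>m (mat_diag r l * V\<^sup>T))" d d] Dc by simp
    then show ?thesis
      using mrank_mult_le[of U "U\<^sup>T"] mrank_mult_le[of V "(-1) \<cdot>\<^sub>m (mat_diag r l * V\<^sup>T)"] by simp
  qed

  define G where "G = backproj d n X (\<lambda>i. y i - meas n X (U * U\<^sup>T) i)"
  have [simp]: "dim_row G = d" "dim_col G = d" by (auto simp: G_def)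
  have symG: "sym_mat d G" unfolding G_def by (rule sym_mat_backproj)
  have GU: "G * U = lam \<cdot>\<^sub>m U" unfolding G_def by (rule f_stationary_gradient[OF st])
  define H where "H = G + D"
  have [simp]: "dim_row H = d" "dim_col H = d" by (auto simp: H_def)
  have symH: "sym_mat d H"
    using symG symD by (auto simp: sym_mat_def H_def mat_normalize)
  define N where "N = mat d d (\<lambda>(a,b). (\<Sum>i<n. eps i * X i $$ (a,b)) / real n)"
  have [simp]: "dim_row N = d" "dim_col N = d" by (auto simp: N_def)
  have Hb: "\<bar>x \<bullet>\<^sub>F (H * x)\<bar> \<le> 9 * b * (x \<bullet>\<^sub>F x)" if x: "x \<in> carrier_mat d 1" for x
  proof -
    have [simp]: "dim_row x = d" "dim_col x = 1" using x by auto
    have xxc: "x * x\<^sup>T \<in> carrier_mat d d" by (auto intro: carrier_matI)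
    have form: "x \<bullet>\<^sub>F (A * x) = A \<bullet>\<^sub>F (x * x\<^sup>T)" if "dim_row A = d" "dim_col A = d" for A
    proof -
      have "x \<bullet>\<^sub>F (A * x) = (A * x) \<bullet>\<^sub>F x" using that by (simp add: frob_inner_commute)
      also have "\<dots> = A \<bullet>\<^sub>F (x * x\<^sup>T)" using that by (subst frob_inner_mult_right) simp_all
      finally show ?thesis .
    qed
    define T where "T = (\<Sum>i<n. meas n X D i * meas n X (x * x\<^sup>T) i)"
    have "G \<bullet>\<^sub>F (x * x\<^sup>T) = (\<Sum>i<n. (eps i - meas n X D i) * meas n X (x * x\<^sup>T) i)"
      unfolding G_def backproj_inner[OF xxc]
      using Mc Dc by (intro sum.cong refl) (simp add: yi D_def meas_linear)
    also have "\<dots> = (\<Sum>i<n. eps i * meas n X (x * x\<^sup>T) i) - T"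
      by (simp add: T_def left_diff_distrib sum_subtractf)
    also have "(\<Sum>i<n. eps i * meas n X (x * x\<^sup>T) i) = backproj d n X eps \<bullet>\<^sub>F (x * x\<^sup>T)"
      by (simp add: backproj_inner[OF xxc])
    also have "backproj d n X eps = sqrt (real n) \<cdot>\<^sub>m N"
    proof (rule eq_matI)
      fix i j assume "i < dim_row (sqrt (real n) \<cdot>\<^sub>m N)" "j < dim_col (sqrt (real n) \<cdot>\<^sub>m N)"
      moreover have "z / sqrt (real n) = sqrt (real n) * (z / real n)" for z
        by (subst (3) n0(1)[symmetric]) (use n0 in \<open>simp add: field_simps\<close>)
      ultimately show "backproj d n X eps $$ (i,j) = (sqrt (real n) \<cdot>\<^sub>m N) $$ (i,j)"
        by (simp add: backproj_def N_def)
    qed (auto simp: N_def)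
    finally have Gx: "G \<bullet>\<^sub>F (x * x\<^sup>T) = sqrt (real n) * (x \<bullet>\<^sub>F (N * x)) - T"
      by (simp add: form frob_inner_linear)
    have Hx: "x \<bullet>\<^sub>F (H * x) = sqrt (real n) * (x \<bullet>\<^sub>F (N * x)) - (T - D \<bullet>\<^sub>F (x * x\<^sup>T))"
      by (simp add: form[of H]) (simp add: H_def frob_inner_linear Gx)
    have "spec_norm N \<le> 8 * sigma * sqrt (real d / real n)" using good unfolding good_event_def N_def by blast
    then have "spec_norm N * (x \<bullet>\<^sub>F x) \<le> 8 * sigma * sqrt (real d / real n) * (x \<bullet>\<^sub>F x)"
      by (rule mult_right_mono) simp
    then have "\<bar>x \<bullet>\<^sub>F (N * x)\<bar> \<le> 8 * sigma * sqrt (real d / real n) * (x \<bullet>\<^sub>F x)"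
      using spec_norm_form_bound[of N d x] x carrier_matI[of N d d] by simp
    then have "sqrt (real n) * \<bar>x \<bullet>\<^sub>F (N * x)\<bar> \<le> sqrt (real n) * (8 * sigma * sqrt (real d / real n) * (x \<bullet>\<^sub>F x))"
      using n0 by (intro mult_left_mono) auto
    also have "\<dots> = 8 * b * (x \<bullet>\<^sub>F x)" using n0 by (simp add: b_def real_sqrt_divide)
    finally have 1: "\<bar>sqrt (real n) * (x \<bullet>\<^sub>F (N * x))\<bar> \<le> 8 * b * (x \<bullet>\<^sub>F x)" by (simp add: abs_mult)
    have "\<bar>T - D \<bullet>\<^sub>F (x * x\<^sup>T)\<bar> \<le> 2 * \<delta> * frob_norm D * (x \<bullet>\<^sub>F x)"
      unfolding T_def by (rule isometry_defect_bound[OF rip pos(3) \<delta>(1) symD rankD x])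
    also have "\<dots> \<le> 2 * \<delta> * e * (x \<bullet>\<^sub>F x)"
      using De \<delta>(1) by (intro mult_right_mono mult_left_mono) auto
    \<comment> \<open>The q = sqrt r in the error bound cancels the one in \<delta>, so that the
      defect is of the order of b.\<close>
    also have "2 * \<delta> * e = (2 * c0 * K) * b" using q by (simp add: \<delta>_def e_def)
    also have "\<dots> * (x \<bullet>\<^sub>F x) \<le> 1 * b * (x \<bullet>\<^sub>F x)"
      using c0(3) b by (intro mult_right_mono) auto
    finally have "\<bar>T - D \<bullet>\<^sub>F (x * x\<^sup>T)\<bar> \<le> b * (x \<bullet>\<^sub>F x)" by simp
    then show ?thesis unfolding Hx using 1 by (simp add: algebra_simps)
  qed
  have me: "81 * b < m - e"
  proof -
    have "sqrt (real d) * ((K + 81) * q * sigma) < sqrt (real d) * lr"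
      using lr pos unfolding q_def by (intro mult_strict_left_mono) auto
    then have "(K + 81) * b * q < m" by (simp add: m_def b_def mult_ac)
    then have "81 * b * q < m - e" by (simp add: e_def algebra_simps)
    moreover have "81 * b * 1 \<le> 81 * b * q" using b q by (intro mult_left_mono) auto
    ultimately show ?thesis by linarith
  qed
  have GHD: "G = H - (U * U\<^sup>T - M)" unfolding H_def D_def[symmetric] by (rule eq_matI) auto
  have certificate: "a \<in> carrier_mat r 1 \<Longrightarrow> (m - e) * (a \<bullet>\<^sub>F a) \<le> (U * a) \<bullet>\<^sub>F (U * a)"
    "x \<in> carrier_mat d 1 \<Longrightarrow> U\<^sup>T * x = 0\<^sub>m r 1 \<Longrightarrow> \<bar>x \<bullet>\<^sub>F (G * x)\<bar> \<le> (9 * b + (9 * b)\<^sup>2 / (m - e)) * (x \<bullet>\<^sub>F x)" for a x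
    using dual_certificate_bounds[OF U V Ml ml symH Hb GHD GU _ _ De[unfolded D_def]] me b lamb by auto
  show "\<exists>VU s W. svd_form d r U VU s W"
    by (rule svd_form_exists[OF U _ certificate(1)]) (use me b in linarith)
  show "U_deb r lam U * (U_deb r lam U)\<^sup>T = VU * mat_diag r (\<lambda>i. s i + lam) * VU\<^sup>T"
    if "svd_form d r U VU s W" using U_deb_svd[OF that lam0] .
  \<comment> \<open>81 is the square of 9: the Schur complement correction costs one further
    b.\<close>
  have "(9 * b)\<^sup>2 / (m - e) \<le> (9 * b)\<^sup>2 / (81 * b)"
    using me b by (intro divide_left_mono) auto
  also have "\<dots> = b" using b by (simp add: power2_eq_square)
  finally have tau: "9 * b + (9 * b)\<^sup>2 / (m - e) \<le> 10 * b" by linarith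
  have Gb: "\<bar>x \<bullet>\<^sub>F (G * x)\<bar> \<le> 10 * b * (x \<bullet>\<^sub>F x)" if "x \<in> carrier_mat d 1" "U\<^sup>T * x = 0\<^sub>m r 1" for x
    using certificate(2)[OF that] mult_right_mono[OF tau frob_inner_nonneg[of x]] by linarith
  show "best_rank_approx r (deb_input d n X y Z) Y \<longleftrightarrow> Y = VU * mat_diag r (\<lambda>i. s i + lam) * VU\<^sup>T"
    if "svd_form d r U VU s W"
    by (rule debiased_of_certificate[OF that U Z G_def GU _ _ Gb rip]) (use b lamb \<delta> in auto)
qed

theorem theorem5:
  shows "\<forall>\<kappa>::real>0. \<forall>c::real>0. \<forall>C::real>0. \<exists>C4\<^sub>0::real. \<forall>C4 C5. C4\<^sub>0 \<le> C4 \<and> C4 \<le> C5 \<longrightarrow>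
    (\<exists>C1\<^sub>0. \<forall>C1 C2. C1\<^sub>0 \<le> C1 \<and> C1 < C2 \<longrightarrow>
    (\<exists>C3\<^sub>0::real. \<forall>C3::real. C3\<^sub>0 \<le> C3 \<longrightarrow>
    (\<exists>c0\<^sub>0>0. \<forall>c0. 0 < c0 \<and> c0 \<le> c0\<^sub>0 \<longrightarrow>
    (\<forall>(d::nat) (n::nat) (r::nat) (sigma::real) (V::real mat) (lv::nat \<Rightarrow> real) (M::real mat)
       (lam::real) (X::nat \<Rightarrow> real mat) (eps::nat \<Rightarrow> real) (U::real mat) (Z::real mat).
     let y = obs n X M eps; lr = Min (lv ` {..<r}) in
       0 < d \<and> 0 < n \<and> 0 < r \<and> sigma > c \<and>
       \<comment> \<open>Assumption 1\<close>
       V \<in> carrier_mat d r \<and> V\<^sup>T * V = 1\<^sub>m r \<and> (\<forall>i<r. lv i > 0) \<and>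
       M = sqrt d \<cdot>\<^sub>m (V * mat_diag r lv * V\<^sup>T) \<and>
       C1 * sqrt r < lr / sigma \<and> lr / sigma < C2 * sqrt r \<and>
       spec_norm M / (lr * sqrt d) \<le> \<kappa> \<and>
       \<comment> \<open>Assumption 2\<close>
       real n / (real d * real r) \<ge> C3 * real r \<and>
       \<comment> \<open>Assumption 3\<close>
       C4 * sqrt d \<le> lam / sigma \<and> lam / sigma \<le> C5 * sqrt d \<and>
       \<comment> \<open>design matrices are symmetric, and the event E_Good with delta_2r = c0/sqrt r\<close>
       (\<forall>i<n. sym_mat d (X i)) \<and>
       good_event d n r sigma (c0 / sqrt r) C X eps \<and>
       f_stationary_2nd d r n X y lam U \<and>
       g_minimizer d n X y lam Z
     \<longrightarrow>
       (\<exists>VU s W. svd_form d r U VU s W) \<and>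
       (\<forall>VU s W. svd_form d r U VU s W \<longrightarrow>
          (\<forall>Y. best_rank_approx r (deb_input d n X y Z) Y \<longleftrightarrow>
               Y = VU * mat_diag r (\<lambda>i. s i + lam) * VU\<^sup>T) \<and>
          U_deb r lam U * (U_deb r lam U)\<^sup>T = VU * mat_diag r (\<lambda>i. s i + lam) * VU\<^sup>T)))))"
proof (intro allI impI, goal_cases)
  case (1 \<kappa> c C)
  then have C: "0 < C" and c: "0 < c" by auto
  show ?case
  \<comment> \<open>Any threshold above 10 would exceed the bound 10 b on the complement.\<close>
  proof (rule exI[of _ 11], intro allI impI, goal_cases)
    case (1 C4 C5)
    define K where "K = 14 * C + 12 * C5"
    have K: "0 < K" using 1 C by (simp add: K_def)
    show ?case
    \<comment> \<open>K depends on C5, so the threshold for C1 can be fixed only after C5; K covers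
      the Frobenius error e and 81 the remaining gap m - e.\<close>
    proof (rule exI[of _ "K + 81"], intro allI impI, rule exI[of _ 0], intro allI impI, goal_cases)
      case (1 C1 C2 C3)
      then have C1: "K + 81 \<le> C1" by auto
      \<comment> \<open>1/10 serves the Frobenius error estimate, 1 / (2 K) keeps the isometry
        defect below b.\<close>
      define c00 where "c00 = min (1/10) (1 / (2 * K))"
      have c00: "0 < c00" "c00 \<le> 1/10" "c00 \<le> 1 / (2 * K)" using K by (auto simp: c00_def)
      show ?case
      proof (rule exI[of _ c00], rule conjI[OF c00(1)], intro allI impI, unfold Let_def, rule impI, goal_cases)
        case (1 c0 d n r sigma V lv M lam X eps U Z)
        let ?lr = "Min (lv ` {..<r})"
        have h: "0 < c0" "c0 \<le> c00" "0 < d" "0 < n" "0 < r" "c < sigma" "V \<in> carrier_mat d r" "V\<^sup>T * V = 1\<^sub>m r"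
          "\<And>i. i < r \<Longrightarrow> 0 < lv i" "M = sqrt d \<cdot>\<^sub>m (V * mat_diag r lv * V\<^sup>T)"
          "C1 * sqrt r < ?lr / sigma" "C4 * sqrt d \<le> lam / sigma" "lam / sigma \<le> C5 * sqrt d"
          "\<And>i. i < n \<Longrightarrow> sym_mat d (X i)" "good_event d n r sigma (c0 / sqrt r) C X eps"
          "f_stationary_2nd d r n X (obs n X M eps) lam U" "g_minimizer d n X (obs n X M eps) lam Z"
          using 1 by auto
        have sig: "0 < sigma" using h c by linarith
        interpret sym_design d n X by standard (rule h)
        have lr: "(K + 81) * sqrt r * sigma < ?lr"
        proof -
          have "(K + 81) * sqrt r \<le> C1 * sqrt r" using C1 by (intro mult_right_mono) auto
          then have "(K + 81) * sqrt r < ?lr / sigma" using h(11) by linarith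
          then show ?thesis using sig by (simp add: pos_less_divide_eq)
        qed
        have lam1: "11 * sqrt d * sigma \<le> lam"
        proof -
          have "11 * sqrt d \<le> C4 * sqrt d" using \<open>11 \<le> C4 \<and> C4 \<le> C5\<close> by (intro mult_right_mono) auto
          then have "11 * sqrt d \<le> lam / sigma" using h(12) by linarith
          then show ?thesis using sig by (simp add: pos_le_divide_eq)
        qed
        have lam2: "lam \<le> C5 * sqrt d * sigma" using h(13) sig by (simp add: pos_divide_le_eq)
        have "c0 \<le> 1 / (2 * K)" using h(2) c00(3) by linarith
        then have c0: "0 < c0" "c0 \<le> 1/10" "2 * c0 * K \<le> 1"
          using h(1,2) c00(2) K by (auto simp: field_simps)
        note res = debiased_estimators[OF h(3-5) sig less_imp_le[OF C] h(7-10) K_def lr lam1 lam2 c0 h(15-17)]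
        show ?case using res by blast
      qed
    qed
  qed
qed

end
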